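(* There exists an integer $d_0>0$ such that for every fixed integer $d\geq d_0$, if $G$ is the uniformly random $d$-regular graph on the vertex set $[n]$ (with $dn$ even), then with probability tending to $1$ as $n\to\infty$, Maker has a winning strategy in the Maker-Breaker Hamiltonicity game played on the edges of $G$.
   Context: The Maker-Breaker Hamiltonicity game on a graph $G$: two players, Maker and Breaker, alternately claim one previously unclaimed edge of $G$ per turn, Breaker moving first, until all edges are claimed. Maker wins if the graph formed by Maker's edges (on the vertex set of $G$) contains a Hamilton cycle; otherwise Breaker wins. Maker has a winning strategy if Maker can guarantee a win against every strategy of Breaker. *)

theory Defs
  imports "HOL-Probability.Probability"
begin

definition simple_graph :: "'v set \<Rightarrow> 'v set set \<Rightarrow> bool" where
  "simple_graph V E \<longleftrightarrow> finite V \<and> E \<subseteq> {e. e \<subseteq> V \<and> card e = 2}"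

definition degree :: "'v set set \<Rightarrow> 'v \<Rightarrow> nat" where
  "degree E v = card {e \<in> E. v \<in> e}"

definition regular_graph :: "nat \<Rightarrow> 'v set \<Rightarrow> 'v set set \<Rightarrow> bool" where
  "regular_graph d V E \<longleftrightarrow> simple_graph V E \<and> (\<forall>v\<in>V. degree E v = d)"

text \<open>
  The edge set of a uniformly random labelled \<open>d\<close>-regular graph on \<open>{1..n}\<close>.
  This is meaningful only if such a graph exists, that is, if \<open>d * n\<close> is even and \<open>d < n\<close>
  (or \<open>n = 0\<close>); otherwise \<^const>\<open>pmf_of_set\<close> is applied to the empty set and
  gives an unspecified distribution.
\<close>

definition random_regular_graph :: "nat \<Rightarrow> nat \<Rightarrow> nat set set pmf" where
  "random_regular_graph d n = pmf_of_set {E. regular_graph d {1..n} E}"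

text \<open>
  A Hamilton cycle is given by the cyclic sequence of its vertices. The length bound
  excludes the degenerate cycles on at most two vertices.
\<close>

definition hamilton_cycle :: "'v set \<Rightarrow> 'v set set \<Rightarrow> 'v list \<Rightarrow> bool" where
  "hamilton_cycle V E vs \<longleftrightarrow>
     length vs \<ge> 3 \<and> distinct vs \<and> set vs = V \<and>
     (\<forall>i<length vs. {vs ! i, vs ! (Suc i mod length vs)} \<in> E)"

definition hamiltonian :: "'v set \<Rightarrow> 'v set set \<Rightarrow> bool" where
  "hamiltonian V E \<longleftrightarrow> (\<exists>vs. hamilton_cycle V E vs)"

text \<open>
  A strategy on the board \<open>X\<close> maps the list of the elements claimed so far, by both
  players and in the order in which they were claimed, to the element to be claimed next.
  It has to name an unclaimed element as long as there is one.
\<close>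

type_synonym 'e strategy = "'e list \<Rightarrow> 'e"

definition legal_strategy :: "'e set \<Rightarrow> 'e strategy \<Rightarrow> bool" where
  "legal_strategy X \<sigma> \<longleftrightarrow> (\<forall>h. distinct h \<and> set h \<subset> X \<longrightarrow> \<sigma> h \<in> X - set h)"

text \<open>The first \<open>k\<close> moves when Breaker, who starts, plays \<open>\<beta>\<close> and Maker plays \<open>\<mu>\<close>.\<close>

fun play :: "'e strategy \<Rightarrow> 'e strategy \<Rightarrow> nat \<Rightarrow> 'e list" where
  "play \<beta> \<mu> 0 = []"
| "play \<beta> \<mu> (Suc k) =
     (let h = play \<beta> \<mu> k in h @ [if even k then \<beta> h else \<mu> h])"

definition maker_claimed :: "'e list \<Rightarrow> 'e set" where
  "maker_claimed h = set (nths h {i. odd i})"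

text \<open>
  Here \<open>W\<close> says which sets of claimed elements are a win for Maker. The game on the finite
  board \<open>X\<close> is over after \<open>card X\<close> moves.
\<close>

definition maker_winning_strategy :: "'e set \<Rightarrow> ('e set \<Rightarrow> bool) \<Rightarrow> 'e strategy \<Rightarrow> bool" where
  "maker_winning_strategy X W \<mu> \<longleftrightarrow>
     legal_strategy X \<mu> \<and>
     (\<forall>\<beta>. legal_strategy X \<beta> \<longrightarrow> W (maker_claimed (play \<beta> \<mu> (card X))))"

definition maker_wins_hamiltonicity :: "'v set \<Rightarrow> 'v set set \<Rightarrow> bool" where
  "maker_wins_hamiltonicity V E \<longleftrightarrow> (\<exists>\<mu>. maker_winning_strategy E (hamiltonian V) \<mu>)"

lemma finite_regular_graphs: "finite V \<Longrightarrow> finite {E. regular_graph d V E}"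
  by (rule finite_subset[of _ "Pow (Pow V)"]) (auto simp: regular_graph_def simple_graph_def)

lemma length_play [simp]: "length (play \<beta> \<mu> k) = k"
  by (induction k) (auto simp: Let_def)

lemma play_legal:
  assumes "finite X" "legal_strategy X \<beta>" "legal_strategy X \<mu>" "k \<le> card X"
  shows "distinct (play \<beta> \<mu> k) \<and> set (play \<beta> \<mu> k) \<subseteq> X"
  using assms(4)
proof (induction k)
  case 0
  then show ?case by simp
next
  case (Suc k)
  let ?h = "play \<beta> \<mu> k"
  have h: "distinct ?h" "set ?h \<subseteq> X" using Suc by auto
  have "card (set ?h) = k" using distinct_card[OF h(1)] by simp
  with Suc.prems h have "set ?h \<subset> X" by auto
  with h assms(2,3) have "\<beta> ?h \<in> X - set ?h" "\<mu> ?h \<in> X - set ?h"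
    unfolding legal_strategy_def by blast+
  with h show ?case by (auto simp: Let_def)
qed

lemma set_play_card:
  assumes "finite X" "legal_strategy X \<beta>" "legal_strategy X \<mu>"
  shows "set (play \<beta> \<mu> (card X)) = X"
  using play_legal[OF assms order.refl] distinct_card[of "play \<beta> \<mu> (card X)"]
  by (simp add: assms(1) card_subset_eq)

lemma legal_strategy_exists: "\<exists>\<sigma>. legal_strategy X \<sigma>"
proof
  show "legal_strategy X (\<lambda>h. SOME e. e \<in> X - set h)"
    unfolding legal_strategy_def
    by (intro allI impI) (rule someI_ex, auto)
qed

end

theory Submission
  imports Defs
begin

text \<open>
  Call a graph an expander if every nonempty set \<open>S\<close> of at most \<open>a = n div 2 ^ 37\<close> vertices has more
  than \<open>2 * card S\<close> outside neighbours. By Posa rotations a non-Hamiltonian expander has quadratically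
  many boosters, that is, pairs whose addition creates a Hamilton cycle or lengthens the longest path.
  It therefore suffices that the final graph \<open>M\<close> of Maker contains an expander with at most
  \<open>8 * n\<close> edges and meets the set of boosters of every non-Hamiltonian expander \<open>H \<subseteq> G\<close> with at most
  \<open>9 * n\<close> edges: starting from the former, at most \<open>n\<close> boosters from \<open>M\<close> lead to a Hamilton cycle.

  Maker obtains the sparse expander by a pairing strategy. In a balanced orientation of \<open>G\<close> every
  vertex owns about \<open>d / 2\<close> edges, eight of which are reserved in four pairs; Maker gets
  an edge of every pair. If the reserved edges are chosen at random, they are locally so sparse
  that four owned edges per vertex force expansion. On the other edges Maker plays the Erdos-Selfridge
  strategy for the booster sets, each of which has order \<open>n * d\<close> edges in \<open>G\<close>, whereas the number of
  subgraphs \<open>H\<close> is only \<open>2 ^ (\<epsilon> * n * d)\<close> for large \<open>d\<close>.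

  Both properties of the random regular graph are proved by switchings: replacing two edges \<open>ux\<close> and
  \<open>vy\<close> by \<open>uv\<close> and \<open>xy\<close> shows that a fixed small edge set \<open>F\<close> lies in \<open>G\<close> with probability at most
  \<open>(2 * d / n) ^ card F\<close>, and that, given \<open>H \<subseteq> G\<close>, a fixed quadratic set of pairs contains few edges of \<open>G\<close>
  only with probability exponentially small in \<open>n * d\<close>.
\<close>

section \<open>The pairing and Erdos-Selfridge strategies\<close>

lemma maker_claimed_snoc:
  "maker_claimed (h @ [x]) = (if odd (length h) then insert x (maker_claimed h) else maker_claimed h)"
  unfolding maker_claimed_def by (cases "odd (length h)") (simp_all add: nths_append)

lemma maker_claimed_subset: "maker_claimed h \<subseteq> set h"
  unfolding maker_claimed_def by (rule set_nths_subset)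

text \<open>\<open>K M B\<close> speaks of positions with Breaker to move, so Maker has to restore
  it once per round. On an even board the last round is complete; on an odd board Breaker takes the
  last element alone, hence \<open>win_last\<close> beside \<open>win\<close>.\<close>

lemma maker_wins_by_invariant:
  fixes X :: "'e set" and K :: "'e set \<Rightarrow> 'e set \<Rightarrow> bool"
  assumes fin: "finite X"
    and start: "K {} {}"
    and step: "\<And>M B b. K M B \<Longrightarrow> M \<inter> B = {} \<Longrightarrow> M \<union> B \<subseteq> X \<Longrightarrow> b \<in> X - (M \<union> B) \<Longrightarrow>
      insert b (M \<union> B) \<noteq> X \<Longrightarrow> \<exists>m \<in> X - insert b (M \<union> B). K (insert m M) (insert b B)"
    and win: "\<And>M B. K M B \<Longrightarrow> M \<inter> B = {} \<Longrightarrow> M \<union> B = X \<Longrightarrow> W M"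
    and win_last: "\<And>M B b. K M B \<Longrightarrow> M \<inter> B = {} \<Longrightarrow> b \<notin> M \<union> B \<Longrightarrow> insert b (M \<union> B) = X \<Longrightarrow> W M"
  shows "\<exists>\<mu>. maker_winning_strategy X W \<mu>"
proof -
  let ?mc = maker_claimed
  \<comment> \<open>Here \<open>h\<close> already ends with Breaker's move, so
    \<open>set h - ?mc h\<close> contains that move.\<close>
  define good where "good h m \<longleftrightarrow> m \<in> X - set h \<and> K (insert m (?mc h)) (set h - ?mc h)" for h m
  \<comment> \<open>Some histories admit no good answer; the fallback to any unclaimed element keeps
    \<open>\<mu>\<close> legal on them.\<close>
  define \<mu> where "\<mu> h = (if \<exists>m. good h m then SOME m. good h m else SOME m. m \<in> X - set h)" for h
  have good_\<mu>: "good h (\<mu> h)" if "\<exists>m. good h m" for h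
    using that by (simp add: \<mu>_def someI_ex)
  have legal: "legal_strategy X \<mu>"
    unfolding legal_strategy_def
  proof (intro allI impI)
    fix h assume h: "distinct h \<and> set h \<subset> X"
    show "\<mu> h \<in> X - set h"
    proof (cases "\<exists>m. good h m")
      case True
      then show ?thesis using good_\<mu> by (auto simp: good_def)
    next
      case False
      then have "\<mu> h = (SOME m. m \<in> X - set h)" by (simp add: \<mu>_def)
      moreover have "\<exists>m. m \<in> X - set h" using h by auto
      ultimately show ?thesis by (metis (no_types, lifting) someI_ex)
    qed
  qed
  have "W (?mc (play \<beta> \<mu> (card X)))" if \<beta>: "legal_strategy X \<beta>" for \<beta>
  proof -
    have inv: "K (?mc (play \<beta> \<mu> (2*k))) (set (play \<beta> \<mu> (2*k)) - ?mc (play \<beta> \<mu> (2*k)))"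
      if "2 * k \<le> card X" for k
      using that
    proof (induction k)
      case 0
      then show ?case using start by (simp add: maker_claimed_def)
    next
      case (Suc k)
      define h where "h = play \<beta> \<mu> (2*k)"
      define b where "b = \<beta> h"
      define m where "m = \<mu> (h @ [b])"
      have h1: "play \<beta> \<mu> (Suc (2*k)) = h @ [b]"
        by (simp add: Let_def h_def b_def)
      have h2: "play \<beta> \<mu> (2 * Suc k) = (h @ [b]) @ [m]"
        unfolding mult_Suc_right add_2_eq_Suc play.simps(2)[of _ _ "Suc (2 * k)"] Let_def h1 m_def by simp
      have dh: "distinct (h @ [b])" "set (h @ [b]) \<subseteq> X"
        using play_legal[OF fin \<beta> legal, of "Suc (2*k)"] Suc.prems h1 by auto
      have len: "length h = 2 * k" by (simp add: h_def)
      have cards: "card (set (h @ [b])) = Suc (2*k)"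
        using distinct_card[OF dh(1)] len by simp
      have IH: "K (?mc h) (set h - ?mc h)" using Suc by (simp add: h_def)
      have un: "?mc h \<union> (set h - ?mc h) = set h" using maker_claimed_subset[of h] by auto
      have "\<exists>m \<in> X - insert b (?mc h \<union> (set h - ?mc h)). K (insert m (?mc h)) (insert b (set h - ?mc h))"
      proof (rule step[OF IH])
        show "insert b (?mc h \<union> (set h - ?mc h)) \<noteq> X"
          unfolding un using cards Suc.prems by auto
      qed (use dh un in auto)
      moreover have mch: "?mc (h @ [b]) = ?mc h" using len by (simp add: maker_claimed_snoc)
      moreover have bh: "insert b (set h - ?mc h) = set (h @ [b]) - ?mc (h @ [b])"
        using dh(1) maker_claimed_subset[of h] mch by auto
      ultimately have "\<exists>m. good (h @ [b]) m" unfolding good_def un by auto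
      from good_\<mu>[OF this] have g: "m \<in> X - set (h @ [b])"
        "K (insert m (?mc h)) (set (h @ [b]) - ?mc h)"
        unfolding good_def m_def mch by auto
      have "?mc ((h @ [b]) @ [m]) = insert m (?mc h)"
        using len mch by (subst maker_claimed_snoc) simp
      moreover have "set ((h @ [b]) @ [m]) - insert m (?mc h) = set (h @ [b]) - ?mc h"
        using g(1) by auto
      ultimately show ?case unfolding h2 using g(2) by simp
    qed
    let ?c = "card X"
    have full: "set (play \<beta> \<mu> ?c) = X" by (rule set_play_card[OF fin \<beta> legal])
    show ?thesis
    proof (cases "even ?c")
      case True
      then have eq: "2 * (?c div 2) = ?c" by simp
      show ?thesis
        by (rule win[OF inv[of "?c div 2", unfolded eq]]) (use full maker_claimed_subset[of "play \<beta> \<mu> (card X)"] in auto)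
    next
      case False
      then have eq: "Suc (2 * (?c div 2)) = ?c" by simp
      define h where "h = play \<beta> \<mu> (2 * (?c div 2))"
      define b where "b = \<beta> h"
      have h1: "play \<beta> \<mu> ?c = h @ [b]"
        by (subst eq[symmetric]) (simp add: Let_def h_def b_def)
      have mch: "?mc (h @ [b]) = ?mc h" by (simp add: maker_claimed_snoc h_def)
      have d: "distinct (h @ [b])" using play_legal[OF fin \<beta> legal, of ?c] h1 by simp
      have un: "?mc h \<union> (set h - ?mc h) = set h" using maker_claimed_subset[of h] by auto
      have "K (?mc h) (set h - ?mc h)" using inv[of "?c div 2"] by (simp add: h_def)
      then have "W (?mc h)"
        by (rule win_last[where b = b]) (use d full h1 un in auto)
      then show ?thesis by (simp add: h1 mch)
    qed
  qed
  with legal show ?thesis unfolding maker_winning_strategy_def by blast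
qed

section \<open>The Erdos-Selfridge potential\<close>

text \<open>If fair coins decided all unclaimed elements, this would be the expected number of sets
  of \<open>F\<close> that Breaker owns completely; sets already hit by Maker count zero.\<close>

definition potential :: "'e set set \<Rightarrow> 'e set \<Rightarrow> 'e set \<Rightarrow> real" where
  "potential F M B = (\<Sum>A | A \<in> F \<and> A \<inter> M = {}. (1/2) ^ card (A - B))"

lemma potential_ge_1:
  assumes "finite F" "A \<in> F" "A \<inter> M = {}" "A \<subseteq> B"
  shows "1 \<le> potential F M B"
proof -
  have "(1/2::real) ^ card (A - B) \<le> potential F M B"
    unfolding potential_def by (rule member_le_sum) (use assms in auto)
  moreover have "A - B = {}" using assms by auto
  ultimately show ?thesis by simp
qed

lemma potential_antimono:
  assumes "finite F" "M \<subseteq> M'"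
  shows "potential F M' B \<le> potential F M B"
  unfolding potential_def by (rule sum_mono2) (use assms in auto)

lemma potential_insert_breaker:
  assumes "finite F" "\<forall>A\<in>F. finite A" "b \<notin> B"
  shows "potential F M (insert b B) =
    potential F M B + (\<Sum>A | A \<in> F \<and> A \<inter> M = {} \<and> b \<in> A. (1/2) ^ card (A - B))"
proof -
  let ?G = "{A. A \<in> F \<and> A \<inter> M = {}}"
  have w: "(1/2::real) ^ card (A - insert b B) =
      (1/2) ^ card (A - B) + (if b \<in> A then (1/2) ^ card (A - B) else 0)" if "A \<in> ?G" for A
  proof (cases "b \<in> A")
    case True
    have "A - insert b B = (A - B) - {b}" by auto
    moreover have "card (A - B) = Suc (card ((A - B) - {b}))"
      by (rule card.remove) (use True assms that in auto)
    ultimately show ?thesis using True by simp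
  next
    case False
    then have "A - insert b B = A - B" by auto
    then show ?thesis using False by simp
  qed
  have "potential F M (insert b B) =
      (\<Sum>A\<in>?G. (1/2) ^ card (A - B) + (if b \<in> A then (1/2) ^ card (A - B) else 0))"
    unfolding potential_def by (rule sum.cong) (use w in auto)
  also have "\<dots> = potential F M B + (\<Sum>A\<in>?G. if b \<in> A then (1/2) ^ card (A - B) else 0)"
    by (simp add: sum.distrib potential_def)
  also have "(\<Sum>A\<in>?G. if b \<in> A then (1/2::real) ^ card (A - B) else 0) =
      (\<Sum>A\<in>?G \<inter> {A. b \<in> A}. (1/2) ^ card (A - B))"
    using assms(1) by (subst sum.inter_restrict) auto
  also have "?G \<inter> {A. b \<in> A} = {A. A \<in> F \<and> A \<inter> M = {} \<and> b \<in> A}" by auto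
  finally show ?thesis .
qed

lemma potential_insert_irrelevant:
  assumes "\<forall>A\<in>F. b \<notin> A"
  shows "potential F M (insert b B) = potential F M B"
proof -
  have "A - insert b B = A - B" if "A \<in> F" for A using assms that by auto
  then show ?thesis unfolding potential_def by (intro sum.cong) auto
qed

lemma potential_insert_maker:
  assumes "finite F"
  shows "potential F (insert m M) B =
    potential F M B - (\<Sum>A | A \<in> F \<and> A \<inter> M = {} \<and> m \<in> A. (1/2) ^ card (A - B))"
proof -
  have "potential F M B = (\<Sum>A\<in>{A. A \<in> F \<and> A \<inter> insert m M = {}} \<union> {A. A \<in> F \<and> A \<inter> M = {} \<and> m \<in> A}.
      (1/2) ^ card (A - B))"
    unfolding potential_def by (rule sum.cong) auto
  also have "\<dots> = potential F (insert m M) B + (\<Sum>A | A \<in> F \<and> A \<inter> M = {} \<and> m \<in> A. (1/2) ^ card (A - B))"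
    unfolding potential_def by (rule sum.union_disjoint) (use assms in auto)
  finally show ?thesis by simp
qed

text \<open>Maker takes an element of greatest weight. Breaker's next element raises the potential
  by at most its own weight, hence by at most what Maker's element has just removed.\<close>

lemma potential_step:
  assumes F: "finite F" "\<forall>A\<in>F. finite A" and R: "finite R" "R \<noteq> {}" "R \<inter> B = {}"
  shows "\<exists>m\<in>R. \<forall>b\<in>R - {m}. potential F (insert m M) (insert b B) \<le> potential F M B"
proof -
  define w where "w x = (\<Sum>A | A \<in> F \<and> A \<inter> M = {} \<and> x \<in> A. (1/2::real) ^ card (A - B))" for x
  have "Max (w ` R) \<in> w ` R" using R by (intro Max_in) auto
  then obtain m where m: "m \<in> R" "w m = Max (w ` R)" by auto
  have "potential F (insert m M) (insert b B) \<le> potential F M B" if b: "b \<in> R - {m}" for b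
  proof -
    have "w b \<le> w m" using m b R by simp
    moreover have "(\<Sum>A | A \<in> F \<and> A \<inter> insert m M = {} \<and> b \<in> A. (1/2::real) ^ card (A - B)) \<le> w b"
      unfolding w_def by (rule sum_mono2) (use F in auto)
    moreover have "b \<notin> B" using b R by auto
    ultimately show ?thesis
      unfolding potential_insert_breaker[OF F \<open>b \<notin> B\<close>] potential_insert_maker[OF F(1)] w_def by linarith
  qed
  with m show ?thesis by blast
qed

text \<open>
  Maker answers in the pair that Breaker has just touched, and otherwise plays on the rest of
  the board by the Erdos-Selfridge potential.
\<close>

lemma maker_hits_pairs_and_sets:
  fixes X :: "'e set"
  assumes fin: "finite X"
    and P: "\<And>p. p \<in> P \<Longrightarrow> p \<subseteq> X \<and> card p = 2" "disjoint P"
    and F: "\<And>A. A \<in> F \<Longrightarrow> A \<subseteq> X - \<Union>P"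
    and pot: "2 * (\<Sum>A\<in>F. (1/2::real) ^ card A) < 1"
    and W: "\<And>M. M \<subseteq> X \<Longrightarrow> (\<And>p. p \<in> P \<Longrightarrow> p \<inter> M \<noteq> {}) \<Longrightarrow> (\<And>A. A \<in> F \<Longrightarrow> A \<inter> M \<noteq> {}) \<Longrightarrow> W M"
  shows "\<exists>\<mu>. maker_winning_strategy X W \<mu>"
proof -
  have finF: "finite F" by (rule finite_subset[of _ "Pow X"]) (use F fin in auto)
  have finA: "\<forall>A\<in>F. finite A" using F fin by (meson Diff_subset finite_subset)
  define R where "R = X - \<Union>P"
  \<comment> \<open>The last clause looks one Breaker move ahead: Maker answers only after that
    move, so the potential must stay below 1 after any next move on \<open>R\<close>.\<close>
  define K where "K M B \<longleftrightarrow> (\<forall>p\<in>P. p \<inter> M \<noteq> {} \<or> p \<inter> B = {}) \<and> potential F M B < 1 \<and>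
    (\<forall>b\<in>R - (M \<union> B). potential F M (insert b B) < 1)" for M B
  have nofull: "A \<inter> M \<noteq> {}" if "A \<in> F" "potential F M B < 1" "A \<subseteq> M \<union> B" for A M B
    using potential_ge_1[OF finF \<open>A \<in> F\<close>, of M B] that by fastforce
  show ?thesis
  proof (rule maker_wins_by_invariant[where K = K])
    show "finite X" by fact
    have p0: "potential F {} {} = (\<Sum>A\<in>F. (1/2::real) ^ card A)" by (simp add: potential_def)
    have nn: "0 \<le> (\<Sum>A\<in>F. (1/2::real) ^ card A)" by (simp add: sum_nonneg)
    \<comment> \<open>Breaker's opening move at most doubles the potential, which accounts for the
      factor 2 in \<open>pot\<close>.\<close>
    have "potential F {} (insert b {}) < 1" for b
    proof -
      have "(\<Sum>A | A \<in> F \<and> A \<inter> {} = {} \<and> b \<in> A. (1/2::real) ^ card (A - {})) \<le> (\<Sum>A\<in>F. (1/2) ^ card A)"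
        using finF by (simp add: sum_mono2)
      then show ?thesis using potential_insert_breaker[OF finF finA, of b "{}" "{}"] pot p0 by simp
    qed
    then show "K {} {}" using pot p0 nn by (simp add: K_def)
  next
    fix M B b
    assume K: "K M B" and disj: "M \<inter> B = {}" and sub: "M \<union> B \<subseteq> X" and b: "b \<in> X - (M \<union> B)"
      and ne: "insert b (M \<union> B) \<noteq> X"
    let ?U = "X - insert b (M \<union> B)"
    have Une: "?U \<noteq> {}" using ne sub b by auto
    \<comment> \<open>A free move, not forced by a pair. It is played on \<open>R\<close> by weight;
      when \<open>R\<close> is used up any element will do, since Maker's moves never raise the
      potential.\<close>
    have respond: "\<exists>m\<in>?U. K (insert m M) (insert b B)"
      if pb: "potential F M (insert b B) < 1"
        and pairs: "\<And>p. p \<in> P \<Longrightarrow> p \<inter> M \<noteq> {} \<or> p \<inter> insert b B = {}"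
    proof (cases "R \<inter> ?U = {}")
      case True
      obtain m where m: "m \<in> ?U" using Une by auto
      have "potential F (insert m M) (insert b B) < 1"
        using potential_antimono[OF finF, of M "insert m M" "insert b B"] pb by (meson le_less_trans subset_insertI)
      moreover have "R - (insert m M \<union> insert b B) = {}" using True unfolding R_def by auto
      ultimately have "K (insert m M) (insert b B)" unfolding K_def using pairs by blast
      with m show ?thesis by blast
    next
      case False
      have "\<exists>m\<in>R \<inter> ?U. \<forall>c\<in>R \<inter> ?U - {m}. potential F (insert m M) (insert c (insert b B)) \<le> potential F M (insert b B)"
        by (rule potential_step[OF finF finA]) (use False fin in auto)
      then obtain m where m: "m \<in> R \<inter> ?U"
        "\<forall>c\<in>R \<inter> ?U - {m}. potential F (insert m M) (insert c (insert b B)) \<le> potential F M (insert b B)" by blast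
      have "potential F (insert m M) (insert b B) < 1"
        using potential_antimono[OF finF, of M "insert m M" "insert b B"] pb by (meson le_less_trans subset_insertI)
      moreover have "\<forall>c\<in>R - (insert m M \<union> insert b B). potential F (insert m M) (insert c (insert b B)) < 1"
      proof
        fix c assume "c \<in> R - (insert m M \<union> insert b B)"
        then have "c \<in> R \<inter> ?U - {m}" unfolding R_def by auto
        then show "potential F (insert m M) (insert c (insert b B)) < 1" using m(2) pb by force
      qed
      ultimately have "K (insert m M) (insert b B)" unfolding K_def using pairs by blast
      with m(1) show ?thesis by blast
    qed
    show "\<exists>m\<in>?U. K (insert m M) (insert b B)"
    proof (cases "b \<in> \<Union>P")
      case False
      then have "b \<in> R - (M \<union> B)" using b by (auto simp: R_def)
      then show ?thesis using K False by (intro respond) (auto simp: K_def)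
    next
      case True
      then obtain p where p: "p \<in> P" "b \<in> p" by auto
      have uniq: "q = p" if "q \<in> P" "b \<in> q" for q
        using P(2) p that by (auto simp: disjoint_def)
      have "potential F M (insert b B) = potential F M B"
        by (rule potential_insert_irrelevant) (use F True in blast)
      then have pb: "potential F M (insert b B) < 1" using K by (simp add: K_def)
      show ?thesis
      proof (cases "p \<inter> M = {}")
        case False
        show ?thesis
        proof (rule respond[OF pb])
          fix q assume "q \<in> P"
          then show "q \<inter> M \<noteq> {} \<or> q \<inter> insert b B = {}"
            using K False uniq[of q] by (cases "b \<in> q") (auto simp: K_def)
        qed
      next
        case True
        then have pB: "p \<inter> B = {}" using K p by (auto simp: K_def)
        obtain m where m: "m \<in> p" "m \<noteq> b"
          using P(1)[OF p(1)] p(2) by (metis card_2_iff insertCI)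
        have mU: "m \<in> ?U" using m pB True P(1)[OF p(1)] by auto
        have "\<forall>q\<in>P. q \<inter> insert m M \<noteq> {} \<or> q \<inter> insert b B = {}"
        proof
          fix q assume q: "q \<in> P"
          show "q \<inter> insert m M \<noteq> {} \<or> q \<inter> insert b B = {}"
            using K q uniq[of q] m by (cases "b \<in> q") (auto simp: K_def)
        qed
        moreover have "potential F (insert m M) (insert b B) < 1"
          using potential_antimono[OF finF, of M "insert m M" "insert b B"] pb by (meson le_less_trans subset_insertI)
        \<comment> \<open>After a forced answer in a pair, the look-ahead clause of the old position
          still covers \<open>c\<close>, because \<open>b\<close> lies in a pair and hence in no set
          of \<open>F\<close>.\<close>
        moreover have "\<forall>c\<in>R - (insert m M \<union> insert b B). potential F (insert m M) (insert c (insert b B)) < 1"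
        proof
          fix c assume c: "c \<in> R - (insert m M \<union> insert b B)"
          have "potential F M (insert b (insert c B)) = potential F M (insert c B)"
            by (rule potential_insert_irrelevant) (use F \<open>b \<in> \<Union>P\<close> in blast)
          also have "\<dots> < 1" using K c by (auto simp: K_def)
          finally show "potential F (insert m M) (insert c (insert b B)) < 1"
            using potential_antimono[OF finF, of M "insert m M" "insert c (insert b B)"]
            by (metis insert_commute le_less_trans subset_insertI)
        qed
        ultimately have "K (insert m M) (insert b B)" by (auto simp: K_def)
        with mU show ?thesis by blast
      qed
    qed
  next
    fix M B assume K: "K M B" and "M \<inter> B = {}" and X: "M \<union> B = X"
    show "W M"
    proof (rule W)
      show "p \<inter> M \<noteq> {}" if "p \<in> P" for p
      proof -
        have "p \<noteq> {}" "p \<subseteq> M \<union> B" using P(1)[OF that] X by auto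
        then show ?thesis using K that unfolding K_def by blast
      qed
      show "A \<inter> M \<noteq> {}" if "A \<in> F" for A
        using nofull[OF that, of M B] K X F[OF that] by (auto simp: K_def)
    qed (use X in auto)
  next
    fix M B b assume K: "K M B" and "M \<inter> B = {}" and b: "b \<notin> M \<union> B" and X: "insert b (M \<union> B) = X"
    show "W M"
    proof (rule W)
      show "p \<inter> M \<noteq> {}" if "p \<in> P" for p
      proof
        assume e: "p \<inter> M = {}"
        \<comment> \<open>By the invariant \<open>B\<close> avoids a pair that Maker has not hit, so
          only the final element could lie in it.\<close>
        then have "p \<subseteq> {b}" using K P(1)[OF that] X that by (auto simp: K_def)
        then have "card p \<le> 1" by (metis card.empty card_insert_le_m1 card_mono finite.emptyI finite.insertI is_singletonI is_singleton_altdef)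
        then show False using P(1)[OF that] by simp
      qed
      show "A \<inter> M \<noteq> {}" if A: "A \<in> F" for A
      proof (cases "b \<in> R")
        case True
        then have "potential F M (insert b B) < 1" using K b by (auto simp: K_def)
        then show ?thesis using nofull[OF A, of M "insert b B"] F[OF A] X by auto
      next
        case False
        then have "A \<subseteq> M \<union> B" using F[OF A] X by (auto simp: R_def)
        then show ?thesis using nofull[OF A, of M B] K by (auto simp: K_def)
      qed
    qed (use X in auto)
  qed
qed

section \<open>Rotations and boosters\<close>

fun path_edges :: "'v list \<Rightarrow> 'v set set" where
  "path_edges (x # y # p) = insert {x, y} (path_edges (y # p))"
| "path_edges _ = {}"

lemma path_edges_Cons:
  "path_edges (x # p) = (if p = [] then {} else insert {x, hd p} (path_edges p))"
  by (cases p) auto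

lemma path_edges_append:
  "path_edges (p @ q) =
    path_edges p \<union> path_edges q \<union> (if p = [] \<or> q = [] then {} else {{last p, hd q}})"
  by (induction p) (auto simp: path_edges_Cons)

lemma path_edges_rev [simp]: "path_edges (rev p) = path_edges p"
  by (induction p) (auto simp: path_edges_Cons path_edges_append last_rev insert_commute)

lemma path_edges_nth: "Suc i < length p \<Longrightarrow> {p ! i, p ! Suc i} \<in> path_edges p"
proof (induction p arbitrary: i rule: path_edges.induct)
  case (1 x y p)
  then show ?case by (cases i) auto
qed auto

lemma path_edges_subset: "e \<in> path_edges p \<Longrightarrow> e \<subseteq> set p"
  by (induction p rule: path_edges.induct) auto

lemma path_edges_at:
  assumes "distinct (A @ z # B)"
  shows "{x, z} \<in> path_edges (A @ z # B) \<longleftrightarrow> (A \<noteq> [] \<and> x = last A) \<or> (B \<noteq> [] \<and> x = hd B)"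
proof -
  have "{x, z} \<notin> path_edges A" "{x, z} \<notin> path_edges B"
    using assms path_edges_subset[of "{x, z}" A] path_edges_subset[of "{x, z}" B] by auto
  moreover have "{x, z} = {last A, z} \<longleftrightarrow> x = last A" "{x, z} = {z, hd B} \<longleftrightarrow> x = hd B"
    by (auto simp: doubleton_eq_iff)
  ultimately show ?thesis
    by (auto simp: path_edges_append path_edges_Cons)
qed

section \<open>Longest paths, expansion and Posa rotations\<close>

definition is_path :: "'v set \<Rightarrow> 'v set set \<Rightarrow> 'v list \<Rightarrow> bool" where
  "is_path V E p \<longleftrightarrow> p \<noteq> [] \<and> distinct p \<and> set p \<subseteq> V \<and> path_edges p \<subseteq> E"

definition longest_path :: "'v set \<Rightarrow> 'v set set \<Rightarrow> 'v list \<Rightarrow> bool" where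
  "longest_path V E p \<longleftrightarrow> is_path V E p \<and> (\<forall>q. is_path V E q \<longrightarrow> length q \<le> length p)"

definition neighbours :: "'v set set \<Rightarrow> 'v set \<Rightarrow> 'v set" where
  "neighbours E S = {w. w \<notin> S \<and> (\<exists>v\<in>S. {v, w} \<in> E)}"

definition expander :: "'v set \<Rightarrow> nat \<Rightarrow> 'v set set \<Rightarrow> bool" where
  "expander V a E \<longleftrightarrow> (\<forall>S\<subseteq>V. S \<noteq> {} \<and> card S \<le> a \<longrightarrow> 2 * card S < card (neighbours E S))"

text \<open>Posa rotations with the first vertex held fixed: the chord from the last vertex to
  \<open>x\<close> replaces the path edge after \<open>x\<close>, and \<open>hd B\<close> becomes
  the new last vertex.\<close>

inductive rotated :: "'v set set \<Rightarrow> 'v list \<Rightarrow> 'v list \<Rightarrow> bool" for E P where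
  initial: "rotated E P P"
| rotation: "rotated E P (A @ x # B) \<Longrightarrow> B \<noteq> [] \<Longrightarrow> {x, last B} \<in> E \<Longrightarrow> rotated E P (A @ x # rev B)"

definition endpoints :: "'v set set \<Rightarrow> 'v list \<Rightarrow> 'v set" where
  "endpoints E P = last ` {Q. rotated E P Q}"

lemma rotated_path:
  assumes "rotated E P Q" "is_path V E P"
  shows "is_path V E Q \<and> set Q = set P \<and> length Q = length P \<and> hd Q = hd P"
  using assms
proof (induction rule: rotated.induct)
  case initial
  then show ?case by simp
next
  case (rotation A x B)
  then have IH: "is_path V E (A @ x # B)" "set (A @ x # B) = set P" "length (A @ x # B) = length P"
    "hd (A @ x # B) = hd P" by auto
  have "path_edges (A @ x # rev B) \<subseteq> insert {x, last B} (path_edges (A @ x # B))"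
    by (auto simp: path_edges_append path_edges_Cons hd_rev)
  then have "is_path V E (A @ x # rev B)"
    using IH(1) rotation.hyps by (auto simp: is_path_def)
  with IH show ?case by (auto simp: hd_append)
qed

text \<open>A rotation deletes only the edge \<open>{z, hd B}\<close>, and \<open>hd B\<close>
  thereby belongs to \<open>endpoints E P\<close>; an edge between two vertices that are never
  endpoints is thus never deleted.\<close>

lemma rotated_keeps_edges:
  assumes "rotated E P Q" "{x, y} \<in> path_edges P" "x \<notin> endpoints E P" "y \<notin> endpoints E P"
  shows "{x, y} \<in> path_edges Q"
  using assms
proof (induction rule: rotated.induct)
  case initial
  then show ?case by simp
next
  case (rotation A z B)
  have "rotated E P (A @ z # rev B)" by (rule rotated.rotation) (use rotation in auto)
  then have "hd B \<in> endpoints E P"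
    using rotation.hyps(2) unfolding endpoints_def by (force simp: last_rev)
  with rotation have "{x, y} \<noteq> {z, hd B}" "{x, y} \<in> path_edges (A @ z # B)"
    by (auto simp: doubleton_eq_iff)
  then show ?case using rotation.hyps(2)
    by (auto simp: path_edges_append path_edges_Cons split: if_splits)
qed

lemma endpoints_subset:
  assumes "is_path V E P"
  shows "endpoints E P \<subseteq> set P"
  using rotated_path[OF _ assms] unfolding endpoints_def is_path_def by (metis (no_types, lifting) image_subsetI last_in_set mem_Collect_eq)

text \<open>
  A vertex of the path that is adjacent to an endpoint but has no path neighbour among the
  endpoints keeps both of its path edges under all rotations; rotating at it would then turn
  one of its path neighbours into an endpoint.
\<close>

lemma neighbours_endpoints:
  assumes P: "longest_path V E P" and x: "x \<in> neighbours E (endpoints E P)" "x \<in> V"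
  shows "x \<in> set P \<and> (\<exists>z\<in>endpoints E P. {x, z} \<in> path_edges P)"
proof -
  let ?R = "endpoints E P"
  have pP: "is_path V E P" using P by (simp add: longest_path_def)
  obtain y where y: "y \<in> ?R" "{y, x} \<in> E" "x \<notin> ?R" using x by (auto simp: neighbours_def)
  from y(1) obtain Q where Q: "rotated E P Q" "last Q = y" unfolding endpoints_def by blast
  have pQ: "is_path V E Q" "set Q = set P" "length Q = length P" "hd Q = hd P"
    using rotated_path[OF Q(1) pP] by auto
  have xP: "x \<in> set P"
  proof (rule ccontr)
    assume "x \<notin> set P"
    then have "is_path V E (Q @ [x])"
      using pQ(1,2) Q(2) y(2) x(2) by (simp add: is_path_def path_edges_append)
    then show False using P pQ(3) by (fastforce simp: longest_path_def)
  qed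
  then obtain A B where AB: "Q = A @ x # B" using pQ(2) by (metis split_list)
  have "B \<noteq> []" using AB Q(2) y by auto
  then have lB: "last B = y" using AB Q(2) by simp
  have "rotated E P (A @ x # rev B)"
  proof (rule rotated.rotation)
    show "rotated E P (A @ x # B)" using Q(1) AB by simp
    show "{x, last B} \<in> E" using lB y(2) by (simp add: insert_commute)
  qed fact
  moreover have "last (A @ x # rev B) = hd B" using \<open>B \<noteq> []\<close> by (simp add: last_rev)
  ultimately have hB: "hd B \<in> ?R" unfolding endpoints_def by (metis imageI mem_Collect_eq)
  have "\<exists>z\<in>?R. {x, z} \<in> path_edges P"
  proof (rule ccontr)
    assume no: "\<not> (\<exists>z\<in>?R. {x, z} \<in> path_edges P)"
    have dQ: "distinct (A @ x # B)" using pQ AB by (simp add: is_path_def)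
    \<comment> \<open>An edge of \<open>P\<close> at \<open>x\<close> survives in \<open>Q\<close>,
      where \<open>x\<close> has only the neighbours \<open>last A\<close> and \<open>hd B\<close>;
      since \<open>hd B\<close> is an endpoint, \<open>last A\<close> remains.\<close>
    have nb: "A \<noteq> [] \<and> z = last A" if "{z, x} \<in> path_edges P" for z
    proof -
      have zR: "z \<notin> ?R" using no that by (subst (asm) insert_commute) blast
      have "{z, x} \<in> path_edges Q" by (rule rotated_keeps_edges[OF Q(1) that zR y(3)])
      then have "(A \<noteq> [] \<and> z = last A) \<or> (B \<noteq> [] \<and> z = hd B)"
        unfolding AB path_edges_at[OF dQ] .
      then show ?thesis using zR hB by blast
    qed
    obtain C D where CD: "P = C @ x # D" using xP by (metis split_list)
    have dP: "distinct (C @ x # D)" using pP CD by (simp add: is_path_def)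
    have "last P \<in> ?R" unfolding endpoints_def by (rule imageI) (simp add: rotated.initial)
    then have D: "D \<noteq> []" using CD y(3) by force
    then have "{hd D, x} \<in> path_edges P" unfolding CD path_edges_at[OF dP] by simp
    then have 1: "A \<noteq> [] \<and> hd D = last A" by (rule nb)
    \<comment> \<open>Rotations fix the first vertex: if \<open>x\<close> came first in
      \<open>P\<close>, it would come first in \<open>Q\<close> as well, although \<open>A\<close>
      is nonempty.\<close>
    have "C \<noteq> []"
    proof
      assume "C = []"
      then have "hd A = x" using 1 pQ(4) AB CD by simp
      then show False using 1 dQ hd_in_set[of A] by auto
    qed
    then have "{last C, x} \<in> path_edges P" unfolding CD path_edges_at[OF dP] by simp
    \<comment> \<open>Both neighbours of \<open>x\<close> on \<open>P\<close> now equal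
      \<open>last A\<close>, contrary to distinctness.\<close>
    then have "last C = last A" using nb by blast
    moreover have "hd D \<in> set D" "last C \<in> set C" using D \<open>C \<noteq> []\<close> by auto
    ultimately show False using 1 dP by auto
  qed
  with xP show ?thesis by blast
qed

lemma card_doubleton_le: "card {x, y} \<le> 2"
  by (simp add: card_insert_if)

lemma card_path_neighbours:
  assumes "distinct P"
  shows "finite {x. {x, z} \<in> path_edges P} \<and> card {x. {x, z} \<in> path_edges P} \<le> 2"
proof (cases "z \<in> set P")
  case False
  then have "{x. {x, z} \<in> path_edges P} = {}" using path_edges_subset[of _ P] by auto
  then show ?thesis by simp
next
  case True
  then obtain A B where AB: "P = A @ z # B" by (metis split_list)
  have "{x. {x, z} \<in> path_edges P} \<subseteq> {last A, hd B}"
    using path_edges_at[of A z B] assms AB by auto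
  moreover have "card {last A, hd B} \<le> 2" by (rule card_doubleton_le)
  ultimately show ?thesis
    by (meson card_mono finite.emptyI finite.insertI finite_subset order_trans)
qed

text \<open>Posa's lemma: each outside neighbour of the endpoint set is next on the path to some
  endpoint, and an endpoint has at most two path neighbours.\<close>

lemma card_neighbours_endpoints:
  assumes "finite V" and P: "longest_path V E P" and E: "\<And>e. e \<in> E \<Longrightarrow> e \<subseteq> V"
  shows "card (neighbours E (endpoints E P)) \<le> 2 * card (endpoints E P)"
proof -
  let ?R = "endpoints E P"
  have pP: "is_path V E P" using P by (simp add: longest_path_def)
  have R: "?R \<subseteq> V" using endpoints_subset[OF pP] pP by (auto simp: is_path_def)
  then have finR: "finite ?R" using assms(1) by (rule finite_subset)
  have dP: "distinct P" using pP by (simp add: is_path_def)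
  have "neighbours E ?R \<subseteq> (\<Union>z\<in>?R. {x. {x, z} \<in> path_edges P})"
  proof
    fix x assume x: "x \<in> neighbours E ?R"
    then have "x \<in> V" using E by (force simp: neighbours_def)
    then show "x \<in> (\<Union>z\<in>?R. {x. {x, z} \<in> path_edges P})"
      using neighbours_endpoints[OF P x] by auto
  qed
  then have "card (neighbours E ?R) \<le> card (\<Union>z\<in>?R. {x. {x, z} \<in> path_edges P})"
    by (rule card_mono[rotated]) (use finR card_path_neighbours[OF dP] in auto)
  also have "\<dots> \<le> (\<Sum>z\<in>?R. card {x. {x, z} \<in> path_edges P})" by (rule card_UN_le[OF finR])
  also have "\<dots> \<le> (\<Sum>z\<in>?R. 2)" by (rule sum_mono) (use card_path_neighbours[OF dP] in auto)
  finally show ?thesis by simp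
qed

lemma expander_endpoints:
  assumes "finite V" "longest_path V E P" "\<And>e. e \<in> E \<Longrightarrow> e \<subseteq> V" "expander V a E"
  shows "a < card (endpoints E P)"
proof (rule ccontr)
  assume a: "\<not> a < card (endpoints E P)"
  have "is_path V E P" using assms(2) by (simp add: longest_path_def)
  then have "endpoints E P \<subseteq> V" using endpoints_subset[of V E P] by (auto simp: is_path_def)
  moreover have "endpoints E P \<noteq> {}" using rotated.initial unfolding endpoints_def by blast
  ultimately have "2 * card (endpoints E P) < card (neighbours E (endpoints E P))"
    using assms(4) a by (auto simp: expander_def)
  then show False using card_neighbours_endpoints[OF assms(1-3)] by simp
qed

section \<open>Boosters\<close>

text \<open>The Hamilton cycle is listed separately because a path through all of \<open>V\<close>
  cannot be lengthened. The other alternative compares with every path of \<open>E\<close>, so it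
  refers to no chosen longest path.\<close>

definition booster :: "'v set \<Rightarrow> 'v set set \<Rightarrow> 'v set \<Rightarrow> bool" where
  "booster V E e \<longleftrightarrow> hamiltonian V (insert e E) \<or>
     (\<exists>p. is_path V (insert e E) p \<and> (\<forall>q. is_path V E q \<longrightarrow> length q < length p))"

definition boosters :: "'v set \<Rightarrow> 'v set set \<Rightarrow> 'v set set" where
  "boosters V E = {e. e \<subseteq> V \<and> card e = 2 \<and> booster V E e}"

lemma ex_longest_path:
  assumes "finite V" "V \<noteq> {}"
  shows "\<exists>P. longest_path V E P"
proof -
  obtain v where v: "v \<in> V" using assms by auto
  then have 1: "is_path V E [v]" by (simp add: is_path_def)
  have "\<forall>p. is_path V E p \<longrightarrow> length p < Suc (card V)"
    using assms(1) by (metis card_mono distinct_card is_path_def less_Suc_eq_le)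
  from ex_has_greatest_nat[OF 1 this] show ?thesis unfolding longest_path_def by auto
qed

lemma hamilton_path_closes:
  assumes "finite V" "card V \<ge> 3" "is_path V E Q" "set Q = V" "{last Q, hd Q} \<in> E"
  shows "hamiltonian V E"
proof -
  have len: "length Q = card V" using assms by (metis distinct_card is_path_def)
  have "{Q ! i, Q ! (Suc i mod length Q)} \<in> E" if i: "i < length Q" for i
  proof (cases "Suc i < length Q")
    case True
    then show ?thesis using path_edges_nth[OF True] assms(3) by (auto simp: is_path_def)
  next
    case False
    then have "Suc i = length Q" using i by simp
    then have "i = length Q - 1" "Suc i mod length Q = 0" by auto
    moreover have "Q \<noteq> []" using i by auto
    ultimately show ?thesis using assms(5) by (simp add: last_conv_nth hd_conv_nth)
  qed
  then have "hamilton_cycle V E Q"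
    using assms len by (simp add: hamilton_cycle_def is_path_def)
  then show ?thesis by (auto simp: hamiltonian_def)
qed

lemma card_le_unordered_pairs:
  assumes "finite U" "(\<lambda>(x, y). {x, y}) ` D \<subseteq> U"
  shows "card D \<le> 2 * card U"
proof -
  have two: "finite {(x, y). {x, y} = e} \<and> card {(x, y). {x, y} = e} \<le> 2" for e :: "'a set"
  proof (cases "\<exists>a b. e = {a, b}")
    case True
    then obtain a b where e: "e = {a, b}" by auto
    have "{(x, y). {x, y} = e} \<subseteq> {(a, b), (b, a)}" unfolding e doubleton_eq_iff by blast
    moreover have "card {(a, b), (b, a)} \<le> 2" by (rule card_doubleton_le)
    ultimately show ?thesis
      by (meson card_mono finite.emptyI finite.insertI finite_subset order_trans)
  next
    case False
    then have "{(x, y). {x, y} = e} = {}" by auto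
    then show ?thesis by simp
  qed
  have "D \<subseteq> (\<Union>e\<in>U. {(x, y). {x, y} = e})" using assms(2) by auto
  then have "card D \<le> card (\<Union>e\<in>U. {(x, y). {x, y} = e})"
    by (rule card_mono[rotated]) (use assms(1) two in auto)
  also have "\<dots> \<le> (\<Sum>e\<in>U. card {(x, y). {x, y} = e})" by (rule card_UN_le[OF assms(1)])
  also have "\<dots> \<le> (\<Sum>e\<in>U. 2)" by (rule sum_mono) (use two in auto)
  finally show ?thesis by simp
qed

lemma longest_path_rev:
  assumes "longest_path V E P"
  shows "longest_path V E (rev P)"
  using assms by (simp add: longest_path_def is_path_def)

lemma longest_path_rotated:
  assumes "longest_path V E P" "rotated E P Q"
  shows "longest_path V E Q"
  using assms rotated_path[OF assms(2)] by (auto simp: longest_path_def)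

text \<open>
  If no edge leaves the longest path, its complement has more than \<open>a\<close> vertices by
  expansion, and joining an endpoint to any of them gives a longer path. Otherwise closing the
  path to a cycle gives a Hamilton cycle or a longer path.
\<close>

lemma boosters_many:
  assumes V: "finite V" "card V \<ge> 3" and E: "\<And>e. e \<in> E \<Longrightarrow> e \<subseteq> V \<and> card e = 2"
    and ex: "expander V a E" and a: "a \<ge> 1" 
  shows "(a + 1)\<^sup>2 \<le> 2 * card (boosters V E)"
proof -
  have EV: "\<And>e. e \<in> E \<Longrightarrow> e \<subseteq> V" using E by blast
  have "V \<noteq> {}" using V by auto
  then obtain P where P: "longest_path V E P" using ex_longest_path[OF V(1)] by blast
  have pP: "is_path V E P" using P by (simp add: longest_path_def)
  have fb: "finite (boosters V E)"
    by (rule finite_subset[of _ "Pow V"]) (auto simp: boosters_def V)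
  have longer: "booster V E e" if "is_path V (insert e E) p" "length P < length p" for e p
    using that P unfolding booster_def longest_path_def by (metis le_less_trans)
  have R: "a < card (endpoints E P)" by (rule expander_endpoints[OF V(1) P EV ex])
  have RV: "endpoints E P \<subseteq> V" using endpoints_subset[OF pP] pP by (auto simp: is_path_def)
  \<comment> \<open>The partners of \<open>y\<close>. In the second case a rotated path ending in
    \<open>y\<close> is reversed, so that \<open>y\<close> is the fixed first vertex and a second
    family of rotations moves the other end.\<close>
  define W where "W y = (if set P \<noteq> V \<and> neighbours E (set P) = {} then V - set P
    else endpoints E (rev (SOME Q. rotated E P Q \<and> last Q = y)))" for y
  have Q: "rotated E P (SOME Q. rotated E P Q \<and> last Q = y) \<and> last (SOME Q. rotated E P Q \<and> last Q = y) = y"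
    if "y \<in> endpoints E P" for y
    by (rule someI_ex) (use that in \<open>auto simp: endpoints_def\<close>)
  have W: "a < card (W y) \<and> W y \<subseteq> V \<and> (\<forall>w\<in>W y. {y, w} \<in> boosters V E)" if y: "y \<in> endpoints E P" for y
  proof -
    define Q where "Q = (SOME Q. rotated E P Q \<and> last Q = y)"
    have Q: "rotated E P Q" "last Q = y" using Q[OF y] by (auto simp: Q_def)
    have pQ: "is_path V E Q" "set Q = set P" "length Q = length P"
      using rotated_path[OF Q(1) pP] by auto
    have yP: "y \<in> set P" "y \<in> V" using endpoints_subset[OF pP] y RV by auto
    show ?thesis
    proof (cases "set P \<noteq> V \<and> neighbours E (set P) = {}")
      case True
      then have Wy: "W y = V - set P" by (simp add: W_def)
      have "a < card (V - set P)"
      proof (rule ccontr)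
        assume "\<not> a < card (V - set P)"
        moreover have "V - set P \<noteq> {}" using True pP by (auto simp: is_path_def)
        ultimately have "2 * card (V - set P) < card (neighbours E (V - set P))"
          using ex unfolding expander_def by auto
        \<comment> \<open>An edge leaving the complement would have to end in \<open>set P\<close>,
          but no edge leaves \<open>set P\<close>.\<close>
        moreover have "neighbours E (V - set P) = {}"
        proof -
          have "False" if w: "w \<in> neighbours E (V - set P)" for w
          proof -
            obtain v where v: "v \<in> V - set P" "{v, w} \<in> E" "w \<notin> V - set P"
              using w by (auto simp: neighbours_def)
            then have "w \<in> set P" using EV by blast
            then have "v \<in> neighbours E (set P)" using v by (auto simp: neighbours_def insert_commute)
            then show False using True by simp
          qed
          then show ?thesis by auto
        qed
        ultimately show False by simp
      qed
      moreover have "{y, w} \<in> boosters V E" if w: "w \<in> V - set P" for w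
      proof -
        have "is_path V (insert {y, w} E) (Q @ [w])"
          using pQ w Q by (auto simp: is_path_def path_edges_append)
        then have "booster V E {y, w}" by (rule longer) (use pQ in simp)
        then show ?thesis using w yP by (auto simp: boosters_def card_insert_if)
      qed
      ultimately show ?thesis using Wy by auto
    next
      case False
      then have Wy: "W y = endpoints E (rev Q)" by (auto simp: W_def Q_def)
      have lQ: "longest_path V E (rev Q)"
        by (rule longest_path_rev[OF longest_path_rotated[OF P Q(1)]])
      then have pr: "is_path V E (rev Q)" by (simp add: longest_path_def)
      have "a < card (W y)" unfolding Wy by (rule expander_endpoints[OF V(1) lQ EV ex])
      moreover have WP: "W y \<subseteq> set P" unfolding Wy using endpoints_subset[OF pr] pQ by simp
      moreover have "{y, w} \<in> boosters V E" if w: "w \<in> W y" for w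
      proof -
        obtain T where T: "rotated E (rev Q) T" "last T = w" using w unfolding Wy endpoints_def by auto
        have pT: "is_path V E T" "set T = set P" "length T = length P" "hd T = y"
          using rotated_path[OF T(1) pr] pQ Q by (auto simp: is_path_def hd_rev)
        \<comment> \<open>This makes the ends \<open>y\<close> and \<open>w\<close> distinct, so
          that \<open>{y, w}\<close> is a genuine pair.\<close>
        have "length P \<ge> 2"
        proof -
          have "2 * card {y} < card (neighbours E {y})"
            using ex yP a unfolding expander_def by (metis bot.extremum card.empty card_insert_if empty_iff finite.intros(1) insert_not_empty insert_subset One_nat_def)
          then have "neighbours E {y} \<noteq> {}" by auto
          then obtain z where z: "z \<noteq> y" "{y, z} \<in> E" by (auto simp: neighbours_def)
          then have "is_path V E [y, z]" using E yP by (auto simp: is_path_def)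
          then show ?thesis using P by (force simp: longest_path_def)
        qed
        then obtain T' where T': "T = y # T'" "T' \<noteq> []"
          using pT(3,4) by (cases T) force+
        then have "w \<in> set T'" using T(2) by auto
        then have yw: "y \<noteq> w" using pT(1) T' by (auto simp: is_path_def)
        have "booster V E {y, w}"
        proof (cases "set P = V")
          case True
          have "hamiltonian V (insert {y, w} E)"
            by (rule hamilton_path_closes[OF V, where Q = T]) (use pT T True in \<open>auto simp: is_path_def insert_commute\<close>)
          then show ?thesis by (simp add: booster_def)
        next
          case ne: False
          then obtain u where "u \<in> neighbours E (set P)" using False by auto
          then obtain v where u: "u \<notin> set P" "v \<in> set P" "{v, u} \<in> E" by (auto simp: neighbours_def)
          then obtain A B where AB: "T = A @ v # B" using pT(2) by (metis split_list)
          \<comment> \<open>The edge \<open>{y, w}\<close> closes \<open>T\<close> to a cycle;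
            cutting it in front of \<open>v\<close> and prepending \<open>u\<close> gives a path
            with one more vertex.\<close>
          have "is_path V (insert {y, w} E) (u # v # B @ A)"
            using pT T(2) u E[OF u(3)] AB
            by (auto simp: is_path_def path_edges_append path_edges_Cons insert_commute split: if_splits)
          then show ?thesis by (rule longer) (use pT(3) AB in auto)
        qed
        then show ?thesis using yw yP WP w pP by (auto simp: boosters_def is_path_def)
      qed
      ultimately show ?thesis using pP by (auto simp: is_path_def)
    qed
  qed
  have finR: "finite (endpoints E P)" using RV V(1) by (rule finite_subset)
  have "(a + 1) * (a + 1) \<le> card (endpoints E P) * (a + 1)" using R by (intro mult_right_mono) auto
  also have "\<dots> = (\<Sum>y\<in>endpoints E P. a + 1)" by simp
  also have "\<dots> \<le> (\<Sum>y\<in>endpoints E P. card (W y))" by (rule sum_mono) (simp add: W Suc_leI)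
  also have "\<dots> = card (Sigma (endpoints E P) W)"
    using finR W V(1) by (subst card_SigmaI) (auto intro: finite_subset)
  also have "\<dots> \<le> 2 * card (boosters V E)"
    by (rule card_le_unordered_pairs[OF fb]) (use W in auto)
  finally show ?thesis by (simp add: power2_eq_square)
qed

lemma expander_mono:
  assumes "expander V a E" "E \<subseteq> E'" "finite V" "\<And>e. e \<in> E' \<Longrightarrow> e \<subseteq> V"
  shows "expander V a E'"
  unfolding expander_def
proof (intro allI impI)
  fix S assume S: "S \<subseteq> V" "S \<noteq> {} \<and> card S \<le> a"
  have "neighbours E S \<subseteq> neighbours E' S" using assms(2) by (auto simp: neighbours_def)
  moreover have "neighbours E' S \<subseteq> V" using assms(4) by (force simp: neighbours_def)
  ultimately have "card (neighbours E S) \<le> card (neighbours E' S)"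
    using assms(3) by (meson card_mono finite_subset)
  then show "2 * card S < card (neighbours E' S)" using assms(1) S unfolding expander_def
    by (meson less_le_trans)
qed

lemma hamiltonian_mono: "hamiltonian V E \<Longrightarrow> E \<subseteq> E' \<Longrightarrow> hamiltonian V E'"
  unfolding hamiltonian_def hamilton_cycle_def by blast

text \<open>Induction on the number of vertices missing from a longest path. A booster in
  \<open>M\<close> completes a Hamilton cycle or lengthens the longest path, so at most
  \<open>card V\<close> edges are added, and \<open>k\<close> leaves room for them.\<close>

lemma hamiltonian_by_boosters:
  assumes V: "finite V" "V \<noteq> {}" and M: "finite M" "\<And>e. e \<in> M \<Longrightarrow> e \<subseteq> V"
    and H: "H \<subseteq> M" "expander V a H" "card H + card V \<le> k"
    and boost: "\<And>H. H \<subseteq> M \<Longrightarrow> card H \<le> k \<Longrightarrow> expander V a H \<Longrightarrow> \<not> hamiltonian V H \<Longrightarrow> boosters V H \<inter> M \<noteq> {}"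
  shows "hamiltonian V M"
proof -
  have len: "length p \<le> card V" if "is_path V E p" for E p
    using that V(1) by (metis card_mono distinct_card is_path_def)
  have "hamiltonian V M" if "longest_path V H P" "j = card V - length P"
    "H \<subseteq> M" "expander V a H" "card H + j \<le> k" for j P H
    using that
  proof (induction j arbitrary: H P rule: less_induct)
    case (less j)
    show ?case
    proof (cases "hamiltonian V H")
      case True
      then show ?thesis using hamiltonian_mono less.prems by blast
    next
      case False
      then obtain e where e: "e \<in> boosters V H" "e \<in> M" using boost[OF less.prems(3) _ less.prems(4)] less.prems by auto
      let ?H = "insert e H"
      have sub: "?H \<subseteq> M" using e less.prems by auto
      have ex: "expander V a ?H"
        by (rule expander_mono[OF less.prems(4)]) (use V M sub in auto)
      show ?thesis
      proof (cases "hamiltonian V ?H")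
        case True
        then show ?thesis using hamiltonian_mono sub by blast
      next
        case nh: False
        obtain Q where Q: "longest_path V ?H Q" using ex_longest_path[OF V] by blast
        obtain p where p: "is_path V ?H p" "\<forall>q. is_path V H q \<longrightarrow> length q < length p"
          using e(1) nh unfolding boosters_def booster_def by auto
        have "length P < length p" using p less.prems(1) by (auto simp: longest_path_def)
        also have "\<dots> \<le> length Q" using Q p by (auto simp: longest_path_def)
        finally have PQ: "length P < length Q" .
        have "length Q \<le> card V" using len[of ?H Q] Q by (auto simp: longest_path_def)
        then have j: "card V - length Q < j" using PQ less.prems by auto
        have "card ?H \<le> Suc (card H)" by (rule card_insert_le_m1) auto
        then show ?thesis
          by (intro less.IH[OF j Q refl sub ex]) (use j less.prems(5) in linarith)
      qed
    qed
  qed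
  moreover obtain P where "longest_path V H P" using ex_longest_path[OF V] by blast
  ultimately show ?thesis using H by fastforce
qed

section \<open>Balanced orientations\<close>

definition outflow :: "('v \<times> 'v) \<Rightarrow> 'v \<Rightarrow> int" where
  "outflow p w = of_bool (fst p = w) - of_bool (snd p = w)"

text \<open>
  By induction on the number of edges of a multigraph: two edges with a common end \<open>v\<close> are
  replaced by a single edge between their other ends, and an orientation of the latter is
  lifted to a directed walk through \<open>v\<close>.
\<close>

lemma balanced_orientation:
  fixes p :: "'i \<Rightarrow> 'v \<times> 'v"
  assumes "finite I"
  shows "\<exists>q. (\<forall>i\<in>I. q i = p i \<or> q i = prod.swap (p i)) \<and> (\<forall>w. \<bar>\<Sum>i\<in>I. outflow (q i) w\<bar> \<le> 1)"
  using assms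
proof (induction "card I" arbitrary: I p rule: less_induct)
  case less
  show ?case
  proof (cases "\<exists>i\<in>I. \<exists>j\<in>I. i \<noteq> j \<and> {fst (p i), snd (p i)} \<inter> {fst (p j), snd (p j)} \<noteq> {}")
    case False
    have "\<bar>\<Sum>i\<in>I. outflow (p i) w\<bar> \<le> 1" for w
    proof (cases "\<exists>i\<in>I. w \<in> {fst (p i), snd (p i)}")
      case True
      then obtain i where i: "i \<in> I" "w \<in> {fst (p i), snd (p i)}" by auto
      have "outflow (p j) w = 0" if "j \<in> I - {i}" for j
        using False i that by (auto simp: outflow_def)
      then have "(\<Sum>j\<in>I. outflow (p j) w) = outflow (p i) w"
        using less.prems i by (simp add: sum.remove)
      then show ?thesis by (simp add: outflow_def)
    next
      case False
      then have "(\<Sum>j\<in>I. outflow (p j) w) = 0" by (intro sum.neutral) (auto simp: outflow_def)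
      then show ?thesis by simp
    qed
    then show ?thesis by blast
  next
    case True
    then obtain i j v where ij: "i \<in> I" "j \<in> I" "i \<noteq> j" "v \<in> {fst (p i), snd (p i)}" "v \<in> {fst (p j), snd (p j)}"
      by blast
    obtain a where a: "p i = (a, v) \<or> p i = (v, a)" using ij(4) by (cases "p i") auto
    obtain b where b: "p j = (b, v) \<or> p j = (v, b)" using ij(5) by (cases "p j") auto
    \<comment> \<open>The edges \<open>i\<close> and \<open>j\<close> are merged under the index
      \<open>i\<close>. The result may be a loop or a parallel edge, which the indexed formulation
      permits.\<close>
    define p' where "p' = p(i := (a, b))"
    let ?I = "I - {j}"
    have "card ?I < card I" using ij(2) less.prems by (intro card_Diff1_less)
    from less.hyps[OF this, of p'] less.prems
    obtain q where q: "\<forall>k\<in>?I. q k = p' k \<or> q k = prod.swap (p' k)" "\<forall>w. \<bar>\<Sum>k\<in>?I. outflow (q k) w\<bar> \<le> 1"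
      by auto
    have "i \<in> ?I" using ij by auto
    then have "q i = p' i \<or> q i = prod.swap (p' i)" using q(1) by blast
    then have qi: "q i = (a, b) \<or> q i = (b, a)" by (simp add: p'_def)
    \<comment> \<open>The oriented merged edge becomes a directed walk through \<open>v\<close>,
      entering and leaving it once, so no total outflow changes.\<close>
    define q' where "q' = (if q i = (a, b) then q(i := (a, v), j := (v, b)) else q(i := (v, a), j := (b, v)))"
    have "q' k = p k \<or> q' k = prod.swap (p k)" if k: "k \<in> I" for k
    proof (cases "k = i \<or> k = j")
      case True
      then show ?thesis using a b ij(3) by (auto simp: q'_def)
    next
      case False
      then have "k \<in> ?I" using k by auto
      then have "q k = p' k \<or> q k = prod.swap (p' k)" using q(1) by blast
      then show ?thesis using False by (simp add: q'_def p'_def)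
    qed
    moreover have "(\<Sum>k\<in>I. outflow (q' k) w) = (\<Sum>k\<in>?I. outflow (q k) w)" for w
    proof -
      have "(\<Sum>k\<in>I. outflow (q' k) w) = outflow (q' j) w + (outflow (q' i) w + (\<Sum>k\<in>?I - {i}. outflow (q' k) w))"
        using ij less.prems sum.remove[of I j "\<lambda>k. outflow (q' k) w"]
          sum.remove[of ?I i "\<lambda>k. outflow (q' k) w"] by simp
      also have "(\<Sum>k\<in>?I - {i}. outflow (q' k) w) = (\<Sum>k\<in>?I - {i}. outflow (q k) w)"
        by (rule sum.cong) (auto simp: q'_def)
      also have "outflow (q' j) w + (outflow (q' i) w + (\<Sum>k\<in>?I - {i}. outflow (q k) w)) =
          outflow (q i) w + (\<Sum>k\<in>?I - {i}. outflow (q k) w)"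
        using qi ij(3) by (cases "q i = (a, b)") (simp_all add: q'_def outflow_def)
      also have "\<dots> = (\<Sum>k\<in>?I. outflow (q k) w)"
        using ij less.prems by (intro sum.remove[symmetric]) auto
      finally show ?thesis .
    qed
    ultimately show ?thesis using q(2) by (intro exI[of _ q']) auto
  qed
qed

lemma simple_graph_finite: "simple_graph V E \<Longrightarrow> finite E"
  unfolding simple_graph_def by (rule finite_subset[of _ "Pow V"]) auto

text \<open>The tail of an edge in a balanced orientation owns it. The degree is the sum of
  out-degree and in-degree, which differ by at most one.\<close>

lemma fair_owner:
  assumes E: "simple_graph V E"
  shows "\<exists>f. (\<forall>e\<in>E. f e \<in> e) \<and> (\<forall>v. degree E v \<le> 2 * card {e\<in>E. f e = v} + 1)"
proof -
  have fin: "finite E" by (rule simple_graph_finite[OF E])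
  have "\<forall>e\<in>E. \<exists>x y. e = {x, y} \<and> x \<noteq> y"
    using E unfolding simple_graph_def by (auto simp: card_2_iff)
  then have "\<forall>e\<in>E. \<exists>p. e = {fst p, snd p} \<and> fst p \<noteq> snd p" by fastforce
  then obtain p where p: "\<And>e. e \<in> E \<Longrightarrow> e = {fst (p e), snd (p e)} \<and> fst (p e) \<noteq> snd (p e)" by metis
  obtain q where q: "\<forall>e\<in>E. q e = p e \<or> q e = prod.swap (p e)" "\<forall>w. \<bar>\<Sum>e\<in>E. outflow (q e) w\<bar> \<le> 1"
    using balanced_orientation[OF fin] by blast
  have qe: "e = {fst (q e), snd (q e)} \<and> fst (q e) \<noteq> snd (q e)" if "e \<in> E" for e
    using q(1) p[OF that] that by (metis fst_swap snd_swap insert_commute)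
  have "degree E v \<le> 2 * card {e\<in>E. fst (q e) = v} + 1" for v
  proof -
    let ?O = "{e\<in>E. fst (q e) = v}" and ?N = "{e\<in>E. snd (q e) = v}"
    have "v \<in> e \<longleftrightarrow> fst (q e) = v \<or> snd (q e) = v" if "e \<in> E" for e
      using qe[OF that] by (metis insert_iff singletonD)
    then have "{e\<in>E. v \<in> e} = ?O \<union> ?N" by auto
    moreover have "fst (q e) \<noteq> snd (q e)" if "e \<in> E" for e using qe[OF that] by simp
    then have "?O \<inter> ?N = {}" by force
    ultimately have deg: "degree E v = card ?O + card ?N"
      using fin by (simp add: degree_def card_Un_disjoint)
    have "(\<Sum>e\<in>E. outflow (q e) v) = int (card ?O) - int (card ?N)"
      using fin by (simp add: outflow_def sum_subtractf of_bool_def sum.If_cases Int_def flip: card_eq_sum)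
    moreover have "\<bar>\<Sum>e\<in>E. outflow (q e) v\<bar> \<le> 1" using q(2) by blast
    ultimately show ?thesis using deg by linarith
  qed
  moreover have "fst (q e) \<in> e" if "e \<in> E" for e using qe[OF that] by blast
  ultimately show ?thesis by (intro exI[of _ "\<lambda>e. fst (q e)"]) blast
qed

section \<open>Blocks of owned edges\<close>

lemma disjoint_blocks:
  fixes k r :: nat
  assumes "finite A" "k * r \<le> card A"
  shows "\<exists>B. (\<forall>i<k. B i \<subseteq> A \<and> card (B i) = r) \<and> (\<forall>i<k. \<forall>j<k. i \<noteq> j \<longrightarrow> B i \<inter> B j = {})"
  using assms(2)
proof (induction k)
  case 0
  then show ?case by auto
next
  case (Suc k)
  then obtain B where B: "\<forall>i<k. B i \<subseteq> A \<and> card (B i) = r" "\<forall>i<k. \<forall>j<k. i \<noteq> j \<longrightarrow> B i \<inter> B j = {}"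
    by auto
  have "card (\<Union>i<k. B i) \<le> (\<Sum>i<k. card (B i))" by (rule card_UN_le) simp
  also have "\<dots> = k * r" using B by simp
  finally have "card (\<Union>i<k. B i) \<le> k * r" .
  then have "r \<le> card (A - (\<Union>i<k. B i))"
  proof -
    have "finite (\<Union>i<k. B i)"
    proof (rule finite_subset[OF _ assms(1)])
      show "(\<Union>i<k. B i) \<subseteq> A" using B(1) by blast
    qed
    then have "card A - card (\<Union>i<k. B i) \<le> card (A - (\<Union>i<k. B i))"
      by (rule diff_card_le_card_Diff)
    with \<open>card (\<Union>i<k. B i) \<le> k * r\<close> Suc.prems show ?thesis by simp
  qed
  then obtain C where C: "C \<subseteq> A - (\<Union>i<k. B i)" "card C = r" by (meson obtain_subset_with_card_n)
  have CB: "C \<inter> B i = {}" if "i < k" for i using C(1) that by auto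
  show ?case
  proof (intro exI[of _ "B(k := C)"] conjI allI impI)
    fix i assume "i < Suc k"
    then show "(B(k := C)) i \<subseteq> A" "card ((B(k := C)) i) = r" using B(1) C by (auto simp: less_Suc_eq)
  next
    fix i j assume ij: "i < Suc k" "j < Suc k" "i \<noteq> j"
    then consider "i < k" "j < k" | "i = k" "j < k" | "i < k" "j = k" by linarith
    then show "(B(k := C)) i \<inter> (B(k := C)) j = {}"
      by cases (use B(2) CB ij in \<open>simp_all add: Int_commute\<close>)
  qed
qed

text \<open>One edge will be reserved in each block, and the blocks \<open>2 * i\<close> and
  \<open>2 * i + 1\<close> at \<open>v\<close> supply one of four pairs. Disjointness makes all
  reserved edges distinct, however they are chosen.\<close>

definition block_system :: "'v set \<Rightarrow> 'v set set \<Rightarrow> nat \<Rightarrow> ('v \<times> nat \<Rightarrow> 'v set set) \<Rightarrow> bool" where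
  "block_system V E r B \<longleftrightarrow>
     (\<forall>v\<in>V. \<forall>i<8. B (v, i) \<subseteq> {e\<in>E. v \<in> e} \<and> card (B (v, i)) = r) \<and>
     (\<forall>s\<in>V \<times> {..<8}. \<forall>t\<in>V \<times> {..<8}. s \<noteq> t \<longrightarrow> B s \<inter> B t = {})"

text \<open>By \<open>fair_owner\<close> every vertex owns at least \<open>8 * r\<close> edges,
  which are cut into eight blocks. Blocks of different vertices are disjoint since an edge has one
  owner.\<close>

lemma block_system_exists:
  assumes E: "simple_graph V E" and deg: "\<And>v. v \<in> V \<Longrightarrow> degree E v > 16 * r"
  shows "\<exists>B. block_system V E r B"
proof -
  have fin: "finite E" by (rule simple_graph_finite[OF E])
  obtain f where f: "\<forall>e\<in>E. f e \<in> e" "\<forall>v. degree E v \<le> 2 * card {e\<in>E. f e = v} + 1"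
    using fair_owner[OF E] by blast
  have "\<exists>B. (\<forall>i<(8::nat). B i \<subseteq> {e\<in>E. f e = v} \<and> card (B i) = r) \<and> (\<forall>i<8. \<forall>j<8::nat. i \<noteq> j \<longrightarrow> B i \<inter> B j = {})"
    if "v \<in> V" for v
  proof (rule disjoint_blocks)
    have "degree E v \<le> 2 * card {e\<in>E. f e = v} + 1" using f(2) by blast
    with deg[OF that] show "8 * r \<le> card {e\<in>E. f e = v}" by linarith
  qed (use fin in simp)
  then have "\<exists>B. \<forall>v\<in>V. (\<forall>i<(8::nat). B v i \<subseteq> {e\<in>E. f e = v} \<and> card (B v i) = r) \<and>
      (\<forall>i<8. \<forall>j<8::nat. i \<noteq> j \<longrightarrow> B v i \<inter> B v j = {})" by (intro bchoice ballI)
  then obtain B where "\<forall>v\<in>V. (\<forall>i<(8::nat). B v i \<subseteq> {e\<in>E. f e = v} \<and> card (B v i) = r) \<and>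
      (\<forall>i<8. \<forall>j<8::nat. i \<noteq> j \<longrightarrow> B v i \<inter> B v j = {})" ..
  note B = bspec[OF this]
  have "block_system V E r (\<lambda>(v, i). B v i)"
    unfolding block_system_def
  proof (intro conjI ballI allI impI)
    fix v i assume v: "v \<in> V" "i < (8::nat)"
    have "B v i \<subseteq> {e\<in>E. f e = v}" "card (B v i) = r" using B[OF v(1)] v(2) by auto
    then show "(case (v, i) of (v, i) \<Rightarrow> B v i) \<subseteq> {e\<in>E. v \<in> e}" "card (case (v, i) of (v, i) \<Rightarrow> B v i) = r"
      using f(1) by auto
  next
    fix s t assume st: "s \<in> V \<times> {..<8::nat}" "t \<in> V \<times> {..<8::nat}" "s \<noteq> t"
    obtain u i where s: "s = (u, i)" by (cases s)
    obtain v j where t: "t = (v, j)" by (cases t)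
    show "(case s of (v, i) \<Rightarrow> B v i) \<inter> (case t of (v, i) \<Rightarrow> B v i) = {}"
    proof (cases "u = v")
      case True
      then show ?thesis using B[of v] st s t by auto
    next
      case False
      have "B u i \<subseteq> {e\<in>E. f e = u}" "B v j \<subseteq> {e\<in>E. f e = v}" using B[of u] B[of v] st s t by auto
      then show ?thesis using False s t by auto
    qed
  qed
  then show ?thesis by blast
qed

text \<open>A uniform choice of one element per block picks up all of \<open>F\<close> with
  probability at most \<open>(1 / r) ^ card F\<close>: each element of \<open>F\<close> can come
  from only one index, so the values at \<open>card F\<close> indices are forced.\<close>

lemma card_choices_containing:
  fixes B :: "'i \<Rightarrow> 'e set"
  assumes I: "finite I" and B: "\<And>i. i \<in> I \<Longrightarrow> card (B i) = r" "\<And>i j. i \<in> I \<Longrightarrow> j \<in> I \<Longrightarrow> i \<noteq> j \<Longrightarrow> B i \<inter> B j = {}"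
    and r: "r > 0" and F: "finite F"
  shows "card {g \<in> PiE I B. F \<subseteq> g ` I} * r ^ card F \<le> r ^ card I"
proof (cases "{g \<in> PiE I B. F \<subseteq> g ` I} = {}")
  case True
  then show ?thesis by (simp only: True) simp
next
  case False
  then obtain g0 where g0: "g0 \<in> PiE I B" "F \<subseteq> g0 ` I" by auto
  have finB: "finite (B i)" if "i \<in> I" for i using B(1)[OF that] r by (simp add: card_ge_0_finite)
  \<comment> \<open>One witness \<open>g0\<close> shows which index supplies each element of
    \<open>F\<close>; by disjointness every other such choice uses the same index.\<close>
  define \<iota> where "\<iota> e = (SOME i. i \<in> I \<and> g0 i = e)" for e
  have \<iota>: "\<iota> e \<in> I \<and> g0 (\<iota> e) = e" if "e \<in> F" for e
    unfolding \<iota>_def by (rule someI_ex) (use g0(2) that in auto)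
  have inj: "inj_on \<iota> F" by (rule inj_onI) (metis \<iota>)
  let ?J = "\<iota> ` F"
  have J: "?J \<subseteq> I" "finite ?J" "card ?J = card F" using \<iota> F inj by (auto simp: card_image)
  have fixed: "g (\<iota> e) = e" if g: "g \<in> PiE I B" "F \<subseteq> g ` I" and e: "e \<in> F" for g e
  proof -
    obtain i where i: "i \<in> I" "g i = e" using g e by auto
    have "e \<in> B i" using g(1) i by auto
    moreover have "e \<in> B (\<iota> e)" using g0(1) \<iota>[OF e] by (metis PiE_mem)
    ultimately have "i = \<iota> e" using B(2)[of i "\<iota> e"] i \<iota>[OF e] by auto
    then show ?thesis using i by simp
  qed
  let ?S = "{g \<in> PiE I B. F \<subseteq> g ` I}"
  have "inj_on (\<lambda>g. restrict g (I - ?J)) ?S"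
  proof (rule inj_onI)
    fix g h assume g: "g \<in> ?S" and h: "h \<in> ?S" and eq: "restrict g (I - ?J) = restrict h (I - ?J)"
    show "g = h"
    proof (rule PiE_ext[of g I B h])
      fix i assume i: "i \<in> I"
      show "g i = h i"
      proof (cases "i \<in> ?J")
        case True
        then obtain e where e: "e \<in> F" "i = \<iota> e" by auto
        have "g (\<iota> e) = e" "h (\<iota> e) = e" using fixed[OF _ _ e(1)] g h by blast+
        then show ?thesis using e(2) by simp
      next
        case False
        then show ?thesis using fun_cong[OF eq, of i] i by simp
      qed
    qed (use g h in auto)
  qed
  moreover have "(\<lambda>g. restrict g (I - ?J)) ` ?S \<subseteq> PiE (I - ?J) B" by (auto simp: PiE_def)
  moreover have "finite (PiE (I - ?J) B)" using I finB by (intro finite_PiE) auto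
  ultimately have "card ?S \<le> card (PiE (I - ?J) B)" by (rule card_inj_on_le)
  also have "\<dots> = r ^ (card I - card F)"
    using I J B(1) by (simp add: card_PiE card_Diff_subset)
  finally have "card ?S * r ^ card F \<le> r ^ (card I - card F) * r ^ card F" by (rule mult_right_mono) simp
  also have "\<dots> = r ^ card I"
    using J I by (simp flip: power_add) (metis card_mono le_add_diff_inverse2)
  finally show ?thesis .
qed

section \<open>Switchings\<close>

definition nbh :: "'v set set \<Rightarrow> 'v \<Rightarrow> 'v set" where
  "nbh E v = {w. {v, w} \<in> E}"

definition darts :: "'v set set \<Rightarrow> ('v \<times> 'v) set" where
  "darts E = {(x, y). {x, y} \<in> E}"

lemma simple_graphD:
  assumes "simple_graph V E" "{x, y} \<in> E"
  shows "x \<noteq> y" "x \<in> V" "y \<in> V"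
  using assms by (auto simp: simple_graph_def)

lemma nbh_subset: "simple_graph V E \<Longrightarrow> nbh E v \<subseteq> V"
  by (auto simp: nbh_def dest: simple_graphD)

lemma finite_nbh: "simple_graph V E \<Longrightarrow> finite (nbh E v)"
  by (rule finite_subset[OF nbh_subset]) (auto simp: simple_graph_def)

lemma card_nbh:
  assumes E: "simple_graph V E"
  shows "card (nbh E v) = degree E v"
proof -
  have "{e\<in>E. v \<in> e} = (\<lambda>w. {v, w}) ` nbh E v"
  proof
    show "{e\<in>E. v \<in> e} \<subseteq> (\<lambda>w. {v, w}) ` nbh E v"
    proof
      fix e assume e: "e \<in> {e\<in>E. v \<in> e}"
      then have "card e = 2" using E by (auto simp: simple_graph_def)
      then obtain w where "e = {v, w}" using e by (auto simp: card_2_iff)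
      then show "e \<in> (\<lambda>w. {v, w}) ` nbh E v" using e by (auto simp: nbh_def)
    qed
  qed (auto simp: nbh_def)
  moreover have "inj_on (\<lambda>w. {v, w}) (nbh E v)" by (auto simp: inj_on_def doubleton_eq_iff)
  ultimately show ?thesis by (simp add: degree_def card_image)
qed

lemma darts_subset: "E \<subseteq> {e. e \<subseteq> V \<and> card e = 2} \<Longrightarrow> darts E \<subseteq> V \<times> V"
  by (auto simp: darts_def)

lemma finite_darts:
  assumes "finite E"
  shows "finite (darts E)"
proof -
  have "finite {(x, y). {x, y} = e}" for e :: "'a set"
  proof (cases "finite e")
    case True
    then show ?thesis by (intro finite_subset[OF _ finite_cartesian_product[OF True True]]) auto
  next
    case False
    then have "{(x, y). {x, y} = e} = {}" by auto
    then show ?thesis by simp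
  qed
  moreover have "darts E = (\<Union>e\<in>E. {(x, y). {x, y} = e})" by (auto simp: darts_def)
  ultimately show ?thesis using assms by simp
qed

lemma card_darts_le:
  assumes "finite E"
  shows "card (darts E) \<le> 2 * card E"
  by (rule card_le_unordered_pairs[OF assms]) (auto simp: darts_def)

lemma card_darts_ge:
  assumes V: "finite V" and E: "E \<subseteq> {e. e \<subseteq> V \<and> card e = 2}"
  shows "2 * card E \<le> card (darts E)"
proof -
  have fin: "finite E" by (rule finite_subset[of _ "Pow V"]) (use V E in auto)
  have fd: "finite (darts E)" by (rule finite_subset[OF darts_subset[OF E]]) (use V in simp)
  have two: "finite {(x, y). {x, y} = e} \<and> card {(x, y). {x, y} = e} = 2" if "e \<in> E" for e
  proof -
    obtain a b where ab: "e = {a, b}" "a \<noteq> b" using E \<open>e \<in> E\<close> by (force simp: card_2_iff)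
    have "{(x, y). {x, y} = e} = {(a, b), (b, a)}" unfolding ab doubleton_eq_iff by blast
    then show ?thesis using ab(2) by simp
  qed
  have "2 * card E = (\<Sum>e\<in>E. card {(x, y). {x, y} = e})" using two by simp
  also have "\<dots> = card (\<Union>e\<in>E. {(x, y). {x, y} = e})"
    by (rule card_UN_disjoint[symmetric]) (use fin two in auto)
  also have "\<dots> \<le> card (darts E)" by (rule card_mono[OF fd]) (auto simp: darts_def)
  finally show ?thesis .
qed

lemma regular_graph_simple: "regular_graph d V G \<Longrightarrow> simple_graph V G"
  by (simp add: regular_graph_def)

lemma regular_graph_nbh:
  assumes "regular_graph d V G"
  shows "finite (nbh G v)" "card (nbh G v) \<le> d" "v \<in> V \<Longrightarrow> card (nbh G v) = d"
proof -
  have s: "simple_graph V G" by (rule regular_graph_simple[OF assms])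
  show "finite (nbh G v)" by (rule finite_nbh[OF s])
  show 1: "v \<in> V \<Longrightarrow> card (nbh G v) = d" using assms card_nbh[OF s] by (simp add: regular_graph_def)
  have "nbh G v = {}" if "v \<notin> V" using that by (auto simp: nbh_def dest: simple_graphD[OF s])
  then show "card (nbh G v) \<le> d" using 1 by fastforce
qed

lemma regular_graphI:
  assumes "simple_graph V G" "\<And>v. v \<in> V \<Longrightarrow> card (nbh G v) = d"
  shows "regular_graph d V G"
  using assms card_nbh[OF assms(1)] by (simp add: regular_graph_def)

lemma card_darts_regular:
  assumes "regular_graph d V G"
  shows "card (darts G) = card V * d" "finite (darts G)"
proof -
  have s: "simple_graph V G" by (rule regular_graph_simple[OF assms])
  have eq: "darts G = Sigma V (nbh G)" by (auto simp: darts_def nbh_def dest: simple_graphD[OF s])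
  have "finite V" using s by (simp add: simple_graph_def)
  then show "card (darts G) = card V * d" "finite (darts G)"
    unfolding eq using regular_graph_nbh[OF assms] by (auto simp: card_SigmaI)
qed

lemma regular_graph_edges:
  assumes "regular_graph d V G"
  shows "2 * card G = card V * d" "finite G"
proof -
  have s: "simple_graph V G" by (rule regular_graph_simple[OF assms])
  show f: "finite G" by (rule simple_graph_finite[OF s])
  show "2 * card G = card V * d"
    using card_darts_le[OF f] card_darts_ge[of V G] s card_darts_regular(1)[OF assms]
    by (simp add: simple_graph_def)
qed

lemma card_Sigma_le:
  assumes "finite A" "\<And>x. x \<in> A \<Longrightarrow> finite (B x)" "\<And>x. x \<in> A \<Longrightarrow> card (B x) \<le> k"
  shows "card (Sigma A B) \<le> card A * k"
proof -
  have "card (Sigma A B) = (\<Sum>x\<in>A. card (B x))" using assms by (simp add: card_SigmaI)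
  also have "\<dots> \<le> (\<Sum>x\<in>A. k)" by (rule sum_mono) (use assms in auto)
  finally show ?thesis by simp
qed

section \<open>The switching operation and double counting\<close>

definition switch :: "'v set set \<Rightarrow> 'v \<Rightarrow> 'v \<Rightarrow> 'v \<Rightarrow> 'v \<Rightarrow> 'v set set" where
  "switch G u v x y = insert {u, v} (insert {x, y} (G - {{u, x}, {v, y}}))"

lemma switch_sym:
  "switch G u v x y = switch G v u y x" "switch G u v x y = switch G x y u v"
  by (auto simp: switch_def insert_commute)

lemma switch_inverse:
  assumes "{u, x} \<in> G" "{v, y} \<in> G" "{u, v} \<notin> G" "{x, y} \<notin> G"
  shows "switch (switch G u v x y) u x v y = G"
  using assms by (auto simp: switch_def)

text \<open>Only the corner \<open>u\<close> is treated; \<open>switch_sym\<close> carries the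
  result to the other three.\<close>

lemma switch_nbh:
  assumes G: "simple_graph V G" and e: "{u, x} \<in> G" "{v, y} \<in> G" "{u, v} \<notin> G" "{x, y} \<notin> G" "u \<noteq> v" "x \<noteq> y"
  shows "card (nbh (switch G u v x y) u) = card (nbh G u)"
proof -
  have ne: "u \<noteq> x" "v \<noteq> y" using simple_graphD[OF G] e by auto
  have ne2: "x \<noteq> v" "y \<noteq> u" using e by (auto simp: insert_commute)
  have "nbh (switch G u v x y) u = insert v (nbh G u - {x})"
  proof (rule set_eqI)
    fix w
    have "{u, w} = {u, v} \<longleftrightarrow> w = v" "{u, w} = {u, x} \<longleftrightarrow> w = x" "{u, w} \<noteq> {x, y}" "{u, w} \<noteq> {v, y}"
      using ne ne2 e(5) by (auto simp: doubleton_eq_iff)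
    then show "w \<in> nbh (switch G u v x y) u \<longleftrightarrow> w \<in> insert v (nbh G u - {x})"
      by (simp add: nbh_def switch_def)
  qed
  moreover have "v \<notin> nbh G u" "x \<in> nbh G u" using e by (auto simp: nbh_def)
  ultimately show ?thesis using finite_nbh[OF G, of u]
    by (metis DiffD1 card_Suc_Diff1 card_insert_disjoint finite_Diff)
qed

lemma switch_regular:
  assumes G: "regular_graph d V G"
    and e: "{u, x} \<in> G" "{v, y} \<in> G" "{u, v} \<notin> G" "{x, y} \<notin> G" "u \<noteq> v" "x \<noteq> y"
  shows "regular_graph d V (switch G u v x y)"
proof (rule regular_graphI)
  have s: "simple_graph V G" by (rule regular_graph_simple[OF G])
  show "simple_graph V (switch G u v x y)"
    using s e simple_graphD[OF s e(1)] simple_graphD[OF s e(2)] by (auto simp: simple_graph_def switch_def)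
  fix w assume w: "w \<in> V"
  have ec: "{x, u} \<in> G" "{y, v} \<in> G" "{v, u} \<notin> G" "{y, x} \<notin> G" using e by (simp_all add: insert_commute)
  show "card (nbh (switch G u v x y) w) = d"
  proof (cases "w \<in> {u, v, x, y}")
    case True
    have "card (nbh (switch G u v x y) u) = card (nbh G u)" by (rule switch_nbh[OF s e])
    moreover have "card (nbh (switch G v u y x) v) = card (nbh G v)"
      by (rule switch_nbh[OF s e(2,1) ec(3,4)]) (use e in auto)
    moreover have "card (nbh (switch G x y u v) x) = card (nbh G x)"
      by (rule switch_nbh[OF s ec(1,2) e(4,3,6,5)])
    moreover have "card (nbh (switch G y x v u) y) = card (nbh G y)"
      by (rule switch_nbh[OF s ec(2,1) ec(4,3)]) (use e in auto)
    moreover have "switch G v u y x = switch G u v x y" "switch G x y u v = switch G u v x y"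
      "switch G y x v u = switch G u v x y"
      using switch_sym by metis+
    ultimately have "card (nbh (switch G u v x y) w) = card (nbh G w)" using True by auto
    then show ?thesis using regular_graph_nbh(3)[OF G w] by simp
  next
    case False
    then have "{w, z} \<noteq> {u, v}" "{w, z} \<noteq> {x, y}" "{w, z} \<noteq> {u, x}" "{w, z} \<noteq> {v, y}" for z
      by (auto simp: doubleton_eq_iff)
    then have "nbh (switch G u v x y) w = nbh G w" by (simp add: nbh_def switch_def)
    then show ?thesis using regular_graph_nbh(3)[OF G w] by simp
  qed
qed

text \<open>The moves \<open>T G\<close> lead from \<open>A\<close> to \<open>A'\<close>, and
  \<open>T'\<close> bounds how many arrive at one target. The target together with \<open>t\<close>
  determines \<open>G\<close> through \<open>\<psi>\<close>, so no move is counted twice.\<close>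

lemma double_count:
  fixes T :: "'g \<Rightarrow> 't set" and T' :: "'h \<Rightarrow> 't set"
  assumes fin: "finite A" "finite A'"
    and T: "\<And>G. G \<in> A \<Longrightarrow> f \<le> card (T G)"
    and \<phi>: "\<And>G t. G \<in> A \<Longrightarrow> t \<in> T G \<Longrightarrow> \<phi> G t \<in> A' \<and> t \<in> T' (\<phi> G t) \<and> \<psi> (\<phi> G t) t = G"
    and T': "\<And>G. G \<in> A' \<Longrightarrow> finite (T' G) \<and> card (T' G) \<le> g"
  shows "card A * f \<le> card A' * g"
proof -
  have finT: "finite (T G)" if "G \<in> A" for G
  proof (rule finite_subset)
    show "T G \<subseteq> (\<Union>G'\<in>A'. T' G')" using \<phi>[OF that] by blast
  qed (use fin T' in auto)
  have "card A * f = (\<Sum>G\<in>A. f)" by simp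
  also have "\<dots> \<le> (\<Sum>G\<in>A. card (T G))" by (rule sum_mono) (rule T)
  also have "\<dots> = card (Sigma A T)" using fin finT by (simp add: card_SigmaI)
  also have "\<dots> \<le> card (Sigma A' T')"
  proof (rule card_inj_on_le)
    show "inj_on (\<lambda>(G, t). (\<phi> G t, t)) (Sigma A T)"
      by (rule inj_onI) (use \<phi> in \<open>auto, metis\<close>)
    show "(\<lambda>(G, t). (\<phi> G t, t)) ` Sigma A T \<subseteq> Sigma A' T'" using \<phi> by auto
    show "finite (Sigma A' T')" using fin T' by auto
  qed
  also have "\<dots> \<le> card A' * g" by (rule card_Sigma_le) (use fin T' in auto)
  finally show ?thesis .
qed

section \<open>Graphs containing a prescribed edge set\<close>

definition regulars :: "nat \<Rightarrow> 'v set \<Rightarrow> 'v set set \<Rightarrow> 'v set set set" where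
  "regulars d V H = {G. regular_graph d V G \<and> H \<subseteq> G}"

lemma finite_regulars: "finite V \<Longrightarrow> finite (regulars d V H)"
  by (rule finite_subset[OF _ finite_regular_graphs[of V d]]) (auto simp: regulars_def)

text \<open>The switching trades \<open>{u, v}\<close> and an edge \<open>{x, y}\<close> for
  \<open>{u, x}\<close> and \<open>{v, y}\<close>. Forwards at least \<open>f\<close> darts
  \<open>(x, y)\<close> qualify; backwards \<open>x\<close> and \<open>y\<close> are neighbours of
  \<open>u\<close> and \<open>v\<close>, which leaves at most \<open>d\<^sup>2\<close>
  choices.\<close>

lemma regulars_insert_edge:
  fixes V :: "'v set"
  assumes V: "finite V" and F: "finite F" and uv: "{u, v} \<notin> F" "u \<noteq> v"
    and f: "f + 2 * card F + 2 * d\<^sup>2 + 2 * d \<le> card V * d"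
  shows "card (regulars d V (insert {u, v} F)) * f \<le> card (regulars d V F) * d\<^sup>2"
proof -
  define T where "T G = {(x, y). {x, y} \<in> G \<and> {x, y} \<notin> F \<and> x \<noteq> u \<and> y \<noteq> v \<and> {u, x} \<notin> G \<and> {v, y} \<notin> G}"
    for G :: "'v set set"
  define T' where "T' G = nbh G u \<times> nbh G v" for G :: "'v set set"
  show ?thesis
  proof (rule double_count[where T = T and T' = T' and \<phi> = "\<lambda>G (x, y). switch G u x v y"
      and \<psi> = "\<lambda>G (x, y). switch G u v x y"])
    show "finite (regulars d V (insert {u, v} F))" "finite (regulars d V F)"
      by (rule finite_regulars[OF V])+
    show "finite (T' G) \<and> card (T' G) \<le> d\<^sup>2" if "G \<in> regulars d V F" for G
    proof -
      have G: "regular_graph d V G" using that by (simp add: regulars_def)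
      then show ?thesis using regular_graph_nbh[OF G]
        by (auto simp: T'_def card_cartesian_product power2_eq_square intro: mult_mono)
    qed
    have "switch G u x v y \<in> regulars d V F \<and> (x, y) \<in> T' (switch G u x v y) \<and> switch (switch G u x v y) u v x y = G"
      if G: "G \<in> regulars d V (insert {u, v} F)" and t: "(x, y) \<in> T G" for G x y
    proof -
      have G: "regular_graph d V G" "{u, v} \<in> G" "F \<subseteq> G" using G by (auto simp: regulars_def)
      have t: "{x, y} \<in> G" "{x, y} \<notin> F" "u \<noteq> x" "v \<noteq> y" "{u, x} \<notin> G" "{v, y} \<notin> G"
        using t by (auto simp: T_def)
      have "regular_graph d V (switch G u x v y)"
        by (rule switch_regular[OF G(1)]) (use G t in auto)
      moreover have "F \<subseteq> switch G u x v y" using G t uv by (auto simp: switch_def)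
      moreover have "(x, y) \<in> T' (switch G u x v y)" by (auto simp: T'_def nbh_def switch_def)
      moreover have "switch (switch G u x v y) u v x y = G" by (rule switch_inverse) (use G t in auto)
      ultimately show ?thesis by (simp add: regulars_def)
    qed
    then show "(case t of (x, y) \<Rightarrow> switch G u x v y) \<in> regulars d V F \<and> t \<in> T' (case t of (x, y) \<Rightarrow> switch G u x v y) \<and>
        (case t of (x, y) \<Rightarrow> switch (case t of (x, y) \<Rightarrow> switch G u x v y) u v x y) = G"
      if "G \<in> regulars d V (insert {u, v} F)" "t \<in> T G" for G t
      using that by (cases t) auto
    show "f \<le> card (T G)" if G: "G \<in> regulars d V (insert {u, v} F)" for G
    proof -
      have G: "regular_graph d V G" using G by (auto simp: regulars_def)
      note nb = regular_graph_nbh[OF G]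
      let ?A = "Sigma {u} (nbh G)" and ?B = "prod.swap ` Sigma {v} (nbh G)"
      let ?C = "Sigma (nbh G u) (nbh G)" and ?D = "prod.swap ` Sigma (nbh G v) (nbh G)"
      \<comment> \<open>A dart fails if it lies in \<open>F\<close>, if \<open>x = u\<close> or
        \<open>y = v\<close>, or if \<open>x\<close> is adjacent to \<open>u\<close> or
        \<open>y\<close> to \<open>v\<close>; this costs \<open>2 * card F\<close>,
        \<open>2 * d\<close> and \<open>2 * d\<^sup>2\<close>.\<close>
      have "darts G \<subseteq> T G \<union> (darts F \<union> (?A \<union> (?B \<union> (?C \<union> ?D))))"
      proof
        fix p assume "p \<in> darts G"
        then obtain x y where p: "p = (x, y)" "{x, y} \<in> G" by (auto simp: darts_def)
        have 1: "(x, y) \<in> ?B" if "y = v" using p(2) that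
          by (auto simp: nbh_def insert_commute image_iff)
        have 2: "(x, y) \<in> ?D" if "{v, y} \<in> G" using p(2) that
          by (force simp: nbh_def insert_commute image_iff)
        show "p \<in> T G \<union> (darts F \<union> (?A \<union> (?B \<union> (?C \<union> ?D))))"
          using p(2) 1 2 unfolding p(1) T_def darts_def by (auto simp: nbh_def)
      qed
      moreover have finT: "finite (T G)"
        by (rule finite_subset[OF _ card_darts_regular(2)[OF G]]) (auto simp: T_def darts_def)
      moreover have "finite (darts F)" by (rule finite_darts[OF F])
      ultimately have "card (darts G) \<le> card (T G \<union> (darts F \<union> (?A \<union> (?B \<union> (?C \<union> ?D)))))"
        using nb by (intro card_mono) auto
      also have "\<dots> \<le> card (T G) + (card (darts F) + (card ?A + (card ?B + (card ?C + card ?D))))"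
        by (meson add_left_mono card_Un_le order_trans)
      also have "\<dots> \<le> card (T G) + (2 * card F + (d + (d + (d * d + d * d))))"
      proof (intro add_mono order.refl)
        show "card (darts F) \<le> 2 * card F" by (rule card_darts_le[OF F])
        show "card ?A \<le> d" using card_Sigma_le[of "{u}" "nbh G" d] nb by simp
        show "card ?B \<le> d"
        proof -
          have "card ?B \<le> card (Sigma {v} (nbh G))" using nb(1) by (intro card_image_le) auto
          also have "\<dots> \<le> d" using card_Sigma_le[of "{v}" "nbh G" d] nb by simp
          finally show ?thesis .
        qed
        have S: "card (Sigma (nbh G w) (nbh G)) \<le> d * d" for w
          using card_Sigma_le[of "nbh G w" "nbh G" d] nb mult_le_mono1[OF nb(2)[of w], of d] by (meson order_trans)
        then show "card ?C \<le> d * d" .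
        show "card ?D \<le> d * d"
          using card_image_le[of "Sigma (nbh G v) (nbh G)" prod.swap] S[of v] nb by (meson finite_SigmaI order_trans)
      qed
      finally show ?thesis using f card_darts_regular(1)[OF G] by (simp add: power2_eq_square)
    qed
  qed
qed

text \<open>Edges are added one at a time, each for a factor \<open>2 * d / card V\<close>. The
  constant 4 in \<open>small\<close> is twice the loss in \<open>regulars_insert_edge\<close>, so at
  least half of all darts qualify there.\<close>

lemma regulars_containing:
  assumes V: "finite V" and F: "finite F" "F \<subseteq> {e. e \<subseteq> V \<and> card e = 2}"
    and small: "4 * card F + 4 * d\<^sup>2 + 4 * d \<le> card V * d" and d: "d > 0"
  shows "card (regulars d V F) * card V ^ card F \<le> card (regulars d V {}) * (2 * d) ^ card F"
  using F small
proof (induction F rule: finite_induct)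
  case empty
  then show ?case by simp
next
  case (insert e F)
  obtain u v where e: "e = {u, v}" "u \<noteq> v" using insert.prems(1) by (auto simp: card_2_iff)
  define f where "f = card V * d - (2 * card F + 2 * d\<^sup>2 + 2 * d)"
  have c: "card (insert e F) = Suc (card F)" using insert by simp
  have "4 * Suc (card F) + 4 * d\<^sup>2 + 4 * d \<le> card V * d" using insert.prems(2) c by simp
  then have f: "f + 2 * card F + 2 * d\<^sup>2 + 2 * d \<le> card V * d" "card V * d \<le> 2 * f"
    unfolding f_def by auto
  let ?X = "card (regulars d V (insert e F))" and ?Y = "card (regulars d V F)"
  have "?X * f \<le> ?Y * d\<^sup>2"
    unfolding e by (rule regulars_insert_edge[OF V insert.hyps(1)]) (use insert.hyps e f in auto)
  then have "?X * (2 * f) \<le> ?Y * (2 * d\<^sup>2)" by (simp add: mult.left_commute)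
  then have "?X * (card V * d) \<le> ?Y * (2 * d\<^sup>2)"
    using f(2) by (meson mult_le_mono2 order_trans)
  then have "(?X * card V) * d \<le> (?Y * (2 * d)) * d" by (simp add: power2_eq_square mult.assoc)
  then have step: "?X * card V \<le> ?Y * (2 * d)" using d by simp
  have "?X * card V ^ card (insert e F) = (?X * card V) * card V ^ card F" by (simp add: c)
  also have "\<dots> \<le> (?Y * (2 * d)) * card V ^ card F" by (rule mult_right_mono[OF step]) simp
  also have "\<dots> = (?Y * card V ^ card F) * (2 * d)" by (simp add: mult_ac)
  also have "\<dots> \<le> (card (regulars d V {}) * (2 * d) ^ card F) * (2 * d)"
    by (rule mult_right_mono) (use insert c in auto)
  finally show ?case by (simp add: c mult_ac)
qed


section \<open>Graphs meeting a given set of pairs\<close>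

text \<open>A switching now creates an edge \<open>{u, v}\<close> of \<open>B\<close> from two edges
  \<open>{u, x}\<close> and \<open>{v, y}\<close>. The second new edge \<open>{x, y}\<close> may lie
  in \<open>B\<close> too, hence a gain of one or two. Backwards, a dart of
  \<open>G \<inter> B\<close> and any further dart of \<open>G\<close> determine the move.\<close>

lemma regulars_gain:
  fixes V :: "'v set"
  assumes V: "finite V" and H: "finite H" and B: "B \<subseteq> {e. e \<subseteq> V \<and> card e = 2}" and d: "d > 0"
    and f: "f + 4 * (card H + k) * (card V * d) + 3 * card V * d ^ 3 \<le> 2 * card B * d\<^sup>2"
  shows "card {G \<in> regulars d V H. card (G \<inter> B) = k} * f \<le>
    (card {G \<in> regulars d V H. card (G \<inter> B) = k + 1} + card {G \<in> regulars d V H. card (G \<inter> B) = k + 2}) *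
    (2 * (k + 2) * (card V * d))"
proof -
  define A where "A j = {G \<in> regulars d V H. card (G \<inter> B) = j}" for j
  \<comment> \<open>Removing only edges outside \<open>H\<close> and \<open>B\<close> keeps
    \<open>H\<close> in the graph and loses no earlier hit.\<close>
  define T where "T G = {((u, x), (v, y)). {u, v} \<in> B \<and> {u, v} \<notin> G \<and> {u, x} \<in> G - (H \<union> B) \<and>
    {v, y} \<in> G - (H \<union> B) \<and> x \<noteq> y \<and> {x, y} \<notin> G}" for G
  define T' where "T' G = {((u, x), (v, y)). {u, v} \<in> G \<inter> B \<and> {x, y} \<in> G}" for G :: "'v set set"
  have finA: "finite (A j)" for j using finite_regulars[OF V] by (simp add: A_def)
  have "card (A k) * f \<le> card (A (k + 1) \<union> A (k + 2)) * (2 * (k + 2) * (card V * d))"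
  proof (rule double_count[where T = T and T' = T' and \<phi> = "\<lambda>G ((u, x), (v, y)). switch G u v x y"
      and \<psi> = "\<lambda>G ((u, x), (v, y)). switch G u x v y"])
    show "finite (A k)" "finite (A (k + 1) \<union> A (k + 2))" using finA by auto
    show "finite (T' G) \<and> card (T' G) \<le> 2 * (k + 2) * (card V * d)" if "G \<in> A (k + 1) \<union> A (k + 2)" for G
    proof -
      have G: "regular_graph d V G" "card (G \<inter> B) \<le> k + 2" using that by (auto simp: A_def regulars_def)
      have fin: "finite (G \<inter> B)" using regular_graph_edges(2)[OF G(1)] by simp
      let ?S = "darts (G \<inter> B) \<times> darts G"
      have "inj_on (\<lambda>((u, x), (v, y)). ((u, v), (x, y))) (T' G)" by (auto simp: inj_on_def)
      moreover have "(\<lambda>((u, x), (v, y)). ((u, v), (x, y))) ` T' G \<subseteq> ?S" by (auto simp: T'_def darts_def)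
      moreover have "finite ?S" using finite_darts[OF fin] card_darts_regular(2)[OF G(1)] by simp
      ultimately have "finite (T' G)" "card (T' G) \<le> card ?S"
        by (meson finite_imageD finite_subset, meson card_inj_on_le)
      moreover have "card ?S \<le> 2 * (k + 2) * (card V * d)"
        using card_darts_le[OF fin] G(2) card_darts_regular(1)[OF G(1)]
        by (simp only: card_cartesian_product) (intro mult_right_mono, auto)
      ultimately show ?thesis by linarith
    qed
    have switched: "switch G u v x y \<in> A (k + 1) \<union> A (k + 2) \<and> ((u, x), (v, y)) \<in> T' (switch G u v x y) \<and>
        switch (switch G u v x y) u x v y = G"
      if G: "G \<in> A k" and t: "((u, x), (v, y)) \<in> T G" for G u x v y
    proof -
      have G: "regular_graph d V G" "H \<subseteq> G" "card (G \<inter> B) = k" using G by (auto simp: A_def regulars_def)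
      have fin: "finite (G \<inter> B)" using regular_graph_edges(2)[OF G(1)] by simp
      have t: "{u, v} \<in> B" "{u, v} \<notin> G" "{u, x} \<in> G" "{u, x} \<notin> H" "{u, x} \<notin> B" "{v, y} \<in> G"
        "{v, y} \<notin> H" "{v, y} \<notin> B" "x \<noteq> y" "{x, y} \<notin> G"
        using t by (auto simp: T_def)
      have uv: "u \<noteq> v" using t(1) B by auto
      have "regular_graph d V (switch G u v x y)" by (rule switch_regular[OF G(1)]) (use t uv in auto)
      moreover have "H \<subseteq> switch G u v x y" using G t by (auto simp: switch_def)
      moreover have "card (switch G u v x y \<inter> B) = k + 1 \<or> card (switch G u v x y \<inter> B) = k + 2"
      proof (cases "{x, y} \<in> B \<and> {x, y} \<noteq> {u, v}")
        case True
        then have "switch G u v x y \<inter> B = insert {x, y} (insert {u, v} (G \<inter> B))"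
          using t by (auto simp: switch_def)
        then show ?thesis using True t fin G(3) by simp
      next
        case False
        then have "switch G u v x y \<inter> B = insert {u, v} (G \<inter> B)"
          using t by (auto simp: switch_def)
        then show ?thesis using t fin G(3) by simp
      qed
      moreover have "((u, x), (v, y)) \<in> T' (switch G u v x y)" using t by (auto simp: T'_def switch_def)
      moreover have "switch (switch G u v x y) u x v y = G" by (rule switch_inverse) (use t in auto)
      ultimately show ?thesis by (simp add: A_def regulars_def)
    qed
    show "(case t of (x, xa) \<Rightarrow> (case x of (u, x) \<Rightarrow> \<lambda>(v, y). switch G u v x y) xa) \<in> A (k + 1) \<union> A (k + 2) \<and>
      t \<in> T' (case t of (x, xa) \<Rightarrow> (case x of (u, x) \<Rightarrow> \<lambda>(v, y). switch G u v x y) xa) \<and>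
      (case t of (x, xa) \<Rightarrow> (case x of (u, x) \<Rightarrow> \<lambda>(v, y). switch
        (case t of (x, xa) \<Rightarrow> (case x of (u, x) \<Rightarrow> \<lambda>(v, y). switch G u v x y) xa) u x v y) xa) = G"
      if "G \<in> A k" "t \<in> T G" for G t
    proof -
      obtain u x v y where t: "t = ((u, x), (v, y))" by (metis surj_pair)
      show ?thesis using switched[of G u x v y] that unfolding t prod.case by blast
    qed
    show "f \<le> card (T G)" if G: "G \<in> A k" for G
    proof -
      have G: "regular_graph d V G" "H \<subseteq> G" "card (G \<inter> B) = k" using G by (auto simp: A_def regulars_def)
      note nb = regular_graph_nbh[OF G(1)]
      note dG = card_darts_regular[OF G(1)]
      let ?n = "card V" and ?D = "darts G"
      define Z where "Z = G \<inter> (H \<union> B)"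
      have finZ: "finite Z" using regular_graph_edges(2)[OF G(1)] by (simp add: Z_def)
      have "card Z \<le> card (H \<union> (G \<inter> B))"
        by (rule card_mono) (use H regular_graph_edges(2)[OF G(1)] in \<open>auto simp: Z_def\<close>)
      then have "card Z \<le> card H + k" using card_Un_le[of H "G \<inter> B"] G(3) by simp
      then have dZ: "card (darts Z) \<le> 2 * (card H + k)" using card_darts_le[OF finZ] by simp
      note fdZ = finite_darts[OF finZ]
      \<comment> \<open>All quadruples over \<open>B\<close> are counted first. Those that fail use
        an edge in \<open>Z\<close>, or have \<open>{u, v}\<close> already present
        (\<open>B1\<close>), \<open>x = y\<close> (\<open>B2\<close>), or \<open>{x, y}\<close>
        already present (\<open>B3\<close>).\<close>
      define all4 where "all4 = {((u, x), (v, y)). {u, v} \<in> B \<and> {u, x} \<in> G \<and> {v, y} \<in> G}"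
      define B1 where "B1 = Sigma ?D (\<lambda>(u, x). Sigma (nbh G u) (nbh G))"
      define B2 where "B2 = Sigma ?D (\<lambda>(u, x). nbh G x \<times> {x})"
      define B3 where "B3 = Sigma ?D (\<lambda>(u, x). prod.swap ` Sigma (nbh G x) (nbh G))"
      have S: "finite (Sigma (nbh G w) (nbh G))" "card (Sigma (nbh G w) (nbh G)) \<le> d * d" for w
        using card_Sigma_le[of "nbh G w" "nbh G" d] nb mult_le_mono1[OF nb(2)[of w], of d]
        by (auto intro: order_trans)
      have c1: "finite B1 \<and> card B1 \<le> ?n * d * (d * d)"
      proof
        show "finite B1" unfolding B1_def using dG(2) nb(1) by (auto intro!: finite_SigmaI)
        have "card B1 \<le> card ?D * (d * d)"
          unfolding B1_def by (rule card_Sigma_le) (use dG(2) S in \<open>auto simp: card_cartesian_product\<close>)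
        then show "card B1 \<le> ?n * d * (d * d)" by (simp add: dG(1))
      qed
      have c2: "finite B2 \<and> card B2 \<le> ?n * d * d"
      proof
        show "finite B2" unfolding B2_def using dG(2) nb(1) by (auto intro!: finite_SigmaI)
        have "card B2 \<le> card ?D * (d)"
          unfolding B2_def by (rule card_Sigma_le) (use dG(2) nb in \<open>auto simp: card_cartesian_product\<close>)
        then show "card B2 \<le> ?n * d * d" by (simp add: dG(1))
      qed
      have S': "finite (prod.swap ` Sigma (nbh G w) (nbh G))" "card (prod.swap ` Sigma (nbh G w) (nbh G)) \<le> d * d" for w
        using S[of w] card_image_le[OF S(1)[of w], of prod.swap] by (auto intro: order_trans)
      have c3: "finite B3 \<and> card B3 \<le> ?n * d * (d * d)"
      proof
        show "finite B3" unfolding B3_def using dG(2) S'(1) by (auto intro!: finite_SigmaI)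
        have "card B3 \<le> card ?D * (d * d)"
          unfolding B3_def by (rule card_Sigma_le) (use dG(2) S' in \<open>auto simp: card_cartesian_product\<close>)
        then show "card B3 \<le> ?n * d * (d * d)" by (simp add: dG(1))
      qed
      have "2 * card B * d\<^sup>2 \<le> card all4"
      proof -
        have dB: "darts B \<subseteq> V \<times> V" by (rule darts_subset[OF B])
        have fdB: "finite (darts B)" by (rule finite_subset[OF dB]) (use V in simp)
        have "2 * card B * d\<^sup>2 \<le> card (darts B) * d\<^sup>2"
          using card_darts_ge[OF V B] by (rule mult_right_mono) simp
        also have "\<dots> = (\<Sum>p\<in>darts B. d * d)" by (simp add: power2_eq_square)
        also have "\<dots> = (\<Sum>p\<in>darts B. card (nbh G (fst p) \<times> nbh G (snd p)))"
        proof (rule sum.cong)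
          fix p assume "p \<in> darts B"
          then have "fst p \<in> V" "snd p \<in> V" using dB by auto
          then show "d * d = card (nbh G (fst p) \<times> nbh G (snd p))"
            by (simp add: card_cartesian_product nb(3))
        qed simp
        also have "\<dots> = card (Sigma (darts B) (\<lambda>p. nbh G (fst p) \<times> nbh G (snd p)))"
          using fdB nb(1) by (simp add: card_SigmaI)
        also have "\<dots> \<le> card all4"
        proof (rule card_inj_on_le)
          show "inj_on (\<lambda>((u, v), (x, y)). ((u, x), (v, y))) (Sigma (darts B) (\<lambda>p. nbh G (fst p) \<times> nbh G (snd p)))"
            by (auto simp: inj_on_def)
          show "(\<lambda>((u, v), (x, y)). ((u, x), (v, y))) ` Sigma (darts B) (\<lambda>p. nbh G (fst p) \<times> nbh G (snd p)) \<subseteq> all4"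
            by (auto simp: all4_def darts_def nbh_def)
          show "finite all4"
            by (rule finite_subset[of _ "?D \<times> ?D"]) (use dG in \<open>auto simp: all4_def darts_def\<close>)
        qed
        finally show ?thesis .
      qed
      also have "card all4 \<le> card (T G \<union> (darts Z \<times> ?D \<union> (?D \<times> darts Z \<union> (B1 \<union> (B2 \<union> B3)))))"
      proof (rule card_mono)
        have "finite (T G)"
          by (rule finite_subset[of _ "?D \<times> ?D"]) (use dG in \<open>auto simp: T_def darts_def\<close>)
        then show "finite (T G \<union> (darts Z \<times> ?D \<union> (?D \<times> darts Z \<union> (B1 \<union> (B2 \<union> B3)))))"
          using fdZ dG c1 c2 c3 by auto
        show "all4 \<subseteq> T G \<union> (darts Z \<times> ?D \<union> (?D \<times> darts Z \<union> (B1 \<union> (B2 \<union> B3))))"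
        proof
          fix t assume "t \<in> all4"
          then obtain u x v y where t: "t = ((u, x), (v, y))" "{u, v} \<in> B" "{u, x} \<in> G" "{v, y} \<in> G"
            by (auto simp: all4_def)
          have "((u, x), (v, y)) \<in> B1" if "{u, v} \<in> G"
            using that t by (simp add: B1_def darts_def nbh_def)
          moreover have "((u, x), (v, y)) \<in> B2" if "x = y"
            using that t by (simp add: B2_def darts_def nbh_def insert_commute)
          moreover have "((u, x), (v, y)) \<in> B3" if "{x, y} \<in> G"
          proof -
            have "(y, v) \<in> Sigma (nbh G x) (nbh G)" using that t by (simp add: nbh_def insert_commute)
            then have "(v, y) \<in> prod.swap ` Sigma (nbh G x) (nbh G)" by (metis image_eqI swap_simp)
            then show ?thesis using t by (simp add: B3_def darts_def)
          qed
          ultimately show "t \<in> T G \<union> (darts Z \<times> ?D \<union> (?D \<times> darts Z \<union> (B1 \<union> (B2 \<union> B3))))"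
            using t(2-4) unfolding t(1) T_def Z_def darts_def by blast
        qed
      qed
      also have "\<dots> \<le> card (T G) + (card (darts Z \<times> ?D) + (card (?D \<times> darts Z) + (card B1 + (card B2 + card B3))))"
        by (meson add_left_mono card_Un_le order_trans)
      also have "\<dots> \<le> card (T G) + (2 * (card H + k) * (?n * d) + ((?n * d) * (2 * (card H + k)) +
          (?n * d * (d * d) + (?n * d * d + ?n * d * (d * d)))))"
        using c1 c2 c3 dZ dG(1) by (intro add_mono order.refl) (auto simp: card_cartesian_product)
      also have "\<dots> \<le> card (T G) + (4 * (card H + k) * (?n * d) + 3 * ?n * d ^ 3)"
      proof -
        have "?n * d * d \<le> ?n * d * (d * d)" using d by simp
        then show ?thesis by (simp add: power3_eq_cube algebra_simps)
      qed
      finally show ?thesis using f by linarith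
    qed
  qed
  also have "\<dots> \<le> (card (A (k + 1)) + card (A (k + 2))) * (2 * (k + 2) * (card V * d))"
    by (intro mult_right_mono card_Un_le) simp
  finally show ?thesis by (simp add: A_def)
qed

text \<open>Downward induction from \<open>K\<close>: in units of the bound claimed for
  \<open>a k\<close>, the next two terms are at most 2 and 4, and 2 + 4 is below 8.\<close>

lemma geometric_growth:
  fixes a :: "nat \<Rightarrow> nat"
  assumes "\<And>k. k < K \<Longrightarrow> 8 * a k \<le> a (k + 1) + a (k + 2)" "\<And>k. a k \<le> N"
  shows "a k * 2 ^ K \<le> N * 2 ^ k"
proof (induction "K - k" arbitrary: k rule: less_induct)
  case less
  show ?case
  proof (cases "k < K")
    case True
    have "a (k + 1) * 2 ^ K \<le> N * 2 ^ (k + 1)" "a (k + 2) * 2 ^ K \<le> N * 2 ^ (k + 2)"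
      by (rule less; use True in simp)+
    moreover have "8 * a k * 2 ^ K \<le> (a (k + 1) + a (k + 2)) * 2 ^ K"
      using assms(1)[OF True] by (rule mult_right_mono) simp
    ultimately show ?thesis by (simp add: algebra_simps)
  next
    case False
    then have "(2::nat) ^ K \<le> 2 ^ k" by (intro power_increasing) auto
    then show ?thesis using assms(2)[of k] by (intro mult_mono) auto
  qed
qed

text \<open>Given \<open>H\<close>, few hits are exponentially rare. Running
  \<open>geometric_growth\<close> up to \<open>2 * K\<close> bounds the share of graphs with
  \<open>k\<close> hits by \<open>2 ^ k / 2 ^ (2 * K)\<close>, and the sum over
  \<open>k \<le> K\<close> is still at most \<open>2 / 2 ^ K\<close>.\<close>

lemma regulars_few_hits:
  fixes V :: "'v set"
  assumes V: "finite V" "V \<noteq> {}" and H: "finite H" "card H \<le> h"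
    and B: "B \<subseteq> {e. e \<subseteq> V \<and> card e = 2}" and d: "d > 0"
    and big: "card V * (40 * K + 4 * h + 32 + 3 * d\<^sup>2) \<le> 2 * card B * d"
  shows "card {G \<in> regulars d V H. card (G \<inter> B) \<le> K} * 2 ^ K \<le> 2 * card (regulars d V H)"
proof -
  let ?A = "\<lambda>k. {G \<in> regulars d V H. card (G \<inter> B) = k}" and ?n = "card V"
  let ?N = "card (regulars d V H)"
  have finR: "finite (regulars d V H)" by (rule finite_regulars[OF V(1)])
  have pos: "?n * d > 0" using V d by (simp add: card_gt_0_iff)
  have "8 * card (?A k) \<le> card (?A (k + 1)) + card (?A (k + 2))" if k: "k < 2 * K" for k
  proof -
    \<comment> \<open>Eight times the backward count \<open>2 * (k + 2) * (?n * d)\<close>, with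
      \<open>2 * K + 2\<close> in place of \<open>k + 2\<close>.\<close>
    let ?f = "16 * (2 * K + 2) * (?n * d)"
    have "?f + 4 * (card H + k) * (?n * d) + 3 * ?n * d ^ 3 \<le>
        ?f + 4 * (h + 2 * K) * (?n * d) + 3 * ?n * d ^ 3"
      using H(2) k by (intro add_mono mult_right_mono mult_left_mono order.refl) auto
    also have "\<dots> = ?n * (40 * K + 4 * h + 32 + 3 * d\<^sup>2) * d"
      by (simp add: algebra_simps power2_eq_square power3_eq_cube)
    also have "\<dots> \<le> 2 * card B * d * d" by (rule mult_right_mono[OF big]) simp
    finally have f: "?f + 4 * (card H + k) * (?n * d) + 3 * ?n * d ^ 3 \<le> 2 * card B * d\<^sup>2"
      by (simp add: power2_eq_square mult.assoc)
    have "card (?A k) * ?f \<le> (card (?A (k + 1)) + card (?A (k + 2))) * (2 * (k + 2) * (?n * d))"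
      by (rule regulars_gain[OF V(1) H(1) B d f])
    also have "\<dots> \<le> (card (?A (k + 1)) + card (?A (k + 2))) * (2 * (2 * K + 2) * (?n * d))"
      using k by (intro mult_left_mono mult_right_mono) auto
    finally have "card (?A k) * ?f \<le> (card (?A (k + 1)) + card (?A (k + 2))) * (2 * (2 * K + 2) * (?n * d))" .
    moreover have "card (?A k) * ?f = (8 * card (?A k)) * (2 * (2 * K + 2) * (?n * d))" by (simp add: algebra_simps)
    ultimately have "(8 * card (?A k)) * (2 * (2 * K + 2) * (?n * d)) \<le>
        (card (?A (k + 1)) + card (?A (k + 2))) * (2 * (2 * K + 2) * (?n * d))" by (simp only:)
    moreover have "0 < 2 * (2 * K + 2) * (?n * d)" using pos by simp
    ultimately show ?thesis by (simp only: mult_le_cancel2)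
  qed
  then have growth: "card (?A k) * 2 ^ (2 * K) \<le> ?N * 2 ^ k" for k
    by (rule geometric_growth) (use finR in \<open>auto intro: card_mono\<close>)
  have "{G \<in> regulars d V H. card (G \<inter> B) \<le> K} = (\<Union>k\<le>K. ?A k)" by auto
  then have "card {G \<in> regulars d V H. card (G \<inter> B) \<le> K} \<le> (\<Sum>k\<le>K. card (?A k))"
    using card_UN_le[of "{..K}" ?A] by simp
  then have "card {G \<in> regulars d V H. card (G \<inter> B) \<le> K} * 2 ^ (2 * K) \<le> (\<Sum>k\<le>K. card (?A k) * 2 ^ (2 * K))"
    unfolding sum_distrib_right[symmetric] by (rule mult_right_mono) simp
  also have "\<dots> \<le> (\<Sum>k\<le>K. ?N * 2 ^ k)" by (rule sum_mono) (rule growth)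
  also have "\<dots> = ?N * (\<Sum>k\<le>K. 2 ^ k)" by (simp add: sum_distrib_left)
  also have "\<dots> \<le> ?N * 2 ^ Suc K"
  proof (rule mult_left_mono)
    have "(\<Sum>k\<le>K. 2 ^ k) + 1 = (2::nat) ^ Suc K" by (induction K) auto
    then show "(\<Sum>k\<le>K. 2 ^ k) \<le> (2::nat) ^ Suc K" by linarith
  qed simp
  finally have "card {G \<in> regulars d V H. card (G \<inter> B) \<le> K} * 2 ^ (2 * K) \<le> ?N * 2 ^ Suc K" .
  moreover have e: "(2::nat) ^ (2 * K) = 2 ^ K * 2 ^ K" by (simp add: mult_2 power_add)
  ultimately have "(card {G \<in> regulars d V H. card (G \<inter> B) \<le> K} * 2 ^ K) * 2 ^ K \<le> (2 * ?N) * 2 ^ K"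
    unfolding e by (simp only: power_Suc mult.assoc mult.left_commute)
  then show ?thesis by (simp only: mult_le_cancel2) simp
qed

section \<open>Existence of regular graphs\<close>

text \<open>The circulant graph with connection set \<open>S\<close>. As \<open>S\<close> is closed
  under passing from \<open>s\<close> to \<open>n - s\<close>, adjacency depends only on the
  difference modulo \<open>n\<close>, which maps the neighbours of \<open>v\<close> bijectively to
  \<open>S\<close>.\<close>

lemma circulant_regular:
  fixes n :: nat
  assumes S: "S \<subseteq> {1..<n}" "\<And>s. s \<in> S \<Longrightarrow> n - s \<in> S"
  shows "regular_graph (card S) {1..n} {{x, y} | x y. x \<in> {1..n} \<and> y \<in> {1..n} \<and> x < y \<and> y - x \<in> S}"
    (is "regular_graph _ _ ?E")
proof (rule regular_graphI)
  show "simple_graph {1..n} ?E" by (auto simp: simple_graph_def)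
  fix v assume v: "v \<in> {1..n}"
  have nbh: "w \<in> nbh ?E v \<longleftrightarrow> w \<in> {1..n} \<and> ((v < w \<and> w - v \<in> S) \<or> (w < v \<and> v - w \<in> S))" for w
    using v by (auto simp: nbh_def doubleton_eq_iff)
  have "bij_betw (\<lambda>w. if v < w then w - v else n - (v - w)) (nbh ?E v) S"
  proof (rule bij_betw_byWitness[where f' = "\<lambda>s. if v + s \<le> n then v + s else v + s - n"])
    show "\<forall>w\<in>nbh ?E v. (if v + (if v < w then w - v else n - (v - w)) \<le> n
        then v + (if v < w then w - v else n - (v - w)) else v + (if v < w then w - v else n - (v - w)) - n) = w"
      using v nbh by (auto split: if_splits)
    show "\<forall>s\<in>S. (if v < (if v + s \<le> n then v + s else v + s - n) then (if v + s \<le> n then v + s else v + s - n) - v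
        else n - (v - (if v + s \<le> n then v + s else v + s - n))) = s"
      using v S(1) by (auto split: if_splits)
    show "(\<lambda>w. if v < w then w - v else n - (v - w)) ` nbh ?E v \<subseteq> S"
    proof (rule image_subsetI)
      fix w assume w: "w \<in> nbh ?E v"
      show "(if v < w then w - v else n - (v - w)) \<in> S"
      proof (cases "v < w")
        case True
        then show ?thesis using w unfolding nbh by auto
      next
        case False
        then have "v - w \<in> S" using w unfolding nbh by auto
        then have "n - (v - w) \<in> S" by (rule S(2))
        then show ?thesis using False by (simp only: if_False)
      qed
    qed
    show "(\<lambda>s. if v + s \<le> n then v + s else v + s - n) ` S \<subseteq> nbh ?E v"
    proof
      fix w assume "w \<in> (\<lambda>s. if v + s \<le> n then v + s else v + s - n) ` S"
      then obtain s where s: "s \<in> S" "w = (if v + s \<le> n then v + s else v + s - n)" by auto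
      have "1 \<le> s" "s < n" "n - s \<in> S" using s S by auto
      moreover have "v - w = n - s" if "\<not> v + s \<le> n" using that s(2) v \<open>s < n\<close> by auto
      ultimately show "w \<in> nbh ?E v" unfolding nbh using v s by auto
    qed
  qed
  then show "card (nbh ?E v) = card S" by (rule bij_betw_same_card)
qed

text \<open>This makes the sample space nonempty. For odd \<open>d\<close> the number
  \<open>n\<close> is even, and the difference \<open>n / 2\<close>, which is its own complement,
  supplies the unpaired neighbour.\<close>

lemma regular_graph_exists:
  fixes d n :: nat
  assumes "d < n" "even (d * n)"
  shows "\<exists>E. regular_graph d {1..n} E"
proof (cases "even d")
  case True
  then obtain k where k: "d = 2 * k" by auto
  let ?S = "{1..k} \<union> {n - k..<n}"
  have "card ?S = d" using k assms by (subst card_Un_disjoint) auto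
  moreover have "regular_graph (card ?S) {1..n} {{x, y} | x y. x \<in> {1..n} \<and> y \<in> {1..n} \<and> x < y \<and> y - x \<in> ?S}"
    by (rule circulant_regular) (use k assms in auto)
  ultimately show ?thesis by auto
next
  case False
  then obtain k where k: "d = 2 * k + 1" by (auto elim: oddE)
  obtain m where m: "n = 2 * m" using False assms by auto
  let ?S = "{1..k} \<union> {n - k..<n} \<union> {m}"
  have km: "k < m" using k m assms by auto
  have "card ({1..k} \<union> {n - k..<n}) = 2 * k" using k assms by (subst card_Un_disjoint) auto
  then have "card ?S = d" using k m km by auto
  moreover have "regular_graph (card ?S) {1..n} {{x, y} | x y. x \<in> {1..n} \<and> y \<in> {1..n} \<and> x < y \<and> y - x \<in> ?S}"
    by (rule circulant_regular) (use k m km assms in auto)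
  ultimately show ?thesis by auto
qed

section \<open>Maker's strategy\<close>

text \<open>The obstruction left by a failure of expansion: \<open>s\<close> vertices and their at
  most \<open>2 * s\<close> neighbours span four edges for each of the \<open>s\<close>
  vertices.\<close>

definition locally_dense :: "'v set \<Rightarrow> nat \<Rightarrow> 'v set set \<Rightarrow> bool" where
  "locally_dense V a E \<longleftrightarrow> (\<exists>s U F. 1 \<le> s \<and> s \<le> a \<and> U \<subseteq> V \<and> card U = 3 * s \<and>
     F \<subseteq> {e. e \<subseteq> U \<and> card e = 2} \<and> card F = 4 * s \<and> F \<subseteq> E)"

abbreviation slots :: "'v set \<Rightarrow> ('v \<times> nat) set" where
  "slots V \<equiv> V \<times> {..<8}"

lemma choice_properties:
  assumes "block_system V G r B" "g \<in> PiE (slots V) B"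
  shows "inj_on g (slots V)" "g ` slots V \<subseteq> G" "\<And>v i. v \<in> V \<Longrightarrow> i < 8 \<Longrightarrow> v \<in> g (v, i)"
proof -
  have mem: "g s \<in> B s" if "s \<in> slots V" for s using assms(2) that by (rule PiE_mem)
  show "inj_on g (slots V)"
  proof (rule inj_onI, rule ccontr)
    fix s t assume st: "s \<in> slots V" "t \<in> slots V" "g s = g t" "s \<noteq> t"
    then have "B s \<inter> B t = {}" using assms(1) unfolding block_system_def by blast
    then show False using mem[OF st(1)] mem[OF st(2)] st(3) by auto
  qed
  have B: "B (v, i) \<subseteq> {e\<in>G. v \<in> e}" if "v \<in> V" "i < 8" for v i
    using assms(1) that by (simp add: block_system_def)
  show "v \<in> g (v, i)" if "v \<in> V" "i < 8" for v i
    using B[OF that] mem[of "(v, i)"] that by auto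
  show "g ` slots V \<subseteq> G"
  proof
    fix e assume "e \<in> g ` slots V"
    then obtain v i where "v \<in> V" "i < 8" "e = g (v, i)" by auto
    then show "e \<in> G" using B[of v i] mem[of "(v, i)"] by auto
  qed
qed

text \<open>If \<open>S\<close> had at most \<open>2 * card S\<close> outside neighbours,
  \<open>3 * card S\<close> vertices would contain all Maker edges reserved at \<open>S\<close>. The
  four pairs at each vertex yield \<open>4 * card S\<close> distinct ones, which
  \<open>sparse\<close> forbids.\<close>

lemma pairs_give_expander:
  assumes G: "simple_graph V G" and B: "block_system V G r B" and g: "g \<in> PiE (slots V) B"
    and sparse: "\<not> locally_dense V a (g ` slots V)" and a: "3 * a \<le> card V"
    and M: "\<And>v i. v \<in> V \<Longrightarrow> i < 4 \<Longrightarrow> g (v, 2 * i) \<in> M \<or> g (v, 2 * i + 1) \<in> M"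
  shows "expander V a (M \<inter> g ` slots V)"
  unfolding expander_def
proof (intro allI impI, rule ccontr)
  let ?H = "M \<inter> g ` slots V"
  fix S assume S: "S \<subseteq> V" "S \<noteq> {} \<and> card S \<le> a" and few: "\<not> 2 * card S < card (neighbours ?H S)"
  have V: "finite V" using G by (simp add: simple_graph_def)
  have finS: "finite S" using S(1) V by (rule finite_subset)
  have GV: "e \<subseteq> V" "card e = 2" if "e \<in> ?H" for e
    using that choice_properties(2)[OF B g] G by (auto simp: simple_graph_def)
  have NV: "neighbours ?H S \<subseteq> V" using GV by (force simp: neighbours_def)
  have "card (S \<union> neighbours ?H S) \<le> 3 * card S" using card_Un_le[of S "neighbours ?H S"] few by simp
  moreover have "3 * card S \<le> card V" using S(2) a by simp
  \<comment> \<open>The set is padded to exactly \<open>3 * card S\<close> vertices, which exist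
    because \<open>3 * a \<le> card V\<close>.\<close>
  ultimately obtain U where U: "S \<union> neighbours ?H S \<subseteq> U" "U \<subseteq> V" "card U = 3 * card S"
    using exists_subset_between[of "S \<union> neighbours ?H S" "3 * card S" V] S(1) NV V by auto
  \<comment> \<open>\<open>j v i\<close> is the slot of a Maker edge in the \<open>i\<close>-th pair
    at \<open>v\<close>.\<close>
  define j where "j v i = (if g (v, 2 * i) \<in> M then 2 * i else 2 * i + 1)" for v and i :: nat
  define F where "F = (\<lambda>(v, i). g (v, j v i)) ` (S \<times> {..<4})"
  have j: "j v i < 8" "g (v, j v i) \<in> M" if "v \<in> V" "i < 4" for v i
    using M[OF that] that by (auto simp: j_def)
  have jinj: "i = i'" if "j v i = j v i'" for v i i'
  proof -
    have "j v i div 2 = i" for i by (simp add: j_def)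
    then show ?thesis using that by metis
  qed
  have "inj_on (\<lambda>(v, i). g (v, j v i)) (S \<times> {..<4})"
  proof (rule inj_onI, clarify)
    fix u i v i' assume h: "u \<in> S" "i < (4::nat)" "v \<in> S" "i' < (4::nat)" "g (u, j u i) = g (v, j v i')"
    have "(u, j u i) = (v, j v i')"
    proof (rule inj_onD[OF choice_properties(1)[OF B g] h(5)])
      show "(u, j u i) \<in> slots V" "(v, j v i') \<in> slots V"
        using j(1)[of u i] j(1)[of v i'] h(1-4) S(1) by auto
    qed
    then show "u = v \<and> i = i'" using jinj by (metis prod.inject)
  qed
  then have cF: "card F = 4 * card S" by (simp add: F_def card_image card_cartesian_product)
  have FH: "F \<subseteq> ?H" using j S(1) by (auto simp: F_def)
  have FU: "F \<subseteq> {e. e \<subseteq> U \<and> card e = 2}"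
  proof
    fix e assume e: "e \<in> F"
    then obtain v i where v: "v \<in> S" "i < 4" "e = g (v, j v i)" by (auto simp: F_def)
    have "v \<in> V" using v(1) S(1) by auto
    then have ve: "v \<in> e" unfolding v(3) using choice_properties(3)[OF B g] j(1) v(2) by simp
    have eH: "e \<in> ?H" using e FH by (rule rev_subsetD)
    then have ce: "card e = 2" by (rule GV(2))
    with ve obtain w where w: "e = {v, w}" unfolding card_2_iff by blast
    have "w \<in> S \<union> neighbours ?H S" using v(1) eH unfolding w neighbours_def by blast
    then show "e \<in> {e. e \<subseteq> U \<and> card e = 2}" using ce w v(1) U(1) by auto
  qed
  have "1 \<le> card S" using S(2) finS by (simp add: Suc_le_eq card_gt_0_iff)
  then have "locally_dense V a (g ` slots V)"
    unfolding locally_dense_def using S(2) U cF FU FH by (intro exI[of _ "card S"] exI[of _ U] exI[of _ F]) auto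
  then show False using sparse by simp
qed

text \<open>The pairs give an expander with at most \<open>8 * card V\<close> edges, and up to
  \<open>card V\<close> boosters are added; hence \<open>9 * card V\<close>. Without the reserved
  edges a booster set still has weight at most \<open>2 ^ (8 * card V) / 2 ^ K\<close>, and the last
  assumption bounds the sum of these weights.\<close>

lemma maker_wins_if_boosted:
  assumes G: "simple_graph V G" and B: "block_system V G r B" and g: "g \<in> PiE (slots V) B"
    and sparse: "\<not> locally_dense V a (g ` slots V)" and a: "3 * a \<le> card V" and V: "V \<noteq> {}"
    and boost: "\<And>H. H \<subseteq> G \<Longrightarrow> card H \<le> 9 * card V \<Longrightarrow> expander V a H \<Longrightarrow> \<not> hamiltonian V H \<Longrightarrow>
      K \<le> card (G \<inter> boosters V H)"
    and K: "2 * card {H. H \<subseteq> G \<and> card H \<le> 9 * card V} * 2 ^ (8 * card V) < (2::nat) ^ K"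
  shows "maker_wins_hamiltonicity V G"
  unfolding maker_wins_hamiltonicity_def
proof (rule maker_hits_pairs_and_sets)
  have finV: "finite V" using G by (simp add: simple_graph_def)
  have finG: "finite G" by (rule simple_graph_finite[OF G])
  let ?n = "card V"
  define G1 where "G1 = g ` slots V"
  define P where "P = {{g (v, 2 * i), g (v, 2 * i + 1)} | v i. v \<in> V \<and> i < 4}"
  define Hs where "Hs = {H. H \<subseteq> G \<and> card H \<le> 9 * ?n \<and> expander V a H \<and> \<not> hamiltonian V H}"
  \<comment> \<open>Reserved edges are removed because the sets of the combined strategy must avoid
    the pairs.\<close>
  define F where "F = (\<lambda>H. G \<inter> boosters V H - G1) ` Hs"
  have inj: "inj_on g (slots V)" and sub: "G1 \<subseteq> G"
    using choice_properties[OF B g] by (auto simp: G1_def)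
  have inj': "s = t" if "g s = g t" "s \<in> slots V" "t \<in> slots V" for s t using inj_onD[OF inj] that by blast
  have finG1: "finite G1" "card G1 \<le> 8 * ?n"
    using finV card_image_le[of "slots V" g] by (auto simp: G1_def card_cartesian_product)
  have UP: "\<Union>P \<subseteq> G1" by (auto simp: P_def G1_def)
  show "finite G" by fact
  show "p \<subseteq> G \<and> card p = 2" if "p \<in> P" for p
  proof -
    from that obtain v i where v: "v \<in> V" "i < 4" "p = {g (v, 2 * i), g (v, 2 * i + 1)}"
      unfolding P_def by blast
    have "g (v, 2 * i) \<noteq> g (v, 2 * i + 1)" using inj'[of "(v, 2 * i)" "(v, 2 * i + 1)"] v by auto
    then show ?thesis using UP sub that v by auto
  qed
  show "disjoint P"
    unfolding disjoint_def
  proof (intro ballI impI)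
    fix p q assume "p \<in> P" "q \<in> P" and ne: "p \<noteq> q"
    then obtain u i v i' where p: "u \<in> V" "i < 4" "p = {g (u, 2 * i), g (u, 2 * i + 1)}"
      and q: "v \<in> V" "i' < 4" "q = {g (v, 2 * i'), g (v, 2 * i' + 1)}"
      unfolding P_def by blast
    have neq: "u \<noteq> v \<or> i \<noteq> i'" using ne p q by auto
    have "g (u, k) \<noteq> g (v, l)" if "k \<in> {2 * i, 2 * i + 1}" "l \<in> {2 * i', 2 * i' + 1}" for k l
    proof
      assume "g (u, k) = g (v, l)"
      moreover have "(u, k) \<in> slots V" "(v, l) \<in> slots V" using that p(1,2) q(1,2) by auto
      ultimately have "(u, k) = (v, l)" by (rule inj')
      then show False using that neq by auto
    qed
    then show "p \<inter> q = {}" using p q by auto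
  qed
  show "A \<subseteq> G - \<Union>P" if "A \<in> F" for A using that UP by (auto simp: F_def)
  have finHs: "finite {H. H \<subseteq> G \<and> card H \<le> 9 * ?n}" using finG by (auto intro: finite_subset[of _ "Pow G"])
  have Hs: "Hs \<subseteq> {H. H \<subseteq> G \<and> card H \<le> 9 * ?n}" by (auto simp: Hs_def)
  have finHs': "finite Hs" using Hs finHs by (rule finite_subset)
  let ?L = "card {H. H \<subseteq> G \<and> card H \<le> 9 * ?n}"
  show "2 * (\<Sum>A\<in>F. (1/2::real) ^ card A) < 1"
  proof -
    have weight: "(1/2::real) ^ card A \<le> 2 ^ (8 * ?n) / 2 ^ K" if A: "A \<in> F" for A
    proof -
      obtain H where H: "H \<in> Hs" "A = G \<inter> boosters V H - G1" using A by (auto simp: F_def)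
      have "K \<le> card (G \<inter> boosters V H)" using H(1) by (intro boost) (auto simp: Hs_def)
      also have "\<dots> \<le> card A + card G1"
        using diff_card_le_card_Diff[OF finG1(1), of "G \<inter> boosters V H"] H(2) by simp
      finally have "K \<le> card A + 8 * ?n" using finG1(2) by simp
      then have "(2::real) ^ K \<le> 2 ^ card A * 2 ^ (8 * ?n)" by (simp flip: power_add)
      then show ?thesis by (simp add: power_one_over field_simps)
    qed
    have "(\<Sum>A\<in>F. (1/2::real) ^ card A) \<le> (\<Sum>A\<in>F. 2 ^ (8 * ?n) / 2 ^ K)" by (rule sum_mono) (rule weight)
    also have "\<dots> = card F * (2 ^ (8 * ?n) / 2 ^ K)" by simp
    also have "\<dots> \<le> ?L * (2 ^ (8 * ?n) / 2 ^ K)"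
    proof (rule mult_right_mono)
      have "card F \<le> card Hs" unfolding F_def by (rule card_image_le[OF finHs'])
      also have "\<dots> \<le> ?L" by (rule card_mono[OF finHs Hs])
      finally show "real (card F) \<le> real ?L" by simp
    qed simp
    finally have "2 * (\<Sum>A\<in>F. (1/2::real) ^ card A) \<le> (2 * ?L * 2 ^ (8 * ?n)) / 2 ^ K" by simp
    also have "\<dots> < 1"
    proof -
      have "real (2 * ?L * 2 ^ (8 * ?n)) < real (2 ^ K)" using K by (simp only: of_nat_less_iff)
      then show ?thesis by simp
    qed
    finally show ?thesis .
  qed
  fix M assume M: "M \<subseteq> G" "\<And>p. p \<in> P \<Longrightarrow> p \<inter> M \<noteq> {}" "\<And>A. A \<in> F \<Longrightarrow> A \<inter> M \<noteq> {}"
  have MV: "e \<subseteq> V" if "e \<in> M" for e using that M(1) G by (auto simp: simple_graph_def)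
  show "hamiltonian V M"
  proof (rule hamiltonian_by_boosters[OF finV V _ MV])
    show "finite M" using M(1) finG by (rule finite_subset)
    show "M \<inter> G1 \<subseteq> M" by simp
    show "expander V a (M \<inter> G1)"
      unfolding G1_def
    proof (rule pairs_give_expander[OF G B g sparse a])
      fix v i assume "v \<in> V" "i < (4::nat)"
      then have "{g (v, 2 * i), g (v, 2 * i + 1)} \<in> P" unfolding P_def by blast
      then show "g (v, 2 * i) \<in> M \<or> g (v, 2 * i + 1) \<in> M" using M(2) by blast
    qed
    have "card (M \<inter> G1) \<le> card G1" using finG1(1) by (intro card_mono) auto
    then show "card (M \<inter> G1) + ?n \<le> 9 * ?n" using finG1(2) by simp
    fix H assume "H \<subseteq> M" "card H \<le> 9 * ?n" "expander V a H" "\<not> hamiltonian V H"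
    then have "G \<inter> boosters V H - G1 \<in> F" using M(1) by (auto simp: F_def Hs_def)
    from M(3)[OF this] show "boosters V H \<inter> M \<noteq> {}" by blast
  qed
qed

section \<open>Counting exceptional graphs\<close>

text \<open>A weak Stirling bound; the induction step rests on
  \<open>(1 + 1 / k) ^ k \<le> exp 1 \<le> 3\<close>.\<close>

lemma power_self_le_fact: "(k::nat) ^ k \<le> 3 ^ k * fact k"
proof (induction k)
  case 0
  then show ?case by simp
next
  case (Suc k)
  have step: "(Suc k) ^ k \<le> 3 * k ^ k"
  proof (cases "k = 0")
    case False
    have "(1 + 1 / real k) ^ k \<le> exp 1"
      by (rule exp_ge_one_plus_x_over_n_power_n) (use False in auto)
    also have "\<dots> \<le> 3" by (rule exp_le)
    finally have "(1 + 1 / real k) ^ k * real k ^ k \<le> 3 * real k ^ k" by (rule mult_right_mono) simp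
    moreover have "(1 + 1 / real k) ^ k * real k ^ k = real (Suc k) ^ k"
      using False by (simp add: field_simps flip: power_mult_distrib)
    ultimately have "real ((Suc k) ^ k) \<le> real (3 * k ^ k)" by simp
    then show ?thesis by (simp only: of_nat_le_iff)
  qed simp
  have "(Suc k) ^ Suc k = Suc k * (Suc k) ^ k" by simp
  also have "\<dots> \<le> Suc k * (3 * (3 ^ k * fact k))"
    using step Suc by (intro mult_left_mono) (auto intro: order_trans)
  also have "\<dots> = 3 ^ Suc k * fact (Suc k)" by (simp add: algebra_simps)
  finally show ?case .
qed

lemma binomial_le_power:
  assumes "k > 0"
  shows "real (m choose k) \<le> (3 * real m / real k) ^ k"
proof -
  have "real (m choose k) * real k ^ k \<le> real (m choose k) * (3 ^ k * fact k)"
  proof (rule mult_left_mono)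
    have "real (k ^ k) \<le> real (3 ^ k * fact k)" using power_self_le_fact[of k] by (simp only: of_nat_le_iff)
    then show "real k ^ k \<le> 3 ^ k * fact k" by simp
  qed simp
  also have "\<dots> = 3 ^ k * real ((m choose k) * fact k)" by simp
  also have "\<dots> \<le> 3 ^ k * real (m ^ k)"
    by (intro mult_left_mono of_nat_mono binomial_fact_pow) simp
  finally have "real (m choose k) * real k ^ k \<le> (3 * real m) ^ k" by (simp add: power_mult_distrib)
  then show ?thesis using assms by (simp add: power_divide field_simps)
qed

section \<open>Local sparseness of random reserved edges\<close>

definition dense_sets :: "'v set \<Rightarrow> nat \<Rightarrow> 'v set set set" where
  "dense_sets V s = (\<Union>U\<in>{U. U \<subseteq> V \<and> card U = 3 * s}. {F. F \<subseteq> {e. e \<subseteq> U \<and> card e = 2} \<and> card F = 4 * s})"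

lemma dense_sets_iff:
  "F \<in> dense_sets V s \<longleftrightarrow>
    (\<exists>U. U \<subseteq> V \<and> card U = 3 * s \<and> F \<subseteq> {e. e \<subseteq> U \<and> card e = 2} \<and> card F = 4 * s)"
  unfolding dense_sets_def by blast

lemma locally_dense_iff:
  "locally_dense V a E \<longleftrightarrow> (\<exists>s\<in>{1..a}. \<exists>F\<in>dense_sets V s. F \<subseteq> E)"
proof
  assume "locally_dense V a E"
  then obtain s U F where h: "1 \<le> s" "s \<le> a" "U \<subseteq> V" "card U = 3 * s"
    "F \<subseteq> {e. e \<subseteq> U \<and> card e = 2}" "card F = 4 * s" "F \<subseteq> E"
    unfolding locally_dense_def by (elim exE conjE)
  then have "F \<in> dense_sets V s" unfolding dense_sets_iff by blast
  then show "\<exists>s\<in>{1..a}. \<exists>F\<in>dense_sets V s. F \<subseteq> E"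
    using h(1,2,7) by (intro bexI[of _ s] bexI[of _ F]) auto
next
  assume "\<exists>s\<in>{1..a}. \<exists>F\<in>dense_sets V s. F \<subseteq> E"
  then obtain s F where s: "1 \<le> s" "s \<le> a" "F \<in> dense_sets V s" "F \<subseteq> E" by auto
  from s(3) obtain U where "U \<subseteq> V \<and> card U = 3 * s \<and> F \<subseteq> {e. e \<subseteq> U \<and> card e = 2} \<and> card F = 4 * s"
    unfolding dense_sets_iff ..
  with s show "locally_dense V a E" unfolding locally_dense_def
    by (intro exI[of _ s] exI[of _ U] exI[of _ F]) simp
qed

lemma dense_setsD:
  assumes "F \<in> dense_sets V s"
  shows "F \<subseteq> {e. e \<subseteq> V \<and> card e = 2}" "card F = 4 * s"
  using assms by (auto simp: dense_sets_def)

text \<open>First the \<open>3 * s\<close> vertices are chosen, then the edges among fewer than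
  \<open>9 * s\<^sup>2 / 2\<close> pairs. Both counts use \<open>binomial_le_power\<close>; in the
  second the base is at most \<open>27 * s / 8\<close>, below \<open>4 * s\<close>.\<close>

lemma card_dense_sets:
  assumes V: "finite V" and s: "s > 0"
  shows "finite (dense_sets V s)"
    "real (card (dense_sets V s)) \<le> ((real (card V) / s) ^ 3 * (4 * s) ^ 4) ^ s"
proof -
  let ?Us = "{U. U \<subseteq> V \<and> card U = 3 * s}"
  let ?Fs = "\<lambda>U::'a set. {F. F \<subseteq> {e. e \<subseteq> U \<and> card e = 2} \<and> card F = 4 * s}"
  have Us: "finite ?Us" "card ?Us = card V choose (3 * s)"
    using V by (auto simp: n_subsets intro: finite_subset[of _ "Pow V"])
  have Fs: "finite (?Fs U) \<and> card (?Fs U) = ((3 * s) choose 2) choose (4 * s)" if U: "U \<in> ?Us" for U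
  proof -
    have fU: "finite U" using U V by (auto intro: finite_subset)
    have "finite {e. e \<subseteq> U \<and> card e = 2}" by (rule finite_subset[of _ "Pow U"]) (use fU in auto)
    moreover have "card {e. e \<subseteq> U \<and> card e = 2} = (3 * s) choose 2" using fU U by (simp add: n_subsets)
    ultimately show ?thesis using n_subsets[of "{e. e \<subseteq> U \<and> card e = 2}" "4 * s"]
      by (auto intro: finite_subset[of _ "Pow {e. e \<subseteq> U \<and> card e = 2}"])
  qed
  show "finite (dense_sets V s)" unfolding dense_sets_def using Us Fs by auto
  have "card (dense_sets V s) \<le> (\<Sum>U\<in>?Us. card (?Fs U))"
    unfolding dense_sets_def by (rule card_UN_le[OF Us(1)])
  also have "\<dots> = (card V choose (3 * s)) * (((3 * s) choose 2) choose (4 * s))"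
    using Fs Us(2) by simp
  finally have "real (card (dense_sets V s)) \<le> real (card V choose (3 * s)) * real (((3 * s) choose 2) choose (4 * s))"
    by (metis of_nat_le_iff of_nat_mult)
  also have "\<dots> \<le> (real (card V) / s) ^ (3 * s) * (4 * real s) ^ (4 * s)"
  proof (rule mult_mono)
    show "real (card V choose (3 * s)) \<le> (real (card V) / s) ^ (3 * s)"
      using binomial_le_power[of "3 * s" "card V"] s by simp
    have "((3 * s) choose 2) * 2 \<le> 3 * s * (3 * s - 1)" unfolding choose_two by simp
    also have "\<dots> \<le> 3 * s * (3 * s)" by (intro mult_left_mono) auto
    finally have "real (((3 * s) choose 2) * 2) \<le> real (3 * s * (3 * s))" by (simp only: of_nat_le_iff)
    then have "3 * real ((3 * s) choose 2) / real (4 * s) \<le> 4 * real s"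
      using s by (simp add: field_simps)
    then have "(3 * real ((3 * s) choose 2) / real (4 * s)) ^ (4 * s) \<le> (4 * real s) ^ (4 * s)"
      by (rule power_mono) simp
    then show "real (((3 * s) choose 2) choose (4 * s)) \<le> (4 * real s) ^ (4 * s)"
      using binomial_le_power[of "4 * s" "(3 * s) choose 2"] s by linarith
  qed auto
  also have "\<dots> = ((real (card V) / s) ^ 3 * (4 * s) ^ 4) ^ s"
    by (simp add: power_mult power_mult_distrib)
  finally show "real (card (dense_sets V s)) \<le> ((real (card V) / s) ^ 3 * (4 * s) ^ 4) ^ s" .
qed

lemma sum_nat_halves: "(\<Sum>s\<in>{1..a}. real s * (1/2) ^ s) = 2 - (a + 2) * (1/2) ^ a"
  by (induction a) (auto simp: field_simps)

text \<open>First moment over pairs of a graph \<open>G\<close> and a choice \<open>g\<close>. With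
  \<open>n = card V\<close>, a set \<open>F\<close> lies in \<open>G\<close> with probability at
  most \<open>(2 * d / n) ^ card F\<close>, and then among the chosen edges with probability at most
  \<open>(1 / r) ^ card F\<close>. As \<open>d \<le> 64 * r\<close>, the product is at most
  \<open>(128 / n) ^ card F\<close>. A bad graph contributes all its choices, so the bound passes to
  the share of bad graphs.\<close>

lemma few_locally_dense:
  fixes V :: "'v set"
  assumes V: "finite V" "V \<noteq> {}" and a: "a * 2 ^ 37 \<le> card V"
    and small: "card V + 4 * d\<^sup>2 + 4 * d \<le> card V * d" and d: "d > 0" "d \<le> 64 * r"
    and Bl: "\<And>G. G \<in> regulars d V {} \<Longrightarrow> block_system V G r (Bl G)"
  shows "real (card {G \<in> regulars d V {}. \<forall>g\<in>PiE (slots V) (Bl G). locally_dense V a (g ` slots V)}) \<le>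
    2 ^ 38 / card V * card (regulars d V {})"
proof -
  let ?n = "card V" and ?I = "slots V" and ?\<Omega> = "regulars d V {}"
  let ?Bad = "{G \<in> ?\<Omega>. \<forall>g\<in>PiE ?I (Bl G). locally_dense V a (g ` ?I)}"
  define c where "c G F = card {g \<in> PiE ?I (Bl G). F \<subseteq> g ` ?I}" for G F
  have r: "r > 0" using d by (cases r) auto
  have n: "?n > 0" using V by (simp add: card_gt_0_iff)
  have finI: "finite ?I" using V by simp
  have cI: "card ?I = 8 * ?n" by (simp add: card_cartesian_product)
  have fin\<Omega>: "finite ?\<Omega>" by (rule finite_regulars[OF V(1)])
  have Blc: "card (Bl G s) = r" "finite (Bl G s)" if "G \<in> ?\<Omega>" "s \<in> ?I" for G s
  proof -
    show "card (Bl G s) = r" using Bl[OF that(1)] that(2) by (auto simp: block_system_def)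
    then show "finite (Bl G s)" using r by (simp add: card_ge_0_finite)
  qed
  have choices: "card (PiE ?I (Bl G)) = r ^ (8 * ?n)" "finite (PiE ?I (Bl G))" if "G \<in> ?\<Omega>" for G
    using Blc[OF that] finI cI by (auto simp: card_PiE intro!: finite_PiE)
  have c_bound: "real (c G F) \<le> real r ^ (8 * ?n) / real r ^ card F" if G: "G \<in> ?\<Omega>" and F: "finite F" for G F
  proof -
    have "c G F * r ^ card F \<le> r ^ card ?I"
      unfolding c_def
    proof (rule card_choices_containing[OF finI _ _ r F])
      show "\<And>i. i \<in> ?I \<Longrightarrow> card (Bl G i) = r" using Blc(1)[OF G] .
      show "\<And>i j. i \<in> ?I \<Longrightarrow> j \<in> ?I \<Longrightarrow> i \<noteq> j \<Longrightarrow> Bl G i \<inter> Bl G j = {}"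
        using Bl[OF G] unfolding block_system_def by blast
    qed
    then have "real (c G F * r ^ card F) \<le> real (r ^ card ?I)" by (simp only: of_nat_le_iff)
    then show ?thesis using r by (simp add: cI field_simps)
  qed
  have c_zero: "c G F = 0" if G: "G \<in> ?\<Omega>" and F: "\<not> F \<subseteq> G" for G F
  proof -
    have "{g \<in> PiE ?I (Bl G). F \<subseteq> g ` ?I} = {}" using choice_properties(2)[OF Bl[OF G]] F by blast
    then show ?thesis unfolding c_def by (simp only: card.empty)
  qed
  have Fbound: "(\<Sum>G\<in>?\<Omega>. real (c G F)) \<le> card ?\<Omega> * real r ^ (8 * ?n) * (128 / ?n) ^ (4 * s)"
    if s: "s \<in> {1..a}" and F: "F \<in> dense_sets V s" for s F
  proof -
    note FD = dense_setsD[OF F]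
    have finF: "finite F" using FD(2) s by (intro card_ge_0_finite) auto
    have "4 * card F + 4 * d\<^sup>2 + 4 * d \<le> ?n * d" using small a s FD(2) by simp
    from regulars_containing[OF V(1) finF FD(1) this d(1)]
    have "real (card (regulars d V F) * ?n ^ card F) \<le> real (card ?\<Omega> * (2 * d) ^ card F)"
      by (simp only: of_nat_le_iff)
    then have R: "real (card (regulars d V F)) \<le> card ?\<Omega> * (2 * real d / ?n) ^ card F"
      using n by (simp add: power_divide field_simps)
    have "(\<Sum>G\<in>?\<Omega>. real (c G F)) = (\<Sum>G\<in>regulars d V F. real (c G F))"
      by (rule sum.mono_neutral_right[OF fin\<Omega>]) (use c_zero in \<open>auto simp: regulars_def\<close>)
    also have "\<dots> \<le> (\<Sum>G\<in>regulars d V F. real r ^ (8 * ?n) / real r ^ card F)"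
      by (rule sum_mono, rule c_bound[OF _ finF]) (simp add: regulars_def)
    also have "\<dots> = real (card (regulars d V F)) * (real r ^ (8 * ?n) / real r ^ card F)" by simp
    also have "\<dots> \<le> (card ?\<Omega> * (2 * real d / ?n) ^ card F) * (real r ^ (8 * ?n) / real r ^ card F)"
      by (rule mult_right_mono[OF R]) simp
    also have "\<dots> = card ?\<Omega> * real r ^ (8 * ?n) * (2 * real d / ?n / r) ^ card F"
      by (simp add: power_divide power_mult_distrib)
    also have "\<dots> \<le> card ?\<Omega> * real r ^ (8 * ?n) * (128 / ?n) ^ card F"
    proof (intro mult_left_mono power_mono)
      have "real d \<le> 64 * real r" using d(2) by linarith
      then show "2 * real d / ?n / r \<le> 128 / ?n" using r n by (simp add: field_simps)
    qed auto
    finally show ?thesis using FD(2) by simp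
  qed
  have term_bound: "real (card (dense_sets V s)) * (128 / ?n) ^ (4 * s) \<le> 2 ^ 37 / ?n * (real s * (1/2) ^ s)"
    if s: "s \<in> {1..a}" for s
  proof -
    \<comment> \<open>\<open>(n / s) ^ 3 * (4 * s) ^ 4 * (128 / n) ^ 4\<close>, with
      \<open>n = card V\<close>, simplifies to this base; \<open>s \<le> a\<close> makes it at most
      1/2.\<close>
    define x where "x = 2 ^ 36 * real s / ?n"
    have s0: "s > 0" using s by simp
    have "real (s * 2 ^ 37) \<le> real ?n"
      using s a by (intro of_nat_mono order_trans[OF _ a] mult_right_mono) auto
    then have x: "0 \<le> x" "x \<le> 1/2" using n by (auto simp: x_def field_simps)
    have "real (card (dense_sets V s)) * (128 / ?n) ^ (4 * s) \<le>
        ((real ?n / s) ^ 3 * (4 * s) ^ 4) ^ s * (128 / ?n) ^ (4 * s)"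
      by (rule mult_right_mono[OF card_dense_sets(2)[OF V(1) s0]]) simp
    also have "\<dots> = ((real ?n / s) ^ 3 * (4 * s) ^ 4 * (128 / ?n) ^ 4) ^ s"
      by (simp add: power_mult power_mult_distrib)
    also have "(real ?n / s) ^ 3 * (4 * s) ^ 4 * (128 / ?n) ^ 4 = x"
      using n s0 by (simp add: x_def field_simps power3_eq_cube power4_eq_xxxx)
    \<comment> \<open>One factor \<open>x\<close> is kept for its decay in \<open>card V\<close>;
      the others are bounded by 1/2, which makes the sum over \<open>s\<close> bounded.\<close>
    also have "x ^ s \<le> x * (1/2) ^ (s - 1)"
    proof -
      have "x ^ s = x * x ^ (s - 1)" using s0 by (cases s) auto
      moreover have "x ^ (s - 1) \<le> (1/2) ^ (s - 1)" by (rule power_mono) (use x in auto)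
      ultimately show ?thesis using x(1) by (simp only: mult_left_mono)
    qed
    also have "\<dots> = 2 ^ 37 / ?n * (real s * (1/2) ^ s)"
    proof -
      have "(1/2 :: real) ^ s = 1/2 * (1/2) ^ (s - 1)" using s0 by (cases s) auto
      then show ?thesis by (simp add: x_def)
    qed
    finally show ?thesis .
  qed
  have "real (card ?Bad) * real r ^ (8 * ?n) = (\<Sum>G\<in>?Bad. real (card (PiE ?I (Bl G))))"
    using choices(1) by simp
  also have "\<dots> \<le> (\<Sum>G\<in>?Bad. \<Sum>s\<in>{1..a}. \<Sum>F\<in>dense_sets V s. real (c G F))"
  proof (rule sum_mono)
    fix G assume G: "G \<in> ?Bad"
    have "PiE ?I (Bl G) \<subseteq> (\<Union>s\<in>{1..a}. \<Union>F\<in>dense_sets V s. {g \<in> PiE ?I (Bl G). F \<subseteq> g ` ?I})"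
    proof
      fix g assume g: "g \<in> PiE ?I (Bl G)"
      then have "locally_dense V a (g ` ?I)" using G by blast
      then show "g \<in> (\<Union>s\<in>{1..a}. \<Union>F\<in>dense_sets V s. {g \<in> PiE ?I (Bl G). F \<subseteq> g ` ?I})"
        unfolding locally_dense_iff using g by blast
    qed
    moreover have "finite (\<Union>s\<in>{1..a}. \<Union>F\<in>dense_sets V s. {g \<in> PiE ?I (Bl G). F \<subseteq> g ` ?I})"
      by (rule finite_subset[of _ "PiE ?I (Bl G)"]) (use choices(2) G in auto)
    ultimately have "card (PiE ?I (Bl G)) \<le>
        card (\<Union>s\<in>{1..a}. \<Union>F\<in>dense_sets V s. {g \<in> PiE ?I (Bl G). F \<subseteq> g ` ?I})" by (intro card_mono)
    also have "\<dots> \<le> (\<Sum>s\<in>{1..a}. card (\<Union>F\<in>dense_sets V s. {g \<in> PiE ?I (Bl G). F \<subseteq> g ` ?I}))"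
      by (rule card_UN_le) simp
    also have "\<dots> \<le> (\<Sum>s\<in>{1..a}. \<Sum>F\<in>dense_sets V s. c G F)"
      unfolding c_def by (intro sum_mono card_UN_le card_dense_sets(1)[OF V(1)]) simp
    finally have "real (card (PiE ?I (Bl G))) \<le> real (\<Sum>s\<in>{1..a}. \<Sum>F\<in>dense_sets V s. c G F)"
      by (simp only: of_nat_le_iff)
    then show "real (card (PiE ?I (Bl G))) \<le> (\<Sum>s\<in>{1..a}. \<Sum>F\<in>dense_sets V s. real (c G F))" by simp
  qed
  also have "\<dots> \<le> (\<Sum>G\<in>?\<Omega>. \<Sum>s\<in>{1..a}. \<Sum>F\<in>dense_sets V s. real (c G F))"
    by (rule sum_mono2[OF fin\<Omega>]) (auto intro!: sum_nonneg)
  also have "\<dots> = (\<Sum>s\<in>{1..a}. \<Sum>G\<in>?\<Omega>. \<Sum>F\<in>dense_sets V s. real (c G F))" by (rule sum.swap)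
  also have "\<dots> = (\<Sum>s\<in>{1..a}. \<Sum>F\<in>dense_sets V s. \<Sum>G\<in>?\<Omega>. real (c G F))"
    by (rule sum.cong[OF refl]) (rule sum.swap)
  also have "\<dots> \<le> (\<Sum>s\<in>{1..a}. \<Sum>F\<in>dense_sets V s. card ?\<Omega> * real r ^ (8 * ?n) * (128 / ?n) ^ (4 * s))"
    by (intro sum_mono Fbound)
  also have "\<dots> = card ?\<Omega> * real r ^ (8 * ?n) * (\<Sum>s\<in>{1..a}. real (card (dense_sets V s)) * (128 / ?n) ^ (4 * s))"
    by (simp add: sum_distrib_left mult_ac)
  also have "\<dots> \<le> card ?\<Omega> * real r ^ (8 * ?n) * (\<Sum>s\<in>{1..a}. 2 ^ 37 / ?n * (real s * (1/2) ^ s))"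
    by (intro mult_left_mono sum_mono term_bound) auto
  also have "\<dots> \<le> card ?\<Omega> * real r ^ (8 * ?n) * (2 ^ 37 / ?n * 2)"
  proof (rule mult_left_mono)
    have "(\<Sum>s\<in>{1..a}. 2 ^ 37 / ?n * (real s * (1/2) ^ s)) = 2 ^ 37 / ?n * (\<Sum>s\<in>{1..a}. real s * (1/2) ^ s)"
      by (rule sum_distrib_left[symmetric])
    also have "\<dots> \<le> 2 ^ 37 / ?n * 2" unfolding sum_nat_halves by (rule mult_left_mono) auto
    finally show "(\<Sum>s\<in>{1..a}. 2 ^ 37 / ?n * (real s * (1/2) ^ s)) \<le> 2 ^ 37 / ?n * 2" .
  qed simp
  finally have "real (card ?Bad) * real r ^ (8 * ?n) \<le> (2 ^ 38 / ?n * card ?\<Omega>) * real r ^ (8 * ?n)"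
    by (simp add: mult_ac)
  then show ?thesis using r by (simp only: mult_le_cancel_right) simp
qed

section \<open>Graphs with too few boosters\<close>

text \<open>Union bound over sparse expanders \<open>H\<close>, conditioned on
  \<open>H \<subseteq> G\<close>. Summing \<open>card (regulars d V H)\<close> over \<open>H\<close>
  counts pairs \<open>H \<subseteq> G\<close>; thus the number of all sparse graphs on
  \<open>V\<close> is replaced by the number \<open>L\<close> of sparse subgraphs of one regular
  graph.\<close>

lemma few_unboosted:
  fixes V :: "'v set"
  assumes V: "finite V" "card V \<ge> 3" and a: "a \<ge> 1" and d: "d > 0"
    and big: "card V * (40 * K + 36 * card V + 32 + 3 * d\<^sup>2) \<le> (a + 1)\<^sup>2 * d"
    and L: "\<And>G. G \<in> regulars d V {} \<Longrightarrow> card {H. H \<subseteq> G \<and> card H \<le> 9 * card V} \<le> L"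
  shows "card {G \<in> regulars d V {}. \<exists>H\<subseteq>G. card H \<le> 9 * card V \<and> expander V a H \<and> \<not> hamiltonian V H \<and>
      card (G \<inter> boosters V H) \<le> K} * 2 ^ K \<le> 2 * L * card (regulars d V {})"
proof -
  let ?n = "card V" and ?\<Omega> = "regulars d V {}"
  let ?Bad = "{G \<in> ?\<Omega>. \<exists>H\<subseteq>G. card H \<le> 9 * ?n \<and> expander V a H \<and> \<not> hamiltonian V H \<and>
      card (G \<inter> boosters V H) \<le> K}"
  define Hs where "Hs = {H. H \<subseteq> {e. e \<subseteq> V \<and> card e = 2} \<and> card H \<le> 9 * ?n \<and> expander V a H \<and> \<not> hamiltonian V H}"
  have fin\<Omega>: "finite ?\<Omega>" by (rule finite_regulars[OF V(1)])
  have finHs: "finite Hs" by (rule finite_subset[of _ "Pow (Pow V)"]) (use V in \<open>auto simp: Hs_def\<close>)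
  have fin_edges: "finite H" if "H \<in> Hs" for H
    by (rule finite_subset[of _ "Pow V"]) (use that V in \<open>auto simp: Hs_def\<close>)
  have one: "card {G \<in> regulars d V H. card (G \<inter> boosters V H) \<le> K} * 2 ^ K \<le> 2 * card (regulars d V H)"
    if H: "H \<in> Hs" for H
  proof (rule regulars_few_hits[OF V(1) _ fin_edges[OF H], where h = "9 * ?n"])
    show "V \<noteq> {}" using V by auto
    show "card H \<le> 9 * ?n" using H by (simp add: Hs_def)
    show "boosters V H \<subseteq> {e. e \<subseteq> V \<and> card e = 2}" by (auto simp: boosters_def)
    have "(a + 1)\<^sup>2 \<le> 2 * card (boosters V H)"
      by (rule boosters_many[OF V _ _ a]) (use H in \<open>auto simp: Hs_def\<close>)
    then have "(a + 1)\<^sup>2 * d \<le> 2 * card (boosters V H) * d" by (rule mult_right_mono) simp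
    then show "?n * (40 * K + 4 * (9 * ?n) + 32 + 3 * d\<^sup>2) \<le> 2 * card (boosters V H) * d"
      by (rule order_trans[rotated]) (use big in simp)
  qed fact
  have fin: "finite {G \<in> regulars d V H. card (G \<inter> boosters V H) \<le> K}" for H
    using finite_regulars[OF V(1)] by simp
  have "?Bad \<subseteq> (\<Union>H\<in>Hs. {G \<in> regulars d V H. card (G \<inter> boosters V H) \<le> K})"
  proof
    fix G assume "G \<in> ?Bad"
    then obtain H where H: "G \<in> ?\<Omega>" "H \<subseteq> G" "card H \<le> 9 * ?n" "expander V a H" "\<not> hamiltonian V H"
      "card (G \<inter> boosters V H) \<le> K" by auto
    then have "H \<in> Hs" by (auto simp: Hs_def regulars_def regular_graph_def simple_graph_def)
    moreover have "G \<in> regulars d V H" using H by (simp add: regulars_def)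
    ultimately show "G \<in> (\<Union>H\<in>Hs. {G \<in> regulars d V H. card (G \<inter> boosters V H) \<le> K})" using H(6) by auto
  qed
  then have "card ?Bad \<le> card (\<Union>H\<in>Hs. {G \<in> regulars d V H. card (G \<inter> boosters V H) \<le> K})"
    by (rule card_mono[rotated]) (use finHs fin in auto)
  also have "\<dots> \<le> (\<Sum>H\<in>Hs. card {G \<in> regulars d V H. card (G \<inter> boosters V H) \<le> K})"
    by (rule card_UN_le[OF finHs])
  finally have "card ?Bad * 2 ^ K \<le> (\<Sum>H\<in>Hs. card {G \<in> regulars d V H. card (G \<inter> boosters V H) \<le> K} * 2 ^ K)"
    unfolding sum_distrib_right[symmetric] by (rule mult_right_mono) simp
  also have "\<dots> \<le> (\<Sum>H\<in>Hs. 2 * card (regulars d V H))" by (rule sum_mono) (rule one)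
  also have "\<dots> = 2 * (\<Sum>H\<in>Hs. card (regulars d V H))" by (rule sum_distrib_left[symmetric])
  also have "(\<Sum>H\<in>Hs. card (regulars d V H)) = (\<Sum>H\<in>Hs. \<Sum>G\<in>?\<Omega>. if H \<subseteq> G then 1 else 0)"
  proof (rule sum.cong[OF refl])
    fix H
    have "regulars d V H = ?\<Omega> \<inter> {G. H \<subseteq> G}" by (auto simp: regulars_def)
    then show "card (regulars d V H) = (\<Sum>G\<in>?\<Omega>. if H \<subseteq> G then 1 else 0)"
      using fin\<Omega> by (simp add: sum.If_cases)
  qed
  also have "\<dots> = (\<Sum>G\<in>?\<Omega>. \<Sum>H\<in>Hs. if H \<subseteq> G then 1 else 0)" by (rule sum.swap)
  also have "\<dots> \<le> (\<Sum>G\<in>?\<Omega>. L)"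
  proof (rule sum_mono)
    fix G assume G: "G \<in> ?\<Omega>"
    have fG: "finite G" using G regular_graph_edges(2) by (auto simp: regulars_def)
    have "(\<Sum>H\<in>Hs. if H \<subseteq> G then 1 else 0) = card (Hs \<inter> {H. H \<subseteq> G})"
      using finHs by (simp add: sum.If_cases)
    also have "\<dots> \<le> card {H. H \<subseteq> G \<and> card H \<le> 9 * ?n}"
      by (rule card_mono) (use fG in \<open>auto simp: Hs_def\<close>)
    also have "\<dots> \<le> L" by (rule L[OF G])
    finally show "(\<Sum>H\<in>Hs. if H \<subseteq> G then 1 else 0) \<le> L" .
  qed
  finally show ?thesis by (simp add: mult_ac)
qed

section \<open>Entropy bound and choice of constants\<close>

text \<open>A small \<open>H\<close> has weight \<open>x ^ card H \<ge> x ^ k\<close>, and the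
  weights of all subsets of \<open>G\<close> sum to \<open>(1 + x) ^ card G\<close>.\<close>

lemma card_small_subsets:
  fixes x :: real
  assumes G: "finite G" and x: "0 < x" "x \<le> 1"
  shows "card {H. H \<subseteq> G \<and> card H \<le> k} * x ^ k \<le> (1 + x) ^ card G"
proof -
  let ?S = "{H. H \<subseteq> G \<and> card H \<le> k}"
  have "card ?S * x ^ k = (\<Sum>H\<in>?S. x ^ k)" by simp
  also have "\<dots> \<le> (\<Sum>H\<in>?S. x ^ card H)"
    by (rule sum_mono) (use x in \<open>auto intro: power_decreasing\<close>)
  also have "\<dots> \<le> (\<Sum>H\<in>Pow G. x ^ card H)"
    by (rule sum_mono2) (use G x in auto)
  also have "\<dots> = (\<Prod>e\<in>G. x + 1)" using prod_add[OF G, of "\<lambda>_. x" "\<lambda>_. 1"] by simp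
  finally show ?thesis by (simp add: add.commute)
qed

text \<open>With \<open>x = 1 / 2 ^ 84\<close>, the factor \<open>2 ^ (756 * n)\<close> is
  \<open>x\<close> to the power \<open>- 9 * n\<close>. The exponent on the right is about
  \<open>8 * x * n * d\<close>, and \<open>x * d \<ge> 256\<close> makes it dominate both
  \<open>764 * n + 1\<close> and the contribution of \<open>(1 + x) ^ m\<close>.\<close>

lemma entropy_numerics:
  assumes d: "d \<ge> 2 ^ 92" and n: "n \<ge> 1" and m: "2 * m = n * d"
  shows "(1 + 1 / 2 ^ 84) ^ m * 2 ^ (756 * n) * 2 * 2 ^ (8 * n) < (2::real) ^ (n * d div 2 ^ 81)"
proof -
  define x :: real where "x = 1 / 2 ^ 84"
  define K where "K = n * d div 2 ^ 81"
  have x: "x > 0" by (simp add: x_def)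
  have ln2: "ln (2::real) \<ge> 1/2" using ln2_ge_two_thirds by linarith
  have pow2: "(2::real) ^ k = exp (ln 2 * k)" for k
    by (simp add: exp_of_nat2_mult)
  have mr: "real m = real n * real d / 2" using arg_cong[OF m, of real] by simp
  have "n * d < 2 ^ 81 * (K + 1)"
    unfolding K_def using mult_div_mod_eq[of "2 ^ 81" "n * d"] mod_less_divisor[of "2 ^ 81" "n * d"] by simp
  then have "real (n * d) < real (2 ^ 81 * (K + 1))" by (simp only: of_nat_less_iff)
  then have Kb: "real n * real d < 2 ^ 81 * (real K + 1)" by simp
  have "real n * 2 ^ 92 \<le> real n * real d"
  proof (rule mult_left_mono)
    have "real (2 ^ 92) \<le> real d" using d by (simp only: of_nat_le_iff)
    then show "2 ^ 92 \<le> real d" by simp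
  qed simp
  then have "256 * real n \<le> x * (real n * real d)" by (simp add: x_def)
  moreover have "8 * (x * (real n * real d)) < real K + 1" using Kb by (simp add: x_def mult_ac)
  moreover have "real n \<ge> 1" using n by simp
  ultimately have "764 * real n + 1 + x * (real n * real d) < K" by linarith
  then have "(764 * real n + 1 + x * (real n * real d)) * ln 2 < K * ln 2"
    by (rule mult_strict_right_mono) simp
  moreover have "x * (real n * real d) * (1/2) \<le> x * (real n * real d) * ln 2"
    by (rule mult_left_mono[OF ln2]) (use x in simp)
  ultimately have *: "x * m + ln 2 * (764 * real n + 1) < ln 2 * K"
    by (simp add: mr algebra_simps)
  have "(1 + x) ^ m \<le> exp x ^ m" using x by (intro power_mono) auto
  also have "\<dots> = exp (x * m)" by (simp add: exp_of_nat2_mult)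
  finally have "(1 + x) ^ m * 2 ^ (764 * n + 1) \<le> exp (x * m) * 2 ^ (764 * n + 1)"
    by (rule mult_right_mono) simp
  also have "\<dots> = exp (x * m + ln 2 * (764 * real n + 1))"
    unfolding pow2 exp_add by simp
  also have "\<dots> < exp (ln 2 * K)" using * by simp
  also have "\<dots> = 2 ^ K" unfolding pow2 ..
  finally have "(1 + x) ^ m * 2 ^ (764 * n + 1) < 2 ^ K" .
  moreover have "(2::real) ^ (764 * n + 1) = 2 ^ (756 * n) * 2 * 2 ^ (8 * n)"
  proof -
    have "764 * n + 1 = 756 * n + 1 + 8 * n" by simp
    then show ?thesis by (simp only: power_add power_one_right)
  qed
  ultimately show ?thesis unfolding x_def K_def by (simp only: mult.assoc)
qed

text \<open>Multiplied by \<open>2 ^ 74\<close>, the right side is at least \<open>n * n * d\<close>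
  because \<open>n < 2 ^ 37 * (a + 1)\<close>. On the left, the term with 40, the term with 36 and
  the rest are at most the fractions 40/128, \<open>36 / 2 ^ 18\<close> and 1/4 of that.\<close>

lemma booster_numerics:
  fixes n d :: nat
  assumes d: "d \<ge> 2 ^ 92" and n: "n \<ge> 2 ^ 76 * (32 + 3 * d\<^sup>2)"
  shows "n * (40 * (n * d div 2 ^ 81) + 36 * n + 32 + 3 * d\<^sup>2) \<le> (n div 2 ^ 37 + 1)\<^sup>2 * d"
proof -
  define a where "a = n div 2 ^ 37"
  define K where "K = n * d div 2 ^ 81"
  have "n < 2 ^ 37 * (a + 1)"
    unfolding a_def using mult_div_mod_eq[of "2 ^ 37" n] mod_less_divisor[of "2 ^ 37" n] by simp
  then have "n * n \<le> (2 ^ 37 * (a + 1)) * (2 ^ 37 * (a + 1))" by (intro mult_mono) auto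
  then have "n * n * d \<le> (2 ^ 37 * (a + 1)) * (2 ^ 37 * (a + 1)) * d" by (rule mult_right_mono) simp
  also have "\<dots> = 2 ^ 74 * ((a + 1)\<^sup>2 * d)" by (simp add: power2_eq_square algebra_simps)
  finally have A: "n * n * d \<le> 2 ^ 74 * ((a + 1)\<^sup>2 * d)" .
  have K: "K * 2 ^ 81 \<le> n * d" unfolding K_def by (rule div_times_less_eq_dividend)
  have D: "n * 2 ^ 92 \<le> n * d" using d by (intro mult_left_mono) auto
  have N: "2 ^ 76 * (32 + 3 * d\<^sup>2) \<le> n * d"
    using n d by (metis (no_types, lifting) One_nat_def le_trans mult_le_mono2 nat_mult_1_right one_le_numeral one_le_power)
  have "2 ^ 74 * (40 * K + 36 * n + 32 + 3 * d\<^sup>2) \<le> n * d"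
  proof -
    define M :: nat where "M = 2 ^ 74"
    have "128 * (M * K) \<le> n * d" using K by (simp add: M_def mult.commute)
    moreover have "2 ^ 18 * (M * n) \<le> n * d" using D by (simp add: M_def mult.commute)
    moreover have "4 * (M * (32 + 3 * d\<^sup>2)) \<le> n * d" using N by (simp add: M_def algebra_simps)
    moreover have "M * (40 * K + 36 * n + 32 + 3 * d\<^sup>2) = 40 * (M * K) + 36 * (M * n) + M * (32 + 3 * d\<^sup>2)"
      by (simp add: algebra_simps)
    moreover have "40 * A + 36 * B + C \<le> P" if "128 * A \<le> P" "2 ^ 18 * B \<le> P" "4 * C \<le> P"
      for A B C P :: nat
      using that by simp
    ultimately show ?thesis unfolding M_def[symmetric] by (simp only:)
  qed
  then have "n * (2 ^ 74 * (40 * K + 36 * n + 32 + 3 * d\<^sup>2)) \<le> n * (n * d)" by (rule mult_left_mono) simp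
  then have "2 ^ 74 * (n * (40 * K + 36 * n + 32 + 3 * d\<^sup>2)) \<le> 2 ^ 74 * ((a + 1)\<^sup>2 * d)"
    using A by (simp only: mult.assoc mult.left_commute)
  then have "n * (40 * K + 36 * n + 32 + 3 * d\<^sup>2) \<le> (a + 1)\<^sup>2 * d"
    unfolding mult_le_cancel1 by simp
  then show ?thesis unfolding a_def K_def .
qed

section \<open>Combination of the exceptional events and passage to the limit\<close>

text \<open>Maker can fail only if every choice of reserved edges is locally dense
  (\<open>Bad1\<close>) or some sparse non-Hamiltonian expander has at most \<open>K\<close>
  boosters in \<open>G\<close> (\<open>Bad2\<close>). Their shares are at most
  \<open>2 ^ 38 / card V\<close> and \<open>1 / card V\<close>.\<close>

lemma few_losing_graphs:
  fixes V :: "'v set"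
  assumes V: "finite V" and d: "d \<ge> 2 ^ 92" and n: "card V \<ge> 2 ^ 76 * (32 + 3 * d\<^sup>2)"
  shows "real (card {G \<in> regulars d V {}. \<not> maker_wins_hamiltonicity V G}) \<le>
    (2 ^ 38 + 1) / card V * card (regulars d V {})"
proof -
  let ?n = "card V" and ?\<Omega> = "regulars d V {}"
  define a where "a = ?n div 2 ^ 37"
  define K where "K = ?n * d div 2 ^ 81"
  \<comment> \<open>Small enough that eight blocks fit into the edges owned by a vertex, large
    enough for \<open>d \<le> 64 * r\<close>.\<close>
  define r where "r = d div 32"
  have d1: "d \<ge> 64" by (rule order_trans[OF _ d]) simp
  have "2 ^ 76 \<le> 2 ^ 76 * (32 + 3 * d\<^sup>2)" by simp
  then have n76: "2 ^ 76 \<le> ?n" using n by (rule order_trans)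
  then have n37: "2 ^ 37 \<le> ?n" by (rule order_trans[rotated]) simp
  have n3: "?n \<ge> 3" by (rule order_trans[OF _ n37]) simp
  have Vne: "V \<noteq> {}" using n3 by auto
  have a1: "a \<ge> 1" unfolding a_def using n37 div_le_mono[OF n37, of "2 ^ 37"] by simp
  have a37: "a * 2 ^ 37 \<le> ?n" unfolding a_def by (rule div_times_less_eq_dividend)
  then have a3: "3 * a \<le> ?n" by simp
  have r: "d \<le> 64 * r" "16 * r < d" using d1 unfolding r_def by linarith+
  have small: "?n + 4 * d\<^sup>2 + 4 * d \<le> ?n * d"
  proof -
    have "d \<le> d\<^sup>2" by (simp add: power2_eq_square)
    then have "4 * d\<^sup>2 + 4 * d \<le> ?n" using n by simp
    moreover have "?n * 2 \<le> ?n * d" using d1 by (intro mult_left_mono) auto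
    ultimately show ?thesis by linarith
  qed
  have fin\<Omega>: "finite ?\<Omega>" by (rule finite_regulars[OF V])
  have simple: "simple_graph V G" if "G \<in> ?\<Omega>" for G
    using that by (simp add: regulars_def regular_graph_def)
  have "\<forall>G\<in>?\<Omega>. \<exists>B. block_system V G r B"
  proof
    fix G assume G: "G \<in> ?\<Omega>"
    show "\<exists>B. block_system V G r B"
    proof (rule block_system_exists[OF simple[OF G]])
      show "16 * r < degree G v" if "v \<in> V" for v
        using G that r by (simp add: regulars_def regular_graph_def)
    qed
  qed
  then have "\<exists>Bl. \<forall>G\<in>?\<Omega>. block_system V G r (Bl G)" by (rule bchoice)
  then obtain Bl where Bl: "\<And>G. G \<in> ?\<Omega> \<Longrightarrow> block_system V G r (Bl G)" by blast
  define Bad1 where "Bad1 = {G \<in> ?\<Omega>. \<forall>g\<in>PiE (slots V) (Bl G). locally_dense V a (g ` slots V)}"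
  define Bad2 where "Bad2 = {G \<in> ?\<Omega>. \<exists>H\<subseteq>G. card H \<le> 9 * ?n \<and> expander V a H \<and> \<not> hamiltonian V H \<and>
      card (G \<inter> boosters V H) \<le> K}"
  \<comment> \<open>\<open>R\<close> bounds the number of subgraphs with at most
    \<open>9 * ?n\<close> edges; its floor \<open>L\<close> is the natural number that
    \<open>few_unboosted\<close> takes.\<close>
  define R :: real where "R = (1 + 1 / 2 ^ 84) ^ (?n * d div 2) * 2 ^ (756 * ?n)"
  define L where "L = nat \<lfloor>R\<rfloor>"
  have cards: "card {H. H \<subseteq> G \<and> card H \<le> 9 * ?n} \<le> L \<and> R * 2 * 2 ^ (8 * ?n) < 2 ^ K" if G: "G \<in> ?\<Omega>" for G
  proof -
    have GE: "2 * card G = ?n * d" "finite G" using G regular_graph_edges by (auto simp: regulars_def)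
    have m: "card G = ?n * d div 2" using GE(1) by linarith
    have "card {H. H \<subseteq> G \<and> card H \<le> 9 * ?n} * (1 / 2 ^ 84) ^ (9 * ?n) \<le> (1 + 1 / 2 ^ 84 :: real) ^ card G"
      by (rule card_small_subsets[OF GE(2)]) simp_all
    moreover have "(1 / 2 ^ 84 :: real) ^ (9 * ?n) = 1 / 2 ^ (756 * ?n)"
      by (simp only: power_one_over power_mult[symmetric]) simp
    ultimately have "card {H. H \<subseteq> G \<and> card H \<le> 9 * ?n} * (1 / 2 ^ (756 * ?n)) \<le> (1 + 1 / 2 ^ 84 :: real) ^ card G"
      by (simp only:)
    then have "real (card {H. H \<subseteq> G \<and> card H \<le> 9 * ?n}) \<le> R"
      unfolding R_def m by (simp only: mult_1_right times_divide_eq_right pos_divide_le_eq zero_less_power zero_less_numeral)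
    then have "card {H. H \<subseteq> G \<and> card H \<le> 9 * ?n} \<le> L" unfolding L_def by (rule le_nat_floor)
    moreover have "R * 2 * 2 ^ (8 * ?n) < 2 ^ K"
      unfolding R_def K_def m[symmetric] by (rule entropy_numerics[OF d _ GE(1)]) (use n3 in linarith)
    ultimately show ?thesis ..
  qed
  have big: "?n * (40 * K + 36 * ?n + 32 + 3 * d\<^sup>2) \<le> (a + 1)\<^sup>2 * d"
    unfolding K_def a_def by (rule booster_numerics[OF d n])
  have "{G \<in> ?\<Omega>. \<not> maker_wins_hamiltonicity V G} \<subseteq> Bad1 \<union> Bad2"
  proof (rule subsetI, rule ccontr)
    fix G assume "G \<in> {G \<in> ?\<Omega>. \<not> maker_wins_hamiltonicity V G}" and nb: "G \<notin> Bad1 \<union> Bad2"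
    then have G: "G \<in> ?\<Omega>" "\<not> maker_wins_hamiltonicity V G" by auto
    obtain g where g: "g \<in> PiE (slots V) (Bl G)" "\<not> locally_dense V a (g ` slots V)"
      using nb G(1) by (auto simp: Bad1_def)
    have "maker_wins_hamiltonicity V G"
    proof (rule maker_wins_if_boosted[OF simple[OF G(1)] Bl[OF G(1)] g a3 Vne])
      fix H assume "H \<subseteq> G" "card H \<le> 9 * ?n" "expander V a H" "\<not> hamiltonian V H"
      then show "K \<le> card (G \<inter> boosters V H)" using nb G(1) by (fastforce simp: Bad2_def)
    next
      let ?c = "card {H. H \<subseteq> G \<and> card H \<le> 9 * ?n}"
      have "real (2 * ?c * 2 ^ (8 * ?n)) \<le> R * 2 * 2 ^ (8 * ?n)"
      proof -
        have "R \<ge> 0" by (simp add: R_def)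
        then have "real L \<le> R" unfolding L_def by simp
        moreover have "real ?c \<le> real L" using cards[OF G(1)] by simp
        ultimately have "real ?c * 2 * 2 ^ (8 * ?n) \<le> R * 2 * 2 ^ (8 * ?n)"
          by (intro mult_right_mono) auto
        then show ?thesis by (simp add: mult_ac)
      qed
      also have "\<dots> < 2 ^ K" using cards[OF G(1)] by simp
      finally have "real (2 * ?c * 2 ^ (8 * ?n)) < real (2 ^ K)" by simp
      then show "2 * ?c * 2 ^ (8 * ?n) < 2 ^ K" by (simp only: of_nat_less_iff)
    qed
    then show False using G(2) by simp
  qed
  moreover have finB: "finite Bad1" "finite Bad2" using fin\<Omega> by (auto simp: Bad1_def Bad2_def)
  ultimately have "card {G \<in> ?\<Omega>. \<not> maker_wins_hamiltonicity V G} \<le> card (Bad1 \<union> Bad2)"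
    by (intro card_mono) auto
  also have "\<dots> \<le> card Bad1 + card Bad2" by (rule card_Un_le)
  finally have "real (card {G \<in> ?\<Omega>. \<not> maker_wins_hamiltonicity V G}) \<le> card Bad1 + real (card Bad2)"
    by linarith
  also have "real (card Bad1) \<le> 2 ^ 38 / ?n * card ?\<Omega>"
    unfolding Bad1_def by (rule few_locally_dense[OF V Vne a37 small _ r(1) Bl]) (use d1 in simp_all)
  also have "real (card Bad2) \<le> 1 / ?n * card ?\<Omega>"
  proof (cases "?\<Omega> = {}")
    case True
    then show ?thesis by (simp add: Bad2_def)
  next
    case False
    then obtain G where "G \<in> ?\<Omega>" by auto
    then have R: "R * 2 * 2 ^ (8 * ?n) < 2 ^ K" using cards by blast
    have "R \<ge> 0" by (simp add: R_def)
    then have L: "real L \<le> R" unfolding L_def by simp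
    have "card Bad2 * 2 ^ K \<le> 2 * L * card ?\<Omega>"
      unfolding Bad2_def by (rule few_unboosted[OF V n3 a1 _ big]) (use d1 cards in auto)
    then have "real (card Bad2 * 2 ^ K) \<le> real (2 * L * card ?\<Omega>)" by (simp only: of_nat_le_iff)
    then have "real (card Bad2 * 2 ^ K) * 2 ^ (8 * ?n) \<le> real (2 * L * card ?\<Omega>) * 2 ^ (8 * ?n)"
      by (intro mult_right_mono) auto
    also have "\<dots> = (real L * 2 * 2 ^ (8 * ?n)) * card ?\<Omega>" by simp
    also have "\<dots> \<le> (R * 2 * 2 ^ (8 * ?n)) * card ?\<Omega>" using L by (intro mult_right_mono) auto
    also have "\<dots> \<le> 2 ^ K * real (card ?\<Omega>)" using R by (intro mult_right_mono) auto
    finally have "2 ^ K * (real (card Bad2) * 2 ^ (8 * ?n)) \<le> 2 ^ K * real (card ?\<Omega>)" by (simp add: mult_ac)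
    then have "real (card Bad2) * 2 ^ (8 * ?n) \<le> card ?\<Omega>" by simp
    \<comment> \<open>The factor \<open>2 ^ (8 * ?n)\<close> of the entropy bound, introduced for
      the booster sets, is spent here on the factor \<open>?n\<close>.\<close>
    moreover have "real (card Bad2) * ?n \<le> real (card Bad2) * 2 ^ (8 * ?n)"
    proof (rule mult_left_mono)
      have "?n \<le> 8 * ?n" by simp
      also have "\<dots> \<le> 2 ^ (8 * ?n)" by (rule less_imp_le) (rule less_exp)
      finally have "real ?n \<le> real (2 ^ (8 * ?n))" by (simp only: of_nat_le_iff)
      then show "real ?n \<le> 2 ^ (8 * ?n)" by simp
    qed simp
    ultimately have "real (card Bad2) * ?n \<le> card ?\<Omega>" by linarith
    then show ?thesis using n3 by (simp add: field_simps)
  qed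
  finally show ?thesis by (simp add: add_divide_distrib distrib_right)
qed

theorem theorem6:
  shows "\<exists>d\<^sub>0 > (0::nat). \<forall>d \<ge> d\<^sub>0.
    ((\<lambda>n. measure_pmf.prob (random_regular_graph d n)
             {E. maker_wins_hamiltonicity {1..n} E})
       \<longlongrightarrow> 1) (inf sequentially (principal {n. even (d * n)}))"
proof (intro exI[of _ "2 ^ 92"] conjI allI impI)
  \<comment> \<open>\<open>2 ^ 92\<close> is the degree bound under which
    \<open>entropy_numerics\<close> and \<open>booster_numerics\<close> are established.\<close>
  fix d :: nat assume d: "d \<ge> 2 ^ 92"
  let ?F = "inf sequentially (principal {n. even (d * n)})"
  let ?p = "\<lambda>n. measure_pmf.prob (random_regular_graph d n) {E. maker_wins_hamiltonicity {1..n} E}"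
  have bound: "1 - (2 ^ 38 + 1) / real n \<le> ?p n"
    if n: "n \<ge> 2 ^ 76 * (32 + 3 * d\<^sup>2)" and ev: "even (d * n)" for n
  proof -
    let ?V = "{1..n}"
    let ?\<Omega> = "regulars d ?V {}"
    have "d \<le> d\<^sup>2" by (simp add: power2_eq_square)
    then have dn: "d < n" using n by simp
    have \<Omega>: "?\<Omega> = {E. regular_graph d ?V E}" by (simp add: regulars_def)
    have fin: "finite ?\<Omega>" by (rule finite_regulars) simp
    \<comment> \<open>Evenness of \<open>d * n\<close> enters here: \<open>pmf_of_set\<close> is
      uniform on a nonempty finite set.\<close>
    have ne: "?\<Omega> \<noteq> {}" using regular_graph_exists[OF dn ev] \<Omega> by auto
    let ?L = "{G \<in> ?\<Omega>. \<not> maker_wins_hamiltonicity ?V G}"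
    have "?p n = card (?\<Omega> \<inter> {E. maker_wins_hamiltonicity ?V E}) / card ?\<Omega>"
      unfolding random_regular_graph_def \<Omega>[symmetric] by (rule measure_pmf_of_set[OF ne fin])
    also have "?\<Omega> \<inter> {E. maker_wins_hamiltonicity ?V E} = ?\<Omega> - ?L" by auto
    also have "card (?\<Omega> - ?L) = card ?\<Omega> - card ?L"
      by (rule card_Diff_subset) (use fin in auto)
    also have "real (card ?\<Omega> - card ?L) = real (card ?\<Omega>) - card ?L"
      by (rule of_nat_diff) (use fin in \<open>auto intro: card_mono\<close>)
    finally have p: "?p n = (real (card ?\<Omega>) - card ?L) / card ?\<Omega>" .
    have "real (card ?L) \<le> (2 ^ 38 + 1) / n * card ?\<Omega>"
      using few_losing_graphs[OF _ d, of ?V] n by simp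
    moreover have "real (card ?\<Omega>) > 0" using fin ne by (simp add: card_gt_0_iff)
    ultimately show ?thesis unfolding p by (simp add: field_simps)
  qed
  have "\<forall>\<^sub>F n in sequentially. n \<ge> 2 ^ 76 * (32 + 3 * d\<^sup>2)" by (rule eventually_ge_at_top)
  \<comment> \<open>The principal filter supplies the evenness that \<open>bound\<close>
    requires.\<close>
  then have low: "\<forall>\<^sub>F n in ?F. 1 - (2 ^ 38 + 1) / real n \<le> ?p n"
    unfolding eventually_inf_principal by (rule eventually_mono) (use bound in blast)
  have "(\<lambda>n. 1 - (2 ^ 38 + 1) / real n) \<longlonglongrightarrow> 1 - 0"
    by (intro tendsto_intros lim_const_over_n)
  then have lim: "((\<lambda>n. 1 - (2 ^ 38 + 1) / real n) \<longlongrightarrow> 1) ?F"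
    by (simp add: tendsto_mono[OF inf_le1])
  show "(?p \<longlongrightarrow> 1) ?F"
    by (rule tendsto_sandwich[OF low _ lim tendsto_const]) (auto intro: always_eventually)
qed simp

end
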